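(* Let $\Sigma$ be a closed oriented surface of genus $\geq2$ with an area form $\rho$ of total area $-\pi\chi(\Sigma)$. Given $(J,\sigma)\in\widetilde{\mathcal{MS}}_0(\Sigma,\rho)$ and $(\dot J,\dot\sigma)\in T_{(J,\sigma)}T^*\mathcal J(\Sigma)$, with $g=g_J=\rho(\cdot,J\cdot)$ and $f=\sqrt{1+\|\sigma\|^2}$, the following conditions are equivalent: i) the pair $(\dot J,\dot\sigma)$ satisfies $$\mathrm{div}_g(f^{-1}g^{-1}\dot\sigma_0)=-f^{-1}\langle\nabla^g_{J\bullet}\sigma\,|\,\dot J\rangle,\qquad \mathrm{div}_g\dot J=-f^{-2}\langle\nabla^g_{J\bullet}\sigma,\dot\sigma_0\rangle;$$ ii) the endomorphisms $Q^\pm=f^{-1}g^{-1}\dot\sigma_0\pm\dot J$ satisfy $$\mathrm{div}_g(Q^+JJ_l)=-\langle\nabla^g_{J\bullet}\sigma\,|\,Q^+\rangle,\qquad \mathrm{div}_g(Q^-JJ_r)=\langle\nabla^g_{J\bullet}\sigma\,|\,Q^-\rangle,$$ where $J_l,J_r$ are the almost complex structures of the components of the Mess map; iii) the endomorphisms $Q^\pm$ satisfy $$\mathrm{div}_gQ^+=-f^{-1}\langle\nabla^g_{J\bullet}\sigma\,|\,Q^+\rangle,\qquad \mathrm{div}_gQ^-=f^{-1}\langle\nabla^g_{J\bullet}\sigma\,|\,Q^-\rangle.$$ Moreover, when these conditions hold, the $1$-forms $\mathrm{div}_{h_l}\dot J_l$ and $\mathrm{div}_{h_r}\dot J_r$ are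 exact, where $h_l=\rho(\cdot,J_l\cdot)$, $h_r=\rho(\cdot,J_r\cdot)$ and $\dot J_l,\dot J_r$ are the first order variations of $J_l,J_r$ along $(\dot J,\dot\sigma)$.
   Context: $T^*\mathcal J(\Sigma)$ is the space of pairs $(J,\sigma)$, with $J$ a smooth almost complex structure on $\Sigma$ such that $g_J=\rho(\cdot,J\cdot)$ is positive definite and $\sigma$ a smooth symmetric 2-tensor with $\sigma(J\cdot,J\cdot)=-\sigma$. $g^{-1}\sigma$ denotes the endomorphism with $\sigma=g(\cdot,(g^{-1}\sigma)\cdot)$. $\langle\sigma|A\rangle=\frac12\mathrm{tr}(g^{-1}\sigma A)$ for an endomorphism $A$; $\langle\sigma,\sigma'\rangle=\frac12\mathrm{tr}(g^{-1}\sigma g^{-1}\sigma')$; $\|\sigma\|^2=\langle\sigma,\sigma\rangle$. $T_{(J,\sigma)}T^*\mathcal J(\Sigma)$ is the space of pairs $(\dot J,\dot\sigma)$ with $\dot J\in\Gamma(\mathrm{End}(T\Sigma))$, $\dot JJ+J\dot J=0$, and $\dot\sigma=\dot\sigma_0-\langle\sigma|J\dot J\rangle g$ with $\dot\sigma_0$ symmetric and $g$-traceless (the $g$-traceless part of $\dot\sigma$). $\widetilde{\mathcal{MS}}_0(\Sigma,\rho)$ is the set of $(J,\sigma)\in T^*\mathcal J(\Sigma)$ such that $h=(1+f)g_J$, $B=h^{-1}\sigma$ satisfy the Gauss-Codazzi equations $K_h=-1-\det B$ and $d^{\nabla^h}B=0$, where $(d^{\nabla^h}B)(X,Y)=(\nabla^h_XB)Y-(\nabla^h_YB)X$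 (the second is equivalent to $\sigma$ being the real part of a $J$-holomorphic quadratic differential). For a Riemannian metric $G$ with Levi-Civita connection $\nabla^G$ and an endomorphism field $A$, $(\mathrm{div}_GA)(X)=\sum_iG((\nabla^G_{e_i}A)X,e_i)$, $(e_i)$ a local $G$-orthonormal frame. $\langle\nabla^g_{J\bullet}\sigma|A\rangle$ is the 1-form $X\mapsto\langle\nabla^g_{JX}\sigma|A\rangle$, and similarly $\langle\nabla^g_{J\bullet}\sigma,\dot\sigma_0\rangle$. The Mess map is $(J,\sigma)\mapsto(J_l,J_r)$, $J_l=(\mathbf 1-JB)^{-1}J(\mathbf 1-JB)=fJ+g^{-1}\sigma$, $J_r=(\mathbf 1+JB)^{-1}J(\mathbf 1+JB)=fJ-g^{-1}\sigma$. *)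

theory Defs
  imports "HOL-Analysis.Analysis" "HOL-Homology.Homology"
begin

section \<open>Matrix preliminaries\<close>

type_synonym mat2 = "real^2^2"

text \<open>
  A chart identifies each tangent space with \<open>real^2\<close>. An endomorphism \<open>A\<close> acts by \<open>A *v X\<close>; a
  bilinear form with matrix \<open>s\<close> is \<open>X, Y \<mapsto> X \<bullet> (s *v Y)\<close>. Hence \<open>b(_, A _)\<close> has matrix
  \<open>b ** A\<close>, \<open>b(A _, A _)\<close> has matrix \<open>transpose A ** b ** A\<close>, and the endomorphism \<open>G\<^sup>-\<^sup>1 s\<close>
  determined by \<open>s = G(_, (G\<^sup>-\<^sup>1 s) _)\<close> has matrix \<open>matrix_inv G ** s\<close>.
\<close>

definition bil :: "mat2 \<Rightarrow> real^2 \<Rightarrow> real^2 \<Rightarrow> real" where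
  "bil s X Y = X \<bullet> (s *v Y)"

definition symmetric_form :: "mat2 \<Rightarrow> bool" where
  "symmetric_form s \<longleftrightarrow> transpose s = s"

definition pos_def_form :: "mat2 \<Rightarrow> bool" where
  "pos_def_form s \<longleftrightarrow> (\<forall>X. X \<noteq> 0 \<longrightarrow> bil s X X > 0)"

definition pair_endo :: "mat2 \<Rightarrow> mat2 \<Rightarrow> mat2 \<Rightarrow> real" where
  "pair_endo G s A = trace (matrix_inv G ** s ** A) / 2"

definition inner_form :: "mat2 \<Rightarrow> mat2 \<Rightarrow> mat2 \<Rightarrow> real" where
  "inner_form G s s' = trace (matrix_inv G ** s ** (matrix_inv G ** s')) / 2"

definition traceless_part :: "mat2 \<Rightarrow> mat2 \<Rightarrow> mat2" where
  "traceless_part G s = s - (trace (matrix_inv G ** s) / 2) *\<^sub>R G"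


section \<open>Riemannian calculus in a coordinate domain\<close>

definition christoffel :: "(real^2 \<Rightarrow> mat2) \<Rightarrow> real^2 \<Rightarrow> 2 \<Rightarrow> 2 \<Rightarrow> 2 \<Rightarrow> real" where
  "christoffel G x k i j =
     (let D = (\<lambda>i a b. frechet_derivative G (at x) (axis i 1) $ a $ b)
      in (\<Sum>l\<in>UNIV. matrix_inv (G x) $ k $ l * (D i j l + D j i l - D l i j)) / 2)"

text \<open>
  The connection form: \<open>\<nabla>\<^sub>X Y = D\<^sub>X Y + connection G x X *v Y\<close>.
\<close>

definition connection :: "(real^2 \<Rightarrow> mat2) \<Rightarrow> real^2 \<Rightarrow> real^2 \<Rightarrow> mat2" where
  "connection G x X = (\<chi> k j. \<Sum>i\<in>UNIV. X $ i * christoffel G x k i j)"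

definition nabla_endo :: "(real^2 \<Rightarrow> mat2) \<Rightarrow> (real^2 \<Rightarrow> mat2) \<Rightarrow> real^2 \<Rightarrow> real^2 \<Rightarrow> mat2" where
  "nabla_endo G A x X =
     frechet_derivative A (at x) X + connection G x X ** A x - A x ** connection G x X"

definition nabla_form :: "(real^2 \<Rightarrow> mat2) \<Rightarrow> (real^2 \<Rightarrow> mat2) \<Rightarrow> real^2 \<Rightarrow> real^2 \<Rightarrow> mat2" where
  "nabla_form G s x X =
     frechet_derivative s (at x) X - transpose (connection G x X) ** s x - s x ** connection G x X"

text \<open>
  The curvature \<open>R(X, Y)\<close>, with \<open>X\<close> and \<open>Y\<close> extended to constant (hence commuting) vector fields,
  and the Gauss curvature \<open>G(R(\<partial>\<^sub>1, \<partial>\<^sub>2)\<partial>\<^sub>2, \<partial>\<^sub>1) / det G\<close>.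
\<close>

definition riemann :: "(real^2 \<Rightarrow> mat2) \<Rightarrow> real^2 \<Rightarrow> real^2 \<Rightarrow> real^2 \<Rightarrow> mat2" where
  "riemann G x X Y =
     frechet_derivative (\<lambda>y. connection G y Y) (at x) X
     - frechet_derivative (\<lambda>y. connection G y X) (at x) Y
     + connection G x X ** connection G x Y - connection G x Y ** connection G x X"

definition gauss_curvature :: "(real^2 \<Rightarrow> mat2) \<Rightarrow> real^2 \<Rightarrow> real" where
  "gauss_curvature G x =
     bil (G x) (riemann G x (axis 1 1) (axis 2 1) *v axis 2 1) (axis 1 1) / det (G x)"

definition orthonormal_frame :: "mat2 \<Rightarrow> (2 \<Rightarrow> real^2) \<Rightarrow> bool" where
  "orthonormal_frame G e \<longleftrightarrow> (\<forall>i j. bil G (e i) (e j) = (if i = j then 1 else 0))"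

text \<open>
  The divergence does not depend on the chosen frame, see \<open>divergence_eq_frame\<close> below.
\<close>

definition divergence :: "(real^2 \<Rightarrow> mat2) \<Rightarrow> (real^2 \<Rightarrow> mat2) \<Rightarrow> real^2 \<Rightarrow> real^2 \<Rightarrow> real" where
  "divergence G A x X =
     (let e = (SOME e. orthonormal_frame (G x) e)
      in \<Sum>i\<in>UNIV. bil (G x) (nabla_endo G A x (e i) *v X) (e i))"


section \<open>Smooth oriented surfaces and their tensor fields\<close>

primrec Ck_on :: "nat \<Rightarrow> (real^2) set \<Rightarrow> (real^2 \<Rightarrow> 'b::real_normed_vector) \<Rightarrow> bool" where
  "Ck_on 0 U F \<longleftrightarrow> continuous_on U F"
| "Ck_on (Suc k) U F \<longleftrightarrow>
     (\<forall>x\<in>U. F differentiable (at x)) \<and>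
     (\<forall>v. Ck_on k U (\<lambda>x. frechet_derivative F (at x) v))"

definition smooth_on :: "(real^2) set \<Rightarrow> (real^2 \<Rightarrow> 'b::real_normed_vector) \<Rightarrow> bool" where
  "smooth_on U F \<longleftrightarrow> (\<forall>k. Ck_on k U F)"

text \<open>A chart is a domain together with a coordinate map, whose values off the domain are irrelevant.\<close>

type_synonym 'a chart = "'a set \<times> ('a \<Rightarrow> real^2)"

definition coords :: "'a chart \<Rightarrow> (real^2) set" where
  "coords c = snd c ` fst c"

definition chart_inv :: "'a chart \<Rightarrow> real^2 \<Rightarrow> 'a" where
  "chart_inv c = inv_into (fst c) (snd c)"

definition overlap :: "'a chart \<Rightarrow> 'a chart \<Rightarrow> (real^2) set" where
  "overlap c d = snd c ` (fst c \<inter> fst d)"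

definition transition :: "'a chart \<Rightarrow> 'a chart \<Rightarrow> real^2 \<Rightarrow> real^2" where
  "transition c d = snd d \<circ> chart_inv c"

definition closed_oriented_surface :: "'a topology \<Rightarrow> 'a chart set \<Rightarrow> bool" where
  "closed_oriented_surface S \<A> \<longleftrightarrow>
     topspace S \<noteq> {} \<and> compact_space S \<and> connected_space S \<and> Hausdorff_space S \<and>
     (\<Union>c\<in>\<A>. fst c) = topspace S \<and>
     (\<forall>c\<in>\<A>. openin S (fst c) \<and> open (coords c) \<and>
        homeomorphic_map (subtopology S (fst c)) (top_of_set (coords c)) (snd c)) \<and>
     (\<forall>c\<in>\<A>. \<forall>d\<in>\<A>. smooth_on (overlap c d) (transition c d) \<and>
        (\<forall>x\<in>overlap c d. det (jacobian (transition c d) (at x)) > 0))"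

text \<open>
  The rank of an abelian group (written multiplicatively) is the maximal size of an integrally
  independent set. For a closed surface the supremum is attained and only finitely many Betti
  numbers are nonzero.
\<close>

definition int_independent :: "('b, 'm) monoid_scheme \<Rightarrow> 'b set \<Rightarrow> bool" where
  "int_independent G B \<longleftrightarrow> finite B \<and> B \<subseteq> carrier G \<and>
     (\<forall>a :: 'b \<Rightarrow> int. finprod G (\<lambda>b. b [^]\<^bsub>G\<^esub> a b) B = \<one>\<^bsub>G\<^esub> \<longrightarrow> (\<forall>b\<in>B. a b = 0))"

definition abelian_rank :: "('b, 'm) monoid_scheme \<Rightarrow> nat" where
  "abelian_rank G = (SUP B\<in>{B. int_independent G B}. card B)"

definition betti :: "nat \<Rightarrow> 'a topology \<Rightarrow> nat" where
  "betti p S = abelian_rank (homology_group (int p) S)"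

definition euler_char :: "'a topology \<Rightarrow> int" where
  "euler_char S = (\<Sum>p | betti p S \<noteq> 0. (-1) ^ p * int (betti p S))"

text \<open>For a closed oriented surface the first homology has rank twice the genus.\<close>

definition genus :: "'a topology \<Rightarrow> nat" where
  "genus S = betti 1 S div 2"

text \<open>
  A tensor field is given by its components in each chart, as functions on the coordinate domain,
  subject to the transformation law; an endomorphism field and a bilinear form field differ only
  in the latter.
\<close>

type_synonym 'a tensor = "'a chart \<Rightarrow> real^2 \<Rightarrow> mat2"

definition endo_field :: "'a chart set \<Rightarrow> 'a tensor \<Rightarrow> bool" where
  "endo_field \<A> A \<longleftrightarrow>
     (\<forall>c\<in>\<A>. smooth_on (coords c) (A c)) \<and>
     (\<forall>c\<in>\<A>. \<forall>d\<in>\<A>. \<forall>x\<in>overlap c d.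
        A d (transition c d x) ** jacobian (transition c d) (at x) =
        jacobian (transition c d) (at x) ** A c x)"

definition form_field :: "'a chart set \<Rightarrow> 'a tensor \<Rightarrow> bool" where
  "form_field \<A> s \<longleftrightarrow>
     (\<forall>c\<in>\<A>. smooth_on (coords c) (s c)) \<and>
     (\<forall>c\<in>\<A>. \<forall>d\<in>\<A>. \<forall>x\<in>overlap c d.
        s c x = transpose (jacobian (transition c d) (at x)) ** s d (transition c d x)
                ** jacobian (transition c d) (at x))"

definition smooth_function :: "'a chart set \<Rightarrow> ('a \<Rightarrow> real) \<Rightarrow> bool" where
  "smooth_function \<A> u \<longleftrightarrow> (\<forall>c\<in>\<A>. smooth_on (coords c) (u \<circ> chart_inv c))"

text \<open>1-forms, as functions of the chart, the coordinate point and the tangent vector.\<close>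

type_synonym 'a covector = "'a chart \<Rightarrow> real^2 \<Rightarrow> real^2 \<Rightarrow> real"

definition eq_forms :: "'a chart set \<Rightarrow> 'a covector \<Rightarrow> 'a covector \<Rightarrow> bool" where
  "eq_forms \<A> \<alpha> \<beta> \<longleftrightarrow> (\<forall>c\<in>\<A>. \<forall>x\<in>coords c. \<forall>X. \<alpha> c x X = \<beta> c x X)"

definition exact_form :: "'a chart set \<Rightarrow> 'a covector \<Rightarrow> bool" where
  "exact_form \<A> \<alpha> \<longleftrightarrow>
     (\<exists>u. smooth_function \<A> u \<and>
        eq_forms \<A> \<alpha> (\<lambda>c x X. frechet_derivative (u \<circ> chart_inv c) (at x) X))"

definition area_form :: "'a chart set \<Rightarrow> 'a tensor \<Rightarrow> bool" where
  "area_form \<A> \<rho> \<longleftrightarrow> form_field \<A> \<rho> \<and>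
     (\<forall>c\<in>\<A>. \<forall>x\<in>coords c. transpose (\<rho> c x) = - \<rho> c x \<and> \<rho> c x $ 1 $ 2 > 0)"

text \<open>The Borel measure on the surface obtained by integrating the area form.\<close>

definition is_area_measure :: "'a topology \<Rightarrow> 'a chart set \<Rightarrow> 'a tensor \<Rightarrow> 'a measure \<Rightarrow> bool" where
  "is_area_measure S \<A> \<rho> M \<longleftrightarrow>
     space M = topspace S \<and> sets M = sigma_sets (topspace S) {U. openin S U} \<and>
     (\<forall>c\<in>\<A>. \<forall>E\<in>sets M. E \<subseteq> fst c \<longrightarrow>
        emeasure M E = (\<integral>\<^sup>+ x\<in>snd c ` E. ennreal (\<rho> c x $ 1 $ 2) \<partial>lborel))"

definition has_total_area :: "'a topology \<Rightarrow> 'a chart set \<Rightarrow> 'a tensor \<Rightarrow> real \<Rightarrow> bool" where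
  "has_total_area S \<A> \<rho> a \<longleftrightarrow>
     (\<exists>M. is_area_measure S \<A> \<rho> M \<and> emeasure M (topspace S) = ennreal a)"


section \<open>The space of pairs and the Gauss-Codazzi equations\<close>

definition metric_of :: "'a tensor \<Rightarrow> 'a tensor \<Rightarrow> 'a tensor" where
  "metric_of \<rho> J = (\<lambda>c x. \<rho> c x ** J c x)"

definition sharp :: "'a tensor \<Rightarrow> 'a tensor \<Rightarrow> 'a tensor" where
  "sharp g s = (\<lambda>c x. matrix_inv (g c x) ** s c x)"

definition f_fun :: "'a tensor \<Rightarrow> 'a tensor \<Rightarrow> 'a chart \<Rightarrow> real^2 \<Rightarrow> real" where
  "f_fun g \<sigma> = (\<lambda>c x. sqrt (1 + inner_form (g c x) (\<sigma> c x) (\<sigma> c x)))"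

definition TstarJ :: "'a chart set \<Rightarrow> 'a tensor \<Rightarrow> ('a tensor \<times> 'a tensor) set" where
  "TstarJ \<A> \<rho> = {(J, \<sigma>).
     endo_field \<A> J \<and> form_field \<A> \<sigma> \<and>
     (\<forall>c\<in>\<A>. \<forall>x\<in>coords c.
        J c x ** J c x = - mat 1 \<and>
        pos_def_form (metric_of \<rho> J c x) \<and>
        symmetric_form (\<sigma> c x) \<and>
        transpose (J c x) ** \<sigma> c x ** J c x = - \<sigma> c x)}"

definition tangent_TstarJ ::
  "'a chart set \<Rightarrow> 'a tensor \<Rightarrow> 'a tensor \<times> 'a tensor \<Rightarrow> ('a tensor \<times> 'a tensor) set" where
  "tangent_TstarJ \<A> \<rho> = (\<lambda>(J, \<sigma>). {(J', \<sigma>').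
     endo_field \<A> J' \<and> form_field \<A> \<sigma>' \<and>
     (\<forall>c\<in>\<A>. \<forall>x\<in>coords c.
        J' c x ** J c x + J c x ** J' c x = 0 \<and>
        (let G = metric_of \<rho> J c x in
          \<exists>\<sigma>\<^sub>0. symmetric_form \<sigma>\<^sub>0 \<and> trace (matrix_inv G ** \<sigma>\<^sub>0) = 0 \<and>
            \<sigma>' c x = \<sigma>\<^sub>0 - pair_endo G (\<sigma> c x) (J c x ** J' c x) *\<^sub>R G))})"

definition h_metric :: "'a tensor \<Rightarrow> 'a tensor \<Rightarrow> 'a tensor \<Rightarrow> 'a tensor" where
  "h_metric \<rho> J \<sigma> = (let g = metric_of \<rho> J in (\<lambda>c x. (1 + f_fun g \<sigma> c x) *\<^sub>R g c x))"

definition shape_op :: "'a tensor \<Rightarrow> 'a tensor \<Rightarrow> 'a tensor \<Rightarrow> 'a tensor" where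
  "shape_op \<rho> J \<sigma> = sharp (h_metric \<rho> J \<sigma>) \<sigma>"

definition MS0 :: "'a chart set \<Rightarrow> 'a tensor \<Rightarrow> ('a tensor \<times> 'a tensor) set" where
  "MS0 \<A> \<rho> = {(J, \<sigma>) \<in> TstarJ \<A> \<rho>.
     let h = h_metric \<rho> J \<sigma>; B = shape_op \<rho> J \<sigma> in
     \<forall>c\<in>\<A>. \<forall>x\<in>coords c.
       gauss_curvature (h c) x = - 1 - det (B c x) \<and>
       (\<forall>X Y. nabla_endo (h c) (B c) x X *v Y - nabla_endo (h c) (B c) x Y *v X = 0)}"


section \<open>The Mess map and its first variation\<close>

text \<open>The components of the Mess map are algebraic in the values of the area form and of the pair.\<close>

definition shape_at :: "mat2 \<Rightarrow> mat2 \<Rightarrow> mat2 \<Rightarrow> mat2" where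
  "shape_at R J s =
     matrix_inv ((1 + sqrt (1 + inner_form (R ** J) s s)) *\<^sub>R (R ** J)) ** s"

definition mess_l_at :: "mat2 \<Rightarrow> mat2 \<times> mat2 \<Rightarrow> mat2" where
  "mess_l_at R = (\<lambda>(J, s).
     matrix_inv (mat 1 - J ** shape_at R J s) ** J ** (mat 1 - J ** shape_at R J s))"

definition mess_r_at :: "mat2 \<Rightarrow> mat2 \<times> mat2 \<Rightarrow> mat2" where
  "mess_r_at R = (\<lambda>(J, s).
     matrix_inv (mat 1 + J ** shape_at R J s) ** J ** (mat 1 + J ** shape_at R J s))"

definition mess_l :: "'a tensor \<Rightarrow> 'a tensor \<Rightarrow> 'a tensor \<Rightarrow> 'a tensor" where
  "mess_l \<rho> J \<sigma> = (\<lambda>c x. mess_l_at (\<rho> c x) (J c x, \<sigma> c x))"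

definition mess_r :: "'a tensor \<Rightarrow> 'a tensor \<Rightarrow> 'a tensor \<Rightarrow> 'a tensor" where
  "mess_r \<rho> J \<sigma> = (\<lambda>c x. mess_r_at (\<rho> c x) (J c x, \<sigma> c x))"

text \<open>
  The first variation is the derivative of the pointwise formula, which makes sense for all matrices
  near the given pair, in the direction \<open>(J', \<sigma>')\<close>. It is the velocity of the image of any curve
  of pairs with velocity \<open>(J', \<sigma>')\<close>, see \<open>variation_along_curve\<close> below.
\<close>

definition mess_l_variation ::
  "'a tensor \<Rightarrow> 'a tensor \<Rightarrow> 'a tensor \<Rightarrow> 'a tensor \<Rightarrow> 'a tensor \<Rightarrow> 'a tensor" where
  "mess_l_variation \<rho> J \<sigma> J' \<sigma>' = (\<lambda>c x.
     frechet_derivative (mess_l_at (\<rho> c x)) (at (J c x, \<sigma> c x)) (J' c x, \<sigma>' c x))"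

definition mess_r_variation ::
  "'a tensor \<Rightarrow> 'a tensor \<Rightarrow> 'a tensor \<Rightarrow> 'a tensor \<Rightarrow> 'a tensor \<Rightarrow> 'a tensor" where
  "mess_r_variation \<rho> J \<sigma> J' \<sigma>' = (\<lambda>c x.
     frechet_derivative (mess_r_at (\<rho> c x)) (at (J c x, \<sigma> c x)) (J' c x, \<sigma>' c x))"


section \<open>The 1-forms occurring in the equations\<close>

definition div_field :: "'a tensor \<Rightarrow> 'a tensor \<Rightarrow> 'a covector" where
  "div_field G A = (\<lambda>c. divergence (G c) (A c))"

text \<open>The 1-forms sending \<open>X\<close> to \<open>\<langle>\<nabla>\<^sub>J\<^sub>X \<sigma> | A\<rangle>\<close> and to \<open>\<langle>\<nabla>\<^sub>J\<^sub>X \<sigma>, \<tau>\<rangle>\<close>.\<close>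

definition nablaJ_endo :: "'a tensor \<Rightarrow> 'a tensor \<Rightarrow> 'a tensor \<Rightarrow> 'a tensor \<Rightarrow> 'a covector" where
  "nablaJ_endo g J \<sigma> A = (\<lambda>c x X.
     pair_endo (g c x) (nabla_form (g c) (\<sigma> c) x (J c x *v X)) (A c x))"

definition nablaJ_form :: "'a tensor \<Rightarrow> 'a tensor \<Rightarrow> 'a tensor \<Rightarrow> 'a tensor \<Rightarrow> 'a covector" where
  "nablaJ_form g J \<sigma> \<tau> = (\<lambda>c x X.
     inner_form (g c x) (nabla_form (g c) (\<sigma> c) x (J c x *v X)) (\<tau> c x))"

definition traceless_field :: "'a tensor \<Rightarrow> 'a tensor \<Rightarrow> 'a tensor" where
  "traceless_field g s = (\<lambda>c x. traceless_part (g c x) (s c x))"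

section \<open>Two-by-two matrices\<close>


lemma mat2_eq_iff:
  "(A::mat2) = B \<longleftrightarrow> A$1$1 = B$1$1 \<and> A$1$2 = B$1$2 \<and> A$2$1 = B$2$1 \<and> A$2$2 = B$2$2"
  by (auto simp: vec_eq_iff forall_2)

lemma mat2_mult_nth: "((A::mat2) ** B) $ i $ j = A$i$1 * B$1$j + A$i$2 * B$2$j"
  by (simp add: matrix_matrix_mult_def sum_2)

lemma mat2_vmult_nth: "((A::mat2) *v X) $ i = A$i$1 * X$1 + A$i$2 * X$2"
  by (simp add: matrix_vector_mult_def sum_2)

lemma trace_mat2: "trace (A::mat2) = A$1$1 + A$2$2"
  by (simp add: trace_def sum_2)

lemma mat_1_mat2: "(mat 1 :: mat2) $ 1 $ 1 = 1" "(mat 1 :: mat2) $ 2 $ 2 = 1"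
    "(mat 1 :: mat2) $ 1 $ 2 = 0" "(mat 1 :: mat2) $ 2 $ 1 = 0"
  by (simp_all add: mat_def)

lemmas mat2_simps = mat2_mult_nth mat2_vmult_nth trace_mat2 mat_1_mat2 transpose_def det_2

definition adj2 :: "mat2 \<Rightarrow> mat2" where
  "adj2 A = vector [vector [A$2$2, - A$1$2], vector [- A$2$1, A$1$1]]"

lemma adj2_nth: "adj2 A $ 1 $ 1 = A$2$2" "adj2 A $ 1 $ 2 = - A$1$2"
    "adj2 A $ 2 $ 1 = - A$2$1" "adj2 A $ 2 $ 2 = A$1$1"
  by (simp_all add: adj2_def)

lemma matrix_inv_unique2:
  assumes "(A::mat2) ** B = mat 1" shows "matrix_inv A = B"
  unfolding matrix_inv_def
proof (rule some_equality)
  have BA: "B ** A = mat 1" using assms matrix_left_right_inverse by blast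
  show "A ** B = mat 1 \<and> B ** A = mat 1" by (simp add: assms BA)
  fix C assume C: "A ** C = mat 1 \<and> C ** A = mat 1"
  have "C = C ** (A ** B)" by (simp only: assms matrix_mul_rid)
  also have "\<dots> = B" using C by (simp only: matrix_mul_assoc matrix_mul_lid)
  finally show "C = B" .
qed

lemma matrix_inv_mat2:
  assumes "det (A::mat2) \<noteq> 0" shows "matrix_inv A = (1 / det A) *\<^sub>R adj2 A"
proof (rule matrix_inv_unique2)
  have "A$1$1 * A$2$2 - A$1$2 * A$2$1 \<noteq> 0" using assms by (simp add: det_2)
  then show "A ** ((1 / det A) *\<^sub>R adj2 A) = mat 1"
    unfolding mat2_eq_iff mat2_simps scaleR_vec_def vec_lambda_beta adj2_nth
    by (simp add: divide_simps) (simp add: algebra_simps)?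
qed

lemma matrix_inv_cancel:
  assumes "det (A::mat2) \<noteq> 0" shows "A ** matrix_inv A = mat 1" "matrix_inv A ** A = mat 1"
proof -
  obtain B where "A ** B = mat 1"
    using assms invertible_det_nz[of A] by (auto simp: invertible_def)
  then show "A ** matrix_inv A = mat 1" "matrix_inv A ** A = mat 1"
    using matrix_inv_unique2[of A B] matrix_left_right_inverse[of A B] by auto
qed

section \<open>Frame independence of the divergence and the Levi-Civita property\<close>

lemma divergence_frame_trace:
  fixes A G :: "real^2 \<Rightarrow> mat2"
  assumes "A differentiable (at x)" and e: "orthonormal_frame (G x) e"
  shows "(\<Sum>i\<in>UNIV. bil (G x) (nabla_endo G A x (e i) *v X) (e i)) =
         (\<Sum>k\<in>UNIV. (nabla_endo G A x (axis k 1) *v X) $ k)"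
proof -
  have lin: "linear (\<lambda>V. nabla_endo G A x V *v X)"
  proof -
    interpret D: linear "frechet_derivative A (at x)"
      using assms(1) by (rule linear_frechet_derivative)
    have c: "connection G x (V + W) = connection G x V + connection G x W"
         "connection G x (r *\<^sub>R V) = r *\<^sub>R connection G x V" for V W r
      by (simp_all add: connection_def vec_eq_iff sum_2 algebra_simps)
    show ?thesis
      by (rule linearI) (simp_all add: nabla_endo_def c D.add D.scaleR vec_eq_iff mat2_simps algebra_simps)
  qed
  define L where "L = matrix (\<lambda>V. nabla_endo G A x V *v X)"
  have L: "nabla_endo G A x V *v X = L *v V" for V
    using fun_cong[OF matrix_vector_mul(2)[OF lin], of V] by (simp only: L_def)
  define E :: mat2 where "E = (\<chi> i j. e j $ i)"
  have b: "bil (G x) (B *v e i) (e j) = (transpose E ** (transpose B ** G x) ** E) $ i $ j" for B i j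
    by (simp add: bil_def E_def inner_vec_def mat2_simps sum_2 algebra_simps)
  have "(transpose E ** G x ** E) $ i $ j = bil (G x) (e i) (e j)" for i j
    using b[of "mat 1" i j] by (simp add: matrix_mul_assoc)
  then have one: "(transpose E ** G x) ** E = mat 1"
    using e by (simp add: orthonormal_frame_def vec_eq_iff mat_def)
  have one': "E ** (transpose E ** G x) = mat 1"
    using one by (simp add: matrix_left_right_inverse)
  have one'': "(G x) ** (E ** transpose E) = mat 1"
    using one' matrix_left_right_inverse[of "E ** transpose E" "G x"] by (simp add: matrix_mul_assoc)
  have "(\<Sum>i\<in>UNIV. bil (G x) (nabla_endo G A x (e i) *v X) (e i)) =
        trace (transpose E ** (transpose L ** G x ** E))"
    by (simp add: L b trace_def matrix_mul_assoc)
  also have "\<dots> = trace (transpose L ** G x ** E ** transpose E)"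
    by (rule trace_mul_sym)
  also have "\<dots> = trace (transpose L)"
    by (simp only: matrix_mul_assoc[symmetric] one'' matrix_mul_rid)
  also have "\<dots> = (\<Sum>k\<in>UNIV. (nabla_endo G A x (axis k 1) *v X) $ k)"
    unfolding L by (simp add: trace_def transpose_def matrix_vector_mult_def axis_def sum_2)
  finally show ?thesis .
qed

lemma divergence_eq_frame:
  assumes "A differentiable (at x)" and "orthonormal_frame (G x) e"
  shows "divergence G A x X = (\<Sum>i\<in>UNIV. bil (G x) (nabla_endo G A x (e i) *v X) (e i))"
  using divergence_frame_trace[of A x G] assms someI[of "orthonormal_frame (G x)" e]
  by (simp add: divergence_def Let_def)

lemma connection_levi_civita:
  assumes "open U" "x \<in> U" "\<And>y. y \<in> U \<Longrightarrow> symmetric_form (G y)"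
    and "G differentiable (at x)"
  shows "connection G x X *v Y = connection G x Y *v X"
    and "det (G x) \<noteq> 0 \<Longrightarrow> nabla_form G G x X = 0"
proof -
  have D: "(G has_derivative frechet_derivative G (at x)) (at x)"
    using assms(4) by (simp add: frechet_derivative_works)
  have "((\<lambda>y. G y $ i $ j) has_derivative (\<lambda>v. frechet_derivative G (at x) v $ i $ j)) (at x)" for i j
    by (intro bounded_linear.has_derivative[OF bounded_linear_vec_nth] D)
  then have d: "((\<lambda>y. G y $ 1 $ 2) has_derivative (\<lambda>v. frechet_derivative G (at x) v $ 1 $ 2)) (at x)"
    "((\<lambda>y. G y $ 2 $ 1) has_derivative (\<lambda>v. frechet_derivative G (at x) v $ 2 $ 1)) (at x)" by auto
  have s: "G y $ 1 $ 2 = G y $ 2 $ 1" if "y \<in> U" for y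
  proof -
    have "transpose (G y) $ 1 $ 2 = G y $ 1 $ 2"
      using assms(3)[OF that] by (simp only: symmetric_form_def)
    then show ?thesis by (simp add: transpose_def)
  qed
  have "((\<lambda>y. G y $ 2 $ 1) has_derivative (\<lambda>v. frechet_derivative G (at x) v $ 1 $ 2)) (at x)"
    using has_derivative_transform_within_open[OF d(1) assms(1,2) s] .
  then have sy: "frechet_derivative G (at x) v $ 1 $ 2 = frechet_derivative G (at x) v $ 2 $ 1" for v
    using has_derivative_unique[OF d(2)] by metis
  have sx: "G x $ 1 $ 2 = G x $ 2 $ 1" using s assms(2) by blast
  show "connection G x X *v Y = connection G x Y *v X"
    by (auto simp: connection_def christoffel_def mat2_simps vec_eq_iff forall_2 sum_2 sy Let_def algebra_simps)
  assume dG: "det (G x) \<noteq> 0"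
  interpret D: linear "frechet_derivative G (at x)"
    using assms(4) by (rule linear_frechet_derivative)
  have X: "X = X$1 *\<^sub>R axis 1 1 + X$2 *\<^sub>R axis 2 1"
    by (simp add: vec_eq_iff forall_2 axis_def)
  have dX: "frechet_derivative G (at x) X = X$1 *\<^sub>R frechet_derivative G (at x) (axis 1 1) + X$2 *\<^sub>R frechet_derivative G (at x) (axis 2 1)"
    by (subst X) (simp only: D.add D.scaleR)
  define I where "I = matrix_inv (G x)"
  have GI: "G x ** I = mat 1" "I ** G x = mat 1"
    using dG by (simp_all add: I_def matrix_inv_cancel)
  have lower: "(G x ** connection G x X) $ l $ j = (\<Sum>i\<in>UNIV. X $ i *
      (frechet_derivative G (at x) (axis i 1) $ j $ l + frechet_derivative G (at x) (axis j 1) $ i $ l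
       - frechet_derivative G (at x) (axis l 1) $ i $ j)) / 2" for l j
  proof -
    define w where "w m = (\<Sum>i\<in>UNIV. X $ i *
      (frechet_derivative G (at x) (axis i 1) $ j $ m + frechet_derivative G (at x) (axis j 1) $ i $ m
       - frechet_derivative G (at x) (axis m 1) $ i $ j)) / 2" for m
    have "connection G x X $ k $ j = I$k$1 * w 1 + I$k$2 * w 2" for k
      by (simp add: connection_def christoffel_def w_def I_def sum_2 Let_def field_simps)
    then have "(G x ** connection G x X) $ l $ j = (G x ** I) $ l $ 1 * w 1 + (G x ** I) $ l $ 2 * w 2"
      by (simp add: mat2_mult_nth algebra_simps)
    also have "\<dots> = w l" using exhaust_2[of l] by (auto simp: GI mat_1_mat2)
    finally show ?thesis by (simp add: w_def)
  qed
  have tr: "transpose (connection G x X) ** G x = transpose (G x ** connection G x X)"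
    using assms(3)[OF assms(2)] by (simp add: matrix_transpose_mul symmetric_form_def)
  have "frechet_derivative G (at x) X $ l $ j = (transpose (G x ** connection G x X) + G x ** connection G x X) $ l $ j" for l j
    using exhaust_2[of l] exhaust_2[of j]
    by (auto simp: transpose_def lower dX sum_2 sy field_simps)
  then show "nabla_form G G x X = 0"
    unfolding nabla_form_def tr by (simp add: vec_eq_iff)
qed

section \<open>Differentiability of matrix expressions\<close>


lemma bounded_bilinear_mat2_mult: "bounded_bilinear ((**) :: mat2 \<Rightarrow> mat2 \<Rightarrow> mat2)"
proof -
  have "bilinear ((**) :: mat2 \<Rightarrow> mat2 \<Rightarrow> mat2)"
    unfolding bilinear_def
    by (intro conjI allI linearI) (simp_all add: vec_eq_iff mat2_mult_nth algebra_simps)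
  then show ?thesis by (simp add: bilinear_conv_bounded_bilinear)
qed

lemma differentiable_mat2_mult:
  fixes F H :: "'b::real_normed_vector \<Rightarrow> mat2"
  assumes "F differentiable at z" "H differentiable at z"
  shows "(\<lambda>z. F z ** H z) differentiable at z"
  using assms bounded_bilinear.FDERIV[OF bounded_bilinear_mat2_mult]
  unfolding differentiable_def by blast

lemma differentiable_mat2_nth:
  fixes F :: "'b::real_normed_vector \<Rightarrow> mat2"
  assumes "F differentiable at z"
  shows "(\<lambda>z. F z $ i $ j) differentiable at z"
proof -
  obtain D where "(F has_derivative D) (at z)" using assms by (auto simp: differentiable_def)
  then have "((\<lambda>z. F z $ i $ j) has_derivative (\<lambda>v. D v $ i $ j)) (at z)"
    by (intro bounded_linear.has_derivative[OF bounded_linear_vec_nth])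
  then show ?thesis by (auto simp: differentiable_def)
qed

lemma differentiable_mat2I:
  fixes F :: "'b::real_normed_vector \<Rightarrow> mat2"
  assumes "\<And>i j. (\<lambda>z. F z $ i $ j) differentiable at z"
  shows "F differentiable at z"
proof -
  have *: "F = (\<lambda>z. \<Sum>i\<in>UNIV. \<Sum>j\<in>UNIV. (F z $ i $ j) *\<^sub>R axis i (axis j 1))"
    by (rule ext) (simp add: vec_eq_iff sum_2 forall_2 axis_def)
  have "(\<lambda>z. \<Sum>i\<in>UNIV. \<Sum>j\<in>UNIV. (F z $ i $ j) *\<^sub>R (axis i (axis j 1) :: mat2)) differentiable at z"
    by (intro differentiable_sum ballI differentiable_scaleR differentiable_const assms finite)
  then show ?thesis using * by simp
qed

lemma differentiable_matrix_inv:
  fixes F :: "'b::real_normed_vector \<Rightarrow> mat2"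
  assumes F: "F differentiable at z" and det: "det (F z) \<noteq> 0"
  shows "(\<lambda>z. matrix_inv (F z)) differentiable at z"
proof -
  have d: "(\<lambda>z. det (F z)) differentiable at z"
    unfolding det_2 by (intro differentiable_diff differentiable_mult differentiable_mat2_nth F)
  have a: "(\<lambda>z. adj2 (F z)) differentiable at z"
  proof (rule differentiable_mat2I)
    fix i j :: 2
    show "(\<lambda>z. adj2 (F z) $ i $ j) differentiable at z"
      using exhaust_2[of i] exhaust_2[of j] differentiable_mat2_nth[OF F]
        differentiable_minus[OF differentiable_mat2_nth[OF F]]
      by (elim disjE) (simp_all add: adj2_nth)
  qed
  have G: "(\<lambda>z. inverse (det (F z)) *\<^sub>R adj2 (F z)) differentiable at z"
    by (intro differentiable_scaleR a differentiable_inverse d det)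
  have "isCont (\<lambda>z. det (F z)) z" using d by (rule differentiable_imp_continuous_within)
  then have "((\<lambda>z. det (F z)) \<longlongrightarrow> det (F z)) (nhds z)"
    by (simp add: continuous_within tendsto_nhds_iff)
  then have "\<forall>\<^sub>F w in nhds z. det (F w) \<in> - {0}"
    by (rule topological_tendstoD) (use det in auto)
  then obtain U where U: "open U" "z \<in> U" "\<And>w. w \<in> U \<Longrightarrow> det (F w) \<noteq> 0"
    by (auto simp: eventually_nhds)
  from G obtain D where "((\<lambda>z. inverse (det (F z)) *\<^sub>R adj2 (F z)) has_derivative D) (at z)"
    by (auto simp: differentiable_def)
  then have "((\<lambda>z. matrix_inv (F z)) has_derivative D) (at z)"
    by (rule has_derivative_transform_within_open[OF _ U(1,2)])
       (simp add: matrix_inv_mat2 U(3) divide_inverse)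
  then show ?thesis by (auto simp: differentiable_def)
qed

section \<open>The Mess map on a fibre\<close>

text \<open>The fibrewise conditions defining the space of pairs, with \<open>R\<close> the area form.\<close>

definition pair_at :: "mat2 \<Rightarrow> mat2 \<Rightarrow> mat2 \<Rightarrow> bool" where
  "pair_at R J s \<longleftrightarrow> transpose R = - R \<and> R $ 1 $ 2 > 0 \<and> J ** J = - mat 1 \<and>
     pos_def_form (R ** J) \<and> symmetric_form s \<and> transpose J ** s ** J = - s"

lemma pair_at_params:
  assumes "pair_at R J s"
  obtains r a b c p q w where
    "R$1$1 = 0" "R$1$2 = r" "R$2$1 = - r" "R$2$2 = 0" "r > 0"
    "J$1$1 = a" "J$1$2 = b" "J$2$1 = c" "J$2$2 = - a" "c > 0" "b * c = - 1 - a\<^sup>2"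
    "s$1$1 = p" "s$1$2 = q" "s$2$1 = q" "s$2$2 = w" "c * w = b * p - 2 * a * q"
proof -
  have "transpose R $ i $ j = (- R) $ i $ j" for i j using assms by (simp only: pair_at_def)
  from this[of 1 1] this[of 1 2] this[of 2 2]
  have R: "R$1$1 = 0" "R$2$1 = - R$1$2" "R$2$2 = 0"
    by (simp_all add: transpose_def)
  have r: "R$1$2 > 0" using assms by (simp only: pair_at_def)
  have "transpose s $ 1 $ 2 = s $ 1 $ 2"
    using assms by (simp only: pair_at_def symmetric_form_def)
  then have s: "s$2$1 = s$1$2" by (simp add: transpose_def)
  have "(J ** J) $ i $ j = (- mat 1) $ i $ j" for i j using assms by (simp only: pair_at_def)
  from this[of 1 1] this[of 2 1]
  have JJ: "J$1$1 * J$1$1 + J$1$2 * J$2$1 = - 1" "J$2$1 * J$1$1 + J$2$2 * J$2$1 = 0"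
    by (simp_all add: mat2_simps)
  have "bil (R ** J) (axis 1 1) (axis 1 1) > 0"
    using assms by (auto simp: pair_at_def pos_def_form_def)
  then have "R$1$2 * J$2$1 > 0"
    by (simp add: bil_def mat2_simps inner_vec_def sum_2 axis_def R)
  then have c: "J$2$1 > 0" using r by (simp add: zero_less_mult_iff)
  have "J$2$1 * (J$1$1 + J$2$2) = 0" using JJ(2) by (simp add: algebra_simps)
  then have d: "J$2$2 = - J$1$1" using c by simp
  have b: "J$1$2 * J$2$1 = - 1 - (J$1$1)\<^sup>2"
    using JJ(1) by (simp add: power2_eq_square)
  have "(transpose J ** s ** J) $ 1 $ 1 = - s $ 1 $ 1"
    using assms by (simp add: pair_at_def)
  then have "(1 + (J$1$1)\<^sup>2) * s$1$1 + J$2$1 * (2 * J$1$1 * s$1$2 + J$2$1 * s$2$2) = 0"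
    by (simp add: mat2_simps s power2_eq_square algebra_simps)
  then have "J$2$1 * (2 * J$1$1 * s$1$2 + J$2$1 * s$2$2 - J$1$2 * s$1$1) = 0"
    using arg_cong[OF b, of "\<lambda>u. u * s$1$1"] by (simp add: algebra_simps)
  then have w: "J$2$1 * s$2$2 = J$1$2 * s$1$1 - 2 * J$1$1 * s$1$2"
    using c by simp
  show ?thesis by (rule that[OF R(1) refl R(2,3) r refl refl refl d c b refl refl s refl w])
qed

lemma pair_at_facts:
  assumes "pair_at R J s"
  defines "H \<equiv> matrix_inv (R ** J) ** s"
  shows "det (R ** J) > 0" and "inner_form (R ** J) s s \<ge> 0"
    and "det H = - inner_form (R ** J) s s" and "trace H = 0" and "trace (J ** H) = 0"
proof -
  obtain r a b c p q w where *:
    "R$1$1 = 0" "R$1$2 = r" "R$2$1 = - r" "R$2$2 = 0" "r > 0"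
    "J$1$1 = a" "J$1$2 = b" "J$2$1 = c" "J$2$2 = - a" "c > 0" "b * c = - 1 - a\<^sup>2"
    "s$1$1 = p" "s$1$2 = q" "s$2$1 = q" "s$2$2 = w" "c * w = b * p - 2 * a * q"
    using pair_at_params[OF assms(1)] by metis
  have det: "det (R ** J) = r\<^sup>2"
  proof -
    have "det (R ** J) = r\<^sup>2 * (- (b * c) - a\<^sup>2)"
      by (simp add: mat2_simps * power2_eq_square algebra_simps del: *(11))
    then show ?thesis using *(11) by simp
  qed
  show "det (R ** J) > 0" using det *(5) by simp
  have inv: "matrix_inv (R ** J) = (1 / r\<^sup>2) *\<^sub>R adj2 (R ** J)"
    using matrix_inv_mat2[of "R ** J"] det *(5) by simp
  have H: "H$1$1 = (a * q - b * p) / r" "H$1$2 = (a * w - b * q) / r"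
     "H$2$1 = (a * p + c * q) / r" "H$2$2 = (a * q + c * w) / r"
    using *(5) unfolding H_def inv
    by (simp_all add: mat2_mult_nth adj2_nth * power2_eq_square field_simps del: *(11,16))
  have "trace H = (c * w - (b * p - 2 * a * q)) / r"
    unfolding trace_mat2 H add_divide_distrib[symmetric] by (simp add: algebra_simps del: *(11,16))
  then show tr: "trace H = 0" using *(16) by simp
  then have H22: "H$2$2 = - H$1$1" by (simp add: trace_mat2)
  have I: "inner_form (R ** J) s s = (H$1$1)\<^sup>2 + H$1$2 * H$2$1"
    unfolding inner_form_def H_def[symmetric]
    by (simp add: trace_mat2 mat2_mult_nth H22 power2_eq_square field_simps)
  then show "det H = - inner_form (R ** J) s s"
    by (simp add: det_2 H22 power2_eq_square)
  have h1: "c * (a * q - b * p) = a * c * q + (1 + a\<^sup>2) * p"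
    using arg_cong[OF *(11), of "\<lambda>u. u * p"] by (simp add: algebra_simps del: *(11,16))
  have h2: "c * (c * (a * w - b * q)) = c * (1 - a\<^sup>2) * q - a * (1 + a\<^sup>2) * p"
    using arg_cong[OF *(16), of "\<lambda>u. u * c * a"] arg_cong[OF *(11), of "\<lambda>u. u * a * p"]
      arg_cong[OF *(11), of "\<lambda>u. u * c * q"]
    by (simp add: algebra_simps power2_eq_square del: *(11,16))
  have "c\<^sup>2 * ((a * q - b * p)\<^sup>2 + (a * w - b * q) * (a * p + c * q)) =
      (c * (a * q - b * p))\<^sup>2 + c * (c * (a * w - b * q)) * (a * p + c * q)"
    by (simp add: algebra_simps power2_eq_square)
  also have "\<dots> = p\<^sup>2 + (a * p + c * q)\<^sup>2"
    unfolding h1 h2 by (simp add: algebra_simps power2_eq_square)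
  finally have "c\<^sup>2 * ((a * q - b * p)\<^sup>2 + (a * w - b * q) * (a * p + c * q)) =
      p\<^sup>2 + (a * p + c * q)\<^sup>2" .
  then have "c\<^sup>2 * ((a * q - b * p)\<^sup>2 + (a * w - b * q) * (a * p + c * q)) \<ge> 0" by simp
  then have "(a * q - b * p)\<^sup>2 + (a * w - b * q) * (a * p + c * q) \<ge> 0"
    using *(10) by (simp add: zero_le_mult_iff)
  moreover have "inner_form (R ** J) s s = ((a * q - b * p)\<^sup>2 + (a * w - b * q) * (a * p + c * q)) / r\<^sup>2"
    unfolding I H by (simp only: power2_eq_square times_divide_times_eq add_divide_distrib[symmetric])
  ultimately show "inner_form (R ** J) s s \<ge> 0" by simp
  show "trace (J ** H) = 0"
    using *(5,11,16) unfolding trace_mat2 mat2_mult_nth H *(6-9)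
    apply (simp add: field_simps del: *(11,16))
    by algebra
qed

lemma TstarJ_pair_at:
  assumes "area_form \<A> \<rho>" "(J, \<sigma>) \<in> TstarJ \<A> \<rho>" "c \<in> \<A>" "x \<in> coords c"
  shows "pair_at (\<rho> c x) (J c x) (\<sigma> c x)"
  using assms unfolding area_form_def TstarJ_def pair_at_def metric_of_def by blast

lemma shape_op_eq_shape_at: "shape_op \<rho> J \<sigma> c x = shape_at (\<rho> c x) (J c x) (\<sigma> c x)"
  by (simp add: shape_op_def sharp_def h_metric_def metric_of_def f_fun_def shape_at_def)

lemma shape_at_eq:
  assumes "pair_at R J s"
  shows "shape_at R J s =
    (1 / (1 + sqrt (1 + inner_form (R ** J) s s))) *\<^sub>R (matrix_inv (R ** J) ** s)"
proof -
  define k where "k = 1 + sqrt (1 + inner_form (R ** J) s s)"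
  have k: "k > 0" using pair_at_facts(2)[OF assms] by (simp add: k_def add_pos_nonneg)
  have "(k *\<^sub>R (R ** J)) ** ((1 / k) *\<^sub>R matrix_inv (R ** J)) = mat 1"
    using matrix_inv_cancel(1)[of "R ** J"] pair_at_facts(1)[OF assms] k
    by (simp add: bounded_bilinear.scaleR_left[OF bounded_bilinear_mat2_mult]
        bounded_bilinear.scaleR_right[OF bounded_bilinear_mat2_mult])
  then have "matrix_inv (k *\<^sub>R (R ** J)) = (1 / k) *\<^sub>R matrix_inv (R ** J)"
    by (rule matrix_inv_unique2)
  then show ?thesis
    by (simp add: shape_at_def k_def[symmetric] bounded_bilinear.scaleR_left[OF bounded_bilinear_mat2_mult])
qed

lemma det_mess:
  assumes "pair_at R J s"
  defines "f \<equiv> sqrt (1 + inner_form (R ** J) s s)"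
  shows "det (mat 1 - J ** shape_at R J s) = 2 / (1 + f)"
    and "det (mat 1 + J ** shape_at R J s) = 2 / (1 + f)"
proof -
  define H where "H = matrix_inv (R ** J) ** s"
  note facts = pair_at_facts[OF assms(1), folded H_def]
  have f: "f \<ge> 1" "f\<^sup>2 = 1 + inner_form (R ** J) s s"
    using facts(2) by (simp_all add: f_def)
  have B: "shape_at R J s = (1 / (1 + f)) *\<^sub>R H"
    using shape_at_eq[OF assms(1)] by (simp add: f_def H_def)
  have dJ: "det J = 1"
  proof -
    obtain r a b c where "J$1$1 = a" "J$1$2 = b" "J$2$1 = c" "J$2$2 = - a" "b * c = - 1 - a\<^sup>2"
      using pair_at_params[OF assms(1)] by metis
    then show ?thesis by (simp add: det_2 power2_eq_square)
  qed
  have JH: "det (J ** H) = 1 - f\<^sup>2" by (simp add: det_mul dJ facts(3) f(2))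
  have dt: "det (mat 1 + t *\<^sub>R M) = 1 + t * trace M + t\<^sup>2 * det M" for t and M :: mat2
    by (simp add: mat2_simps power2_eq_square algebra_simps)
  have e: "det (mat 1 + t *\<^sub>R (J ** H)) = 1 + t\<^sup>2 * (1 - f\<^sup>2)" for t
    using facts(5) by (simp add: dt JH)
  have n: "1 + f \<noteq> 0" "1 - f\<^sup>2 = (1 + f) * (1 - f)" using f(1) by (simp_all add: power2_eq_square algebra_simps)
  have v: "1 + (1 / (1 + f))\<^sup>2 * (1 - f\<^sup>2) = 2 / (1 + f)"
  proof -
    have "(1 / (1 + f))\<^sup>2 * (1 - f\<^sup>2) = (1 - f) / (1 + f)"
      unfolding n(2) using n(1) by (simp add: power2_eq_square)
    then show ?thesis using n(1) by (simp add: field_simps)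
  qed
  have JB: "J ** shape_at R J s = (1 / (1 + f)) *\<^sub>R (J ** H)"
    by (simp add: B bounded_bilinear.scaleR_right[OF bounded_bilinear_mat2_mult])
  show "det (mat 1 + J ** shape_at R J s) = 2 / (1 + f)"
    unfolding JB e v by simp
  show "det (mat 1 - J ** shape_at R J s) = 2 / (1 + f)"
    using e[of "- (1 / (1 + f))"] v by (simp add: JB)
qed

lemma mess_at_eq:
  assumes "pair_at R J s"
  defines "f \<equiv> sqrt (1 + inner_form (R ** J) s s)" and "H \<equiv> matrix_inv (R ** J) ** s"
  shows "mess_l_at R (J, s) = f *\<^sub>R J + H" and "mess_r_at R (J, s) = f *\<^sub>R J - H"
proof -
  note facts = pair_at_facts[OF assms(1), folded H_def]
  have f: "f \<ge> 1" "f\<^sup>2 = 1 + inner_form (R ** J) s s"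
    using facts(2) by (simp_all add: f_def)
  have B: "shape_at R J s = (1 / (1 + f)) *\<^sub>R H"
    using shape_at_eq[OF assms(1)] by (simp add: f_def H_def)
  have J2: "J ** J = - mat 1" using assms(1) by (simp add: pair_at_def)
  have detH: "det H = 1 - f\<^sup>2" using facts(3) f(2) by simp
  have HH: "H ** H = (f\<^sup>2 - 1) *\<^sub>R mat 1"
  proof -
    have h: "H$2$2 = - H$1$1" using facts(4) by (simp add: trace_mat2)
    have "H$1$1 * H$1$1 + H$1$2 * H$2$1 = f\<^sup>2 - 1"
      using detH by (simp add: det_2 h)
    then show ?thesis by (simp add: mat2_eq_iff mat2_simps h mult.commute)
  qed
  have anti: "H ** J = - (J ** H)"
  proof -
    have h: "H$2$2 = - H$1$1" using facts(4) by (simp add: trace_mat2)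
    obtain a where j: "J$1$1 = a" "J$2$2 = - a" using pair_at_params[OF assms(1)] by metis
    have "J$1$1 * H$1$1 + J$1$2 * H$2$1 + J$2$1 * H$1$2 + J$2$2 * H$2$2 = 0"
      using facts(5) by (simp add: trace_mat2 mat2_mult_nth)
    then show ?thesis by (simp add: mat2_eq_iff mat2_simps h j algebra_simps)
  qed
  note bb = bounded_bilinear_mat2_mult
  note bil = bounded_bilinear.scaleR_left[OF bb] bounded_bilinear.scaleR_right[OF bb]
    bounded_bilinear.add_left[OF bb] bounded_bilinear.add_right[OF bb]
    bounded_bilinear.diff_left[OF bb] bounded_bilinear.diff_right[OF bb]
    bounded_bilinear.minus_left[OF bb] bounded_bilinear.minus_right[OF bb]
  have JHH: "J ** H ** H = (f\<^sup>2 - 1) *\<^sub>R J"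
    by (simp add: matrix_mul_assoc[symmetric] HH bil)
  have JHJ: "J ** H ** J = H"
    by (simp add: matrix_mul_assoc[symmetric] anti bil) (simp add: matrix_mul_assoc J2 bil)
  have JHM: "J ** (J ** M) = - M" for M :: mat2 by (simp add: matrix_mul_assoc J2 bil)
  have n: "1 + f \<noteq> 0" using f(1) by simp
  have conj: "M ** (f *\<^sub>R J + t *\<^sub>R H) = J ** M"
    if M: "M = mat 1 - (t / (1 + f)) *\<^sub>R (J ** H)" and t: "t\<^sup>2 = 1" for M t
  proof -
    have "M ** (f *\<^sub>R J + t *\<^sub>R H) =
        (f - t\<^sup>2 / (1 + f) * (f\<^sup>2 - 1)) *\<^sub>R J + (t - t * f / (1 + f)) *\<^sub>R H"
      unfolding M by (simp add: bil JHH JHJ)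
         (simp add: vec_eq_iff power2_eq_square add_divide_distrib diff_divide_distrib algebra_simps)
    moreover have "J ** M = J + (t / (1 + f)) *\<^sub>R H"
      unfolding M by (simp add: bil JHM)
    moreover have "f - t\<^sup>2 / (1 + f) * (f\<^sup>2 - 1) = 1" "t - t * f / (1 + f) = t / (1 + f)"
      using n unfolding t by (simp_all add: field_simps power2_eq_square)
    ultimately show ?thesis by simp
  qed
  have solve: "matrix_inv M ** J ** M = K" if "M ** K = J ** M" "det M \<noteq> 0" for M K
    using that matrix_inv_cancel(2)[OF that(2)]
    by (metis matrix_mul_assoc matrix_mul_lid)
  have ne: "2 / (1 + f) \<noteq> 0" using n by simp
  show "mess_l_at R (J, s) = f *\<^sub>R J + H"
    unfolding mess_l_at_def prod.case
    using conj[of "mat 1 - J ** shape_at R J s" 1] det_mess(1)[OF assms(1), folded f_def] ne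
    by (intro solve) (simp_all add: B bil)
  show "mess_r_at R (J, s) = f *\<^sub>R J - H"
    unfolding mess_r_at_def prod.case
    using conj[of "mat 1 + J ** shape_at R J s" "-1"] det_mess(2)[OF assms(1), folded f_def] ne
    by (intro solve) (simp_all add: B bil)
qed

lemma differentiable_mess_at:
  assumes "pair_at R J s"
  shows "mess_l_at R differentiable (at (J, s))" and "mess_r_at R differentiable (at (J, s))"
proof -
  have fs: "fst differentiable (at (J, s))" "snd differentiable (at (J, s))"
    unfolding differentiable_def
    using bounded_linear_imp_has_derivative[OF bounded_linear_fst]
      bounded_linear_imp_has_derivative[OF bounded_linear_snd] by blast+
  have RJ: "(\<lambda>z. R ** fst z) differentiable (at (J, s))"
    by (intro differentiable_mat2_mult differentiable_const fs)
  have inv: "(\<lambda>z. matrix_inv (R ** fst z)) differentiable (at (J, s))"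
    using pair_at_facts(1)[OF assms] by (intro differentiable_matrix_inv RJ) simp
  have H: "(\<lambda>z. matrix_inv (R ** fst z) ** snd z) differentiable (at (J, s))"
    by (intro differentiable_mat2_mult inv fs)
  have tr: "(\<lambda>z. 1 + inner_form (R ** fst z) (snd z) (snd z)) differentiable (at (J, s))"
    unfolding inner_form_def trace_mat2 divide_inverse
    by (intro differentiable_add differentiable_mult differentiable_const differentiable_mat2_nth
        differentiable_mat2_mult H)
  have pos: "1 + inner_form (R ** J) s s > 0" using pair_at_facts(2)[OF assms] by simp
  obtain D where "((\<lambda>z. 1 + inner_form (R ** fst z) (snd z) (snd z)) has_derivative D) (at (J, s))"
    using tr by (auto simp: differentiable_def)
  from has_derivative_real_sqrt[OF _ this] pos
  have sq: "(\<lambda>z. sqrt (1 + inner_form (R ** fst z) (snd z) (snd z))) differentiable (at (J, s))"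
    by (auto simp: differentiable_def)
  have "det ((1 + sqrt (1 + inner_form (R ** J) s s)) *\<^sub>R (R ** J)) =
      (1 + sqrt (1 + inner_form (R ** J) s s))\<^sup>2 * det (R ** J)"
    by (simp add: det_2 power2_eq_square algebra_simps)
  moreover have "1 + sqrt (1 + inner_form (R ** J) s s) > 0"
    using pos by (simp add: add_pos_nonneg)
  ultimately have dn: "det ((1 + sqrt (1 + inner_form (R ** J) s s)) *\<^sub>R (R ** J)) \<noteq> 0"
    using pair_at_facts(1)[OF assms] by simp
  have B: "(\<lambda>z. shape_at R (fst z) (snd z)) differentiable (at (J, s))"
    unfolding shape_at_def
    by (intro differentiable_mat2_mult differentiable_matrix_inv differentiable_scaleR
        differentiable_add differentiable_const sq RJ fs) (use dn in simp)
  have JB: "(\<lambda>z. fst z ** shape_at R (fst z) (snd z)) differentiable (at (J, s))"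
    by (intro differentiable_mat2_mult fs B)
  have ne: "2 / (1 + sqrt (1 + inner_form (R ** J) s s)) \<noteq> 0"
    using \<open>1 + sqrt _ > 0\<close> by simp
  show "mess_l_at R differentiable (at (J, s))"
    unfolding mess_l_at_def case_prod_beta
    by (intro differentiable_mat2_mult differentiable_matrix_inv differentiable_diff
        differentiable_const JB fs) (use det_mess(1)[OF assms] ne in simp)
  show "mess_r_at R differentiable (at (J, s))"
    unfolding mess_r_at_def case_prod_beta
    by (intro differentiable_mat2_mult differentiable_matrix_inv differentiable_add
        differentiable_const JB fs) (use det_mess(2)[OF assms] ne in simp)
qed

lemma variation_along_curve:
  assumes "pair_at R J s" and "\<gamma> t\<^sub>0 = (J, s)" and "(\<gamma> has_vector_derivative v) (at t\<^sub>0)"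
  shows "((\<lambda>t. mess_l_at R (\<gamma> t)) has_vector_derivative
            frechet_derivative (mess_l_at R) (at (J, s)) v) (at t\<^sub>0)"
    and "((\<lambda>t. mess_r_at R (\<gamma> t)) has_vector_derivative
            frechet_derivative (mess_r_at R) (at (J, s)) v) (at t\<^sub>0)"
  using vector_derivative_diff_chain_within[OF assms(3), of "mess_l_at R" _]
    vector_derivative_diff_chain_within[OF assms(3), of "mess_r_at R" _]
    differentiable_mess_at[OF assms(1)]
  by (auto simp: frechet_derivative_works assms(2) o_def intro: has_derivative_at_withinI)

end

theory Submission
  imports Defs
begin

text \<open>
  Write \<open>H = g\<^sup>-\<^sup>1 \<sigma>\<close>, \<open>J\<^sub>l = f J + H\<close> and \<open>C = J J\<^sub>l = J H - f\<close>, so that \<open>det C = 1\<close>. Since \<open>\<nabla> J = 0\<close>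
  and since the Codazzi equation for \<open>B\<close> is conformally invariant, \<open>(\<nabla>\<^sub>X H) Y\<close> is symmetric in
  \<open>X, Y\<close>. For \<open>Q\<close> anticommuting with \<open>J\<close>, the Leibniz rule then shows that the defect
  \<open>E(X) = div Q (X) + f\<^sup>-\<^sup>1 \<langle>\<nabla>\<^sub>J\<^sub>X \<sigma> | Q\<rangle>\<close> satisfies
  \<open>E(C X) = div (Q J J\<^sub>l) (X) + \<langle>\<nabla>\<^sub>J\<^sub>X \<sigma> | Q\<rangle>\<close>, and invertibility of \<open>C\<close> gives the equivalence of ii)
  and iii), while i) and iii) differ by taking sums and differences. For the exactness, the first
  variation of \<open>J\<^sub>l\<close> is \<open>\<langle>\<sigma> | Q\<rangle> J + f Q = \<langle>\<sigma> | Q J\<rangle> 1 - Q C\<close> with \<open>Q = Q\<^sup>+\<close>, and passing from the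
  connection of \<open>g\<close> to that of \<open>h\<^sub>l\<close> changes its divergence by \<open>- \<langle>\<nabla>\<^sub>J\<^sub>X \<sigma> | Q\<rangle>\<close>; by ii) what
  remains is \<open>d\<langle>\<sigma> | Q J\<rangle>\<close>. The right component is the left one for \<open>(J, - \<sigma>)\<close>.
\<close>

section \<open>The algebra of a complex structure on the plane\<close>

text \<open>Every pointwise identity is reduced to real algebra by writing 2x2 matrices in a basis
  1, \<open>J\<close>, \<open>K\<close>, \<open>J K\<close>, where \<open>K\<close> is an involution
  anticommuting with \<open>J\<close>. Matrices commuting with \<open>J\<close> are then complex
  numbers, those anticommuting with \<open>J\<close> are complex multiples of \<open>K\<close>, and
  the one nontrivial relation left among the coordinates is \<open>f * f = 1 + |H|^2\<close>. The
  first variation has an obstacle of its own. It is a derivative over all matrices near the pair,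
  while the closed form \<open>f J + H\<close> is valid on pairs only, so the closed form cannot
  simply be differentiated. What does hold on a full neighbourhood is the conjugation relation
  defining the Mess map. Multiplied by \<open>1 + f\<close> it reads
  \<open>N ** mess_l_at R z = fst z ** N\<close>, and since \<open>N\<close> is invertible its
  linearisation determines the derivative. The prescribed trace part of \<open>\<sigma>'\<close> is
  what makes this derivative depend on \<open>Q\<close> alone, through
  \<open><\<sigma> | Q> J + f Q\<close>.\<close>

lemmas mat2_linear_simps =
  bounded_bilinear.scaleR_left[OF bounded_bilinear_mat2_mult]
  bounded_bilinear.scaleR_right[OF bounded_bilinear_mat2_mult]
  bounded_bilinear.add_left[OF bounded_bilinear_mat2_mult]
  bounded_bilinear.add_right[OF bounded_bilinear_mat2_mult]
  bounded_bilinear.diff_left[OF bounded_bilinear_mat2_mult]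
  bounded_bilinear.diff_right[OF bounded_bilinear_mat2_mult]
  bounded_bilinear.minus_left[OF bounded_bilinear_mat2_mult]
  bounded_bilinear.minus_right[OF bounded_bilinear_mat2_mult]
  bounded_bilinear.zero_left[OF bounded_bilinear_mat2_mult]
  bounded_bilinear.zero_right[OF bounded_bilinear_mat2_mult]

lemma trace_mat2_simps:
  "trace ((A::mat2) + B) = trace A + trace B"
  "trace (A - B) = trace A - trace B"
  "trace (- A) = - trace A"
  "trace (r *\<^sub>R A) = r * trace A"
  "trace (mat 1 :: mat2) = 2" "trace (0 :: mat2) = 0"
  by (simp_all add: trace_mat2 mat_1_mat2 algebra_simps)

lemma trace_mult_commute: "trace ((A::mat2) ** B) = trace (B ** A)"
  by (rule trace_mul_sym)

lemma trace_eq_sum_axis: "trace (A::mat2) = (\<Sum>k\<in>UNIV. (A *v axis k 1) $ k)"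
  by (simp add: trace_def sum_2 mat2_vmult_nth axis_def)

lemma mat2_eqI_vmult: "(\<And>X. (A::mat2) *v X = B *v X) \<Longrightarrow> A = B"
  by (simp add: matrix_eq)

locale complex_structure =
  fixes J :: mat2
  assumes JJ: "J ** J = - mat 1"
begin

lemma J_nth: "J$2$2 = - J$1$1" "J$2$1 \<noteq> 0" "J$1$2 * J$2$1 = - 1 - J$1$1 * J$1$1"
proof -
  have e: "J$1$1 * J$1$1 + J$1$2 * J$2$1 = - 1" "J$1$1 * J$1$2 + J$1$2 * J$2$2 = 0"
      "J$2$1 * J$1$1 + J$2$2 * J$2$1 = 0" "J$2$1 * J$1$2 + J$2$2 * J$2$2 = - 1"
    using JJ by (simp_all add: mat2_eq_iff mat2_mult_nth mat_1_mat2)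
  have sq: "a * a \<noteq> - 1" for a :: real
    using zero_le_square[of a] by linarith
  show n: "J$2$1 \<noteq> 0" using e(1) sq by auto
  have "J$2$1 * (J$1$1 + J$2$2) = 0" using e(3) by (simp add: algebra_simps)
  then show "J$2$2 = - J$1$1" using n by simp
  show "J$1$2 * J$2$1 = - 1 - J$1$1 * J$1$1" using e(1) by simp
qed

text \<open>The \<open>J\<close>-antilinear involution fixing \<open>axis 1 1\<close>. Together with
  \<open>mat 1\<close>, \<open>J\<close> and \<open>J ** K\<close> it exhibits the real 2x2 matrices
  as the split quaternions.\<close>

definition K :: mat2 where
  "K = vector [vector [1, - 2 * J$1$1 / J$2$1], vector [0, - 1]]"

lemma K_nth: "K$1$1 = 1" "K$1$2 = - 2 * J$1$1 / J$2$1" "K$2$1 = 0" "K$2$2 = - 1"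
  by (simp_all add: K_def)

lemma KK: "K ** K = mat 1"
  by (simp add: mat2_eq_iff mat2_mult_nth mat_1_mat2 K_nth)

lemma KJ: "K ** J = - (J ** K)"
  using J_nth(2)
  by (simp add: mat2_eq_iff mat2_mult_nth mat_1_mat2 K_nth J_nth(1) field_simps)

text \<open>Split-quaternion coordinates: \<open>qt a b 0 0\<close> commutes with \<open>J\<close>
  and \<open>qt 0 0 c d\<close> anticommutes with it. With \<open>qt_mult\<close> the matrix
  identities become polynomial identities in real coordinates.\<close>

definition qt :: "real \<Rightarrow> real \<Rightarrow> real \<Rightarrow> real \<Rightarrow> mat2" where
  "qt a b c d = a *\<^sub>R mat 1 + b *\<^sub>R J + c *\<^sub>R K + d *\<^sub>R (J ** K)"

lemma qt_mult:
  "qt a b c d ** qt a' b' c' d' =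
    qt (a * a' - b * b' + c * c' + d * d') (a * b' + b * a' - c * d' + d * c')
       (a * c' + c * a' - b * d' + d * b') (a * d' + d * a' + b * c' - c * b')"
proof -
  have e: "J ** (J ** A) = - A" "K ** (K ** A) = A" "K ** (J ** A) = - (J ** (K ** A))" for A :: mat2
    by (simp_all add: matrix_mul_assoc JJ KK KJ mat2_linear_simps)
  show ?thesis
    by (simp add: qt_def mat2_linear_simps matrix_mul_assoc[symmetric] e JJ KK KJ)
      (simp add: vec_eq_iff algebra_simps)
qed

lemma qt_scaleR: "r *\<^sub>R qt a b c d = qt (r * a) (r * b) (r * c) (r * d)"
  by (simp add: qt_def algebra_simps)

lemma qt_add: "qt a b c d + qt a' b' c' d' = qt (a + a') (b + b') (c + c') (d + d')"
  and qt_diff: "qt a b c d - qt a' b' c' d' = qt (a - a') (b - b') (c - c') (d - d')"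
  and qt_minus: "- qt a b c d = qt (-a) (-b) (-c) (-d)"
  by (simp_all add: qt_def algebra_simps)

lemma trace_J: "trace J = 0"
  by (simp add: trace_mat2 J_nth(1))

lemma trace_qt: "trace (qt a b c d) = 2 * a"
proof -
  have "trace K = 0" by (simp add: trace_mat2 K_nth)
  moreover have "trace (J ** K) = 0"
    using trace_mult_commute[of J K] by (simp add: KJ trace_mat2_simps)
  ultimately show ?thesis
    by (simp add: qt_def trace_mat2_simps trace_J)
qed

lemma mat_1_qt: "mat 1 = qt 1 0 0 0"
  by (simp add: qt_def)

lemma scaleR_J: "r *\<^sub>R J = qt 0 r 0 0"
  by (simp add: qt_def)

lemma J_mult_qt: "J ** qt a b c d = qt (- b) a (- d) c"
  and qt_mult_J: "qt a b c d ** J = qt (- b) a d (- c)"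
  using qt_mult[of 0 1 0 0 a b c d] qt_mult[of a b c d 0 1 0 0] scaleR_J[of 1] by simp_all

lemmas qt_simps = qt_mult qt_scaleR qt_add qt_diff qt_minus trace_qt mat_1_qt
  scaleR_J J_mult_qt qt_mult_J

lemma commuting_qtE:
  assumes "M ** J = J ** M"
  obtains a b where "M = qt a b 0 0"
proof
  define b where "b = M$2$1 / J$2$1"
  define a where "a = M$1$1 - b * J$1$1"
  have e: "M$1$2 * J$2$1 = J$1$2 * M$2$1"
      "M$2$1 * J$1$1 + M$2$2 * J$2$1 = J$2$1 * M$1$1 - J$1$1 * M$2$1"
    using assms by (simp_all add: mat2_eq_iff mat2_mult_nth J_nth(1))
  have "M$1$2 = b * J$1$2" using e(1) J_nth(2) by (simp add: b_def field_simps)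
  moreover have bM: "M$2$1 = b * J$2$1" using J_nth(2) by (simp add: b_def)
  moreover have "J$2$1 * M$2$2 = J$2$1 * (a - b * J$1$1)"
    using e(2) by (simp add: a_def bM algebra_simps)
  ultimately show "M = qt a b 0 0"
    using J_nth by (simp add: qt_def mat2_eq_iff mat_1_mat2 a_def)
qed

text \<open>Right multiplication by the involution \<open>K\<close> turns an anticommuting matrix
  into a commuting one, and a second multiplication undoes it.\<close>

lemma anticommuting_qtE:
  assumes "A ** J = - (J ** A)"
  obtains c d where "A = qt 0 0 c d"
proof -
  have "A ** K ** J = J ** (A ** K)"
    by (simp add: matrix_mul_assoc[symmetric] KJ mat2_linear_simps)
       (simp add: matrix_mul_assoc assms mat2_linear_simps)
  then obtain a b where "A ** K = qt a b 0 0" by (rule commuting_qtE)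
  then have "A ** K ** K = qt a b 0 0 ** qt 0 0 1 0" by (simp add: qt_def)
  then have "A = qt 0 0 a b" by (simp add: matrix_mul_assoc[symmetric] KK qt_mult)
  then show ?thesis by (rule that)
qed

text \<open>In complex notation the factors are \<open>z K\<close>, \<open>w K\<close>,
  \<open>u K\<close>, and moving \<open>K\<close> past a complex number conjugates it. The product
  is \<open>z * cnj w * u\<close> times \<open>K\<close>, which is symmetric in the outer
  factors.\<close>

lemma anticommuting_triple_commute:
  assumes "A ** J = - (J ** A)" "B ** J = - (J ** B)" "C ** J = - (J ** C)"
  shows "A ** B ** C = C ** B ** A"
proof -
  obtain a a' b b' c c' where "A = qt 0 0 a a'" "B = qt 0 0 b b'" "C = qt 0 0 c c'"
    by (meson assms anticommuting_qtE)
  then show ?thesis by (simp add: qt_mult algebra_simps)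
qed

section \<open>Pointwise identities for the Mess map and its tangent vectors\<close>

context
  fixes H :: mat2 and f :: real
  assumes H: "H ** J = - (J ** H)" and f: "f\<^sup>2 = 1 + trace (H ** H) / 2"
begin

text \<open>Anticommutation cancels the mixed terms, and \<open>H ** H\<close> is the scalar
  \<open>f * f - 1\<close>.\<close>

lemma mess_square: "(f *\<^sub>R J + H) ** (f *\<^sub>R J + H) = - mat 1"
proof -
  obtain h h' where "H = qt 0 0 h h'" using H by (rule anticommuting_qtE)
  then show ?thesis using f
    by (simp add: qt_simps power2_eq_square del: distrib_left_numeral)
qed

text \<open>The anticommutator of \<open>H\<close> and \<open>Q\<close> is the scalar
  \<open>trace (H ** Q)\<close>, and the coefficient of \<open>J\<close> is the one that cancels it.
  The matrix is therefore tangent to the space of complex structures at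
  \<open>f J + H\<close>.\<close>

lemma mess_tangent_anticommute:
  assumes "Q ** J = - (J ** Q)"
  shows "((trace (H ** Q) / 2) *\<^sub>R J + f *\<^sub>R Q) ** (f *\<^sub>R J + H) =
    - ((f *\<^sub>R J + H) ** ((trace (H ** Q) / 2) *\<^sub>R J + f *\<^sub>R Q))"
proof -
  obtain h h' q q' where "H = qt 0 0 h h'" "Q = qt 0 0 q q'"
    by (meson H assms anticommuting_qtE)
  then show ?thesis by (simp add: qt_simps) (simp add: field_simps)
qed

text \<open>Origin of the exact form: the divergence of a scalar multiple of the identity is the
  differential of the scalar, and the remaining term is the field whose divergence condition ii)
  controls.\<close>

lemma mess_tangent_eq:
  assumes "Q ** J = - (J ** Q)"
  shows "(trace (H ** Q) / 2) *\<^sub>R J + f *\<^sub>R Q =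
    (trace (H ** Q ** J) / 2) *\<^sub>R mat 1 - Q ** J ** (f *\<^sub>R J + H)"
proof -
  obtain h h' q q' where "H = qt 0 0 h h'" "Q = qt 0 0 q q'"
    by (meson H assms anticommuting_qtE)
  then show ?thesis by (simp add: qt_simps) (simp add: algebra_simps add_divide_distrib diff_divide_distrib)
qed

lemma mess_inverse: "(J ** H - f *\<^sub>R mat 1) ** (- (J ** H + f *\<^sub>R mat 1)) = mat 1"
proof -
  obtain h h' where "H = qt 0 0 h h'" using H by (rule anticommuting_qtE)
  then show ?thesis using f
    by (simp add: qt_simps power2_eq_square del: distrib_left_numeral)
qed

text \<open>Here \<open>T\<close> and \<open>d\<close> stand for the derivatives of \<open>H\<close>
  and \<open>f\<close>, so the middle factor is the derivative of \<open>f J + H\<close> and the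
  hypothesis on \<open>d\<close> is the derivative of \<open>f * f = 1 + |H|^2\<close>. The trace is
  the correction caused by changing the metric.\<close>

lemma mess_connection_trace:
  assumes Q: "Q ** J = - (J ** Q)" and T: "T ** J = - (J ** T)" and d: "f * d = trace (H ** T) / 2"
  shows "trace (((trace (H ** Q) / 2) *\<^sub>R J + f *\<^sub>R Q) ** (d *\<^sub>R J + T) ** (f *\<^sub>R J + H)) =
    trace (Q ** (T ** J))"
proof -
  obtain h h' q q' t t' where *: "H = qt 0 0 h h'" "Q = qt 0 0 q q'" "T = qt 0 0 t t'"
    by (meson assms H anticommuting_qtE)
  have f': "f * f = 1 + h * h + h' * h'" and d': "f * d = h * t + h' * t'"
    using f d by (simp_all add: * qt_simps power2_eq_square)
  have "trace (((trace (H ** Q) / 2) *\<^sub>R J + f *\<^sub>R Q) ** (d *\<^sub>R J + T) ** (f *\<^sub>R J + H)) =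
     2 * ((f * d) * (q' * h - q * h') + (f * f) * (q * t' - q' * t) + (h * q + h' * q') * (h' * t - h * t'))"
    unfolding * by (simp add: qt_simps) (simp add: field_simps)
  also have "\<dots> = 2 * (q * t' - q' * t)"
    unfolding f' d' by (simp add: algebra_simps)
  also have "\<dots> = trace (Q ** (T ** J))"
    unfolding * by (simp add: qt_simps)
  finally show ?thesis .
qed

text \<open>
  The linearisation of \<open>N (f J + H) = J N\<close>, where \<open>N = (1 + f) 1 - J H\<close> is a multiple of the
  matrix conjugating \<open>J\<close> to the first component of the Mess map.
\<close>

lemma mess_linearised:
  assumes J': "J' ** J = - (J ** J')" and U: "U ** J = - (J ** U)"
    and f': "f' = trace (H ** U) / 2"
    and H': "H' = f *\<^sub>R U + (trace (H ** J') / 2) *\<^sub>R J"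
  shows "(f' *\<^sub>R mat 1 - (J' ** H + J ** H')) ** (f *\<^sub>R J + H) +
      ((1 + f) *\<^sub>R mat 1 - J ** H) **
        ((trace (H ** (U + J')) / 2) *\<^sub>R J + f *\<^sub>R (U + J')) =
    J' ** ((1 + f) *\<^sub>R mat 1 - J ** H) + J ** (f' *\<^sub>R mat 1 - (J' ** H + J ** H'))"
proof -
  obtain h h' j j' u u' where *: "H = qt 0 0 h h'" "J' = qt 0 0 j j'" "U = qt 0 0 u u'"
    by (meson assms H anticommuting_qtE)
  have f2: "f * f = 1 + h * h + h' * h'"
    using f by (simp add: * qt_simps power2_eq_square del: distrib_left_numeral)
  \<comment> \<open>The same relation in the shape in which \<open>f * f\<close> occurs inside
    right-nested products.\<close>
  then have f2': "f * (f * a) = a + h * (h * a) + h' * (h' * a)" for a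
    by (metis (no_types) mult.assoc distrib_right mult_1)
  have f': "f' = h * u + h' * u'"
    using f' by (simp add: * qt_simps del: distrib_left_numeral)
  have qt_cong: "qt a b c d = qt a' b' c' d'" if "a = a'" "b = b'" "c = c'" "d = d'"
    for a b c d a' b' c' d' using that by simp
  show ?thesis
    unfolding H' * f'
    by (simp only: qt_simps) (rule qt_cong; simp add: field_simps f2 f2')
qed

end

end

section \<open>Covariant derivatives of endomorphism fields\<close>

text \<open>Both functions have the same derivatives at \<open>x\<close>, so the choice behind
  \<open>frechet_derivative\<close> is made from one and the same predicate.\<close>

lemma frechet_derivative_cong:
  assumes "open U" "x \<in> U" "\<And>y. y \<in> U \<Longrightarrow> F y = G y"
  shows "frechet_derivative F (at x) = frechet_derivative G (at x)"
proof -
  have "(F has_derivative D) (at x) \<longleftrightarrow> (G has_derivative D) (at x)" for D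
    using has_derivative_transform_within_open[of F D x UNIV U G]
      has_derivative_transform_within_open[of G D x UNIV U F] assms by auto
  then show ?thesis by (simp add: frechet_derivative_def)
qed

lemma differentiable_cong:
  assumes "F differentiable (at x)" "open U" "x \<in> U" "\<And>y. y \<in> U \<Longrightarrow> F y = G y"
  shows "G differentiable (at x)"
  using assms(1) has_derivative_transform_within_open[of F _ x UNIV U G] assms(2-4)
  unfolding differentiable_def by blast

lemma frechet_derivative_rules:
  assumes "F differentiable (at x)" "G differentiable (at x)"
  shows "frechet_derivative (\<lambda>y. F y + G y) (at x) v =
      frechet_derivative F (at x) v + frechet_derivative G (at x) v"
    and "frechet_derivative (\<lambda>y. F y - G y) (at x) v =
      frechet_derivative F (at x) v - frechet_derivative G (at x) v"
proof -
  note D = assms[unfolded frechet_derivative_works]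
  show "frechet_derivative (\<lambda>y. F y + G y) (at x) v =
      frechet_derivative F (at x) v + frechet_derivative G (at x) v"
    by (subst frechet_derivative_at[OF has_derivative_add[OF D], symmetric]) (rule refl)
  show "frechet_derivative (\<lambda>y. F y - G y) (at x) v =
      frechet_derivative F (at x) v - frechet_derivative G (at x) v"
    by (subst frechet_derivative_at[OF has_derivative_diff[OF D], symmetric]) (rule refl)
qed

lemma frechet_derivative_bilinear:
  assumes "bounded_bilinear pr" "F differentiable (at x)" "G differentiable (at x)"
  shows "frechet_derivative (\<lambda>y. pr (F y) (G y)) (at x) v =
      pr (F x) (frechet_derivative G (at x) v) + pr (frechet_derivative F (at x) v) (G x)"
  by (subst frechet_derivative_at[OF bounded_bilinear.FDERIV[OF assms(1)
      assms(2,3)[unfolded frechet_derivative_works]], symmetric]) (rule refl)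

lemmas frechet_derivative_mat2_mult = frechet_derivative_bilinear[OF bounded_bilinear_mat2_mult]
lemmas frechet_derivative_scaleR = frechet_derivative_bilinear[OF bounded_bilinear_scaleR]

lemma frechet_derivative_bounded_linear:
  assumes "bounded_linear L" "F differentiable (at x)"
  shows "frechet_derivative (\<lambda>y. L (F y)) (at x) v = L (frechet_derivative F (at x) v)"
  by (subst frechet_derivative_at[OF bounded_linear.has_derivative[OF assms(1)
      assms(2)[unfolded frechet_derivative_works]], symmetric]) (rule refl)

lemma bounded_linear_trace: "bounded_linear (trace :: mat2 \<Rightarrow> real)"
  unfolding trace_mat2 
  by (intro bounded_linear_add bounded_linear_compose[OF bounded_linear_vec_nth bounded_linear_vec_nth])

lemma connection_linear:
  "connection G x (V + W) = connection G x V + connection G x W"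
  "connection G x (r *\<^sub>R V) = r *\<^sub>R connection G x V"
  by (simp_all add: connection_def vec_eq_iff sum_2 algebra_simps)

lemma nabla_endo_linear:
  assumes "A differentiable (at x)"
  shows "nabla_endo G A x (V + W) = nabla_endo G A x V + nabla_endo G A x W"
    and "nabla_endo G A x (r *\<^sub>R V) = r *\<^sub>R nabla_endo G A x V"
proof -
  interpret D: linear "frechet_derivative A (at x)"
    using assms by (rule linear_frechet_derivative)
  show "nabla_endo G A x (V + W) = nabla_endo G A x V + nabla_endo G A x W"
    and "nabla_endo G A x (r *\<^sub>R V) = r *\<^sub>R nabla_endo G A x V"
    by (simp_all add: nabla_endo_def connection_linear D.add D.scaleR mat2_linear_simps algebra_simps)
qed

lemma nabla_endo_cong:
  assumes "open U" "x \<in> U" "\<And>y. y \<in> U \<Longrightarrow> A y = B y"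
  shows "nabla_endo G A x = nabla_endo G B x"
  using frechet_derivative_cong[OF assms] assms(2,3) by (auto simp: nabla_endo_def fun_eq_iff)

lemma nabla_endo_const_mat1: "nabla_endo G (\<lambda>_. r *\<^sub>R mat 1) x V = 0"
  by (simp add: nabla_endo_def mat2_linear_simps)

lemma nabla_endo_uminus:
  "A differentiable (at x) \<Longrightarrow> nabla_endo G (\<lambda>y. - A y) x V = - nabla_endo G A x V"
  using frechet_derivative_bounded_linear[OF bounded_linear_minus[OF bounded_linear_ident], of A x V]
  by (simp add: nabla_endo_def mat2_linear_simps)

context
  fixes G A B :: "real^2 \<Rightarrow> mat2" and x V :: "real^2"
  assumes A: "A differentiable (at x)" and B: "B differentiable (at x)"
begin

lemma nabla_endo_add:
  "nabla_endo G (\<lambda>y. A y + B y) x V = nabla_endo G A x V + nabla_endo G B x V"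
  by (simp add: nabla_endo_def frechet_derivative_rules[OF A B] mat2_linear_simps)

lemma nabla_endo_diff:
  "nabla_endo G (\<lambda>y. A y - B y) x V = nabla_endo G A x V - nabla_endo G B x V"
  by (simp add: nabla_endo_def frechet_derivative_rules[OF A B] mat2_linear_simps)

lemma nabla_endo_mult:
  "nabla_endo G (\<lambda>y. A y ** B y) x V = nabla_endo G A x V ** B x + A x ** nabla_endo G B x V"
  by (simp add: nabla_endo_def frechet_derivative_mat2_mult[OF A B] mat2_linear_simps matrix_mul_assoc)

end

lemma nabla_endo_scaleR:
  assumes u: "u differentiable (at x)" and A: "A differentiable (at x)"
  shows "nabla_endo G (\<lambda>y. u y *\<^sub>R A y) x V =
    frechet_derivative u (at x) V *\<^sub>R A x + u x *\<^sub>R nabla_endo G A x V"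
  by (simp add: nabla_endo_def frechet_derivative_scaleR[OF u A] mat2_linear_simps algebra_simps)

text \<open>The connection enters through a commutator, which has trace zero.\<close>

lemma trace_nabla_endo:
  assumes "A differentiable (at x)"
  shows "frechet_derivative (\<lambda>y. trace (A y)) (at x) V = trace (nabla_endo G A x V)"
  by (simp add: nabla_endo_def trace_mat2_simps trace_mult_commute[of "A x"]
      frechet_derivative_bounded_linear[OF bounded_linear_trace assms])

lemma orthonormal_frame_exists:
  assumes "symmetric_form M" "pos_def_form M"
  shows "\<exists>e. orthonormal_frame M e"
proof -
  have "transpose M $ 1 $ 2 = M $ 1 $ 2" using assms(1) by (simp only: symmetric_form_def)
  then have s: "M$2$1 = M$1$2" by (simp add: transpose_def)
  have a: "M$1$1 > 0"
  proof -
    have "bil M (axis 1 1) (axis 1 1) > 0"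
      using assms(2) by (simp add: pos_def_form_def axis_eq_0_iff)
    then show ?thesis by (simp add: bil_def mat2_vmult_nth inner_vec_def sum_2 axis_def)
  qed
  \<comment> \<open>Gram-Schmidt with the denominator cleared: \<open>v\<close> is
    \<open>M\<close>-orthogonal to \<open>axis 1 1\<close>.\<close>
  define v :: "real^2" where "v = vector [- M$1$2, M$1$1]"
  have v: "v$1 = - M$1$2" "v$2 = M$1$1" by (simp_all add: v_def)
  have "v \<noteq> 0" using a v(2) by (metis less_irrefl zero_index)
  then have d: "bil M v v > 0" using assms(2) by (simp add: pos_def_form_def)
  define e :: "2 \<Rightarrow> real^2" where
    "e i = (if i = 1 then (1 / sqrt (M$1$1)) *\<^sub>R axis 1 1 else (1 / sqrt (bil M v v)) *\<^sub>R v)" for i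
  have b: "bil M (r *\<^sub>R X) (t *\<^sub>R Y) = (r * t) * bil M X Y" for r t X Y
    by (simp add: bil_def mat2_vmult_nth inner_vec_def sum_2 algebra_simps)
  have "bil M (axis 1 1) v = 0" "bil M v (axis 1 1) = 0" "bil M (axis 1 1) (axis 1 1) = M$1$1"
    by (simp_all add: bil_def mat2_vmult_nth inner_vec_def sum_2 axis_def v s)
  then have "orthonormal_frame M e"
    using a d by (auto simp: orthonormal_frame_def forall_2 e_def b)
  then show ?thesis by (rule exI[of _ e])
qed

lemma divergence_eq_trace:
  assumes "A differentiable (at x)" "symmetric_form (G x)" "pos_def_form (G x)"
  shows "divergence G A x X = (\<Sum>k\<in>UNIV. (nabla_endo G A x (axis k 1) *v X) $ k)"
proof -
  obtain e where e: "orthonormal_frame (G x) e"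
    using orthonormal_frame_exists[OF assms(2,3)] by blast
  show ?thesis
    using divergence_eq_frame[of A x G e X] divergence_frame_trace[of A x G e X] assms(1) e
    by simp
qed

lemma divergence_cong:
  assumes "open U" "x \<in> U" "\<And>y. y \<in> U \<Longrightarrow> G y = G' y" "\<And>y. y \<in> U \<Longrightarrow> A y = A' y"
  shows "divergence G A x X = divergence G' A' x X"
proof -
  have "connection G x = connection G' x"
    using frechet_derivative_cong[OF assms(1-3)] assms(2,3)
    by (simp add: connection_def christoffel_def fun_eq_iff)
  then have "nabla_endo G A x = nabla_endo G' A' x"
    using frechet_derivative_cong[OF assms(1,2,4)] assms(2,4)
    by (simp add: nabla_endo_def fun_eq_iff)
  then show ?thesis using assms(2,3) by (simp add: divergence_def)
qed

section \<open>Surfaces with an area form and a compatible complex structure\<close>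

text \<open>The algebraic conditions are imposed on a neighbourhood so that they can be
  differentiated; the calculus itself takes place at the single point \<open>x\<close>.\<close>

locale area_structure =
  fixes U :: "(real^2) set" and R J :: "real^2 \<Rightarrow> mat2" and x :: "real^2"
  assumes U: "open U" "x \<in> U"
    and R: "\<And>y. y \<in> U \<Longrightarrow> transpose (R y) = - R y" "\<And>y. y \<in> U \<Longrightarrow> R y $ 1 $ 2 > 0"
    and J: "\<And>y. y \<in> U \<Longrightarrow> J y ** J y = - mat 1"
    and pos_def: "\<And>y. y \<in> U \<Longrightarrow> pos_def_form (R y ** J y)"
    and differentiable: "R differentiable (at x)" "J differentiable (at x)"
begin

abbreviation metric :: "real^2 \<Rightarrow> mat2" where "metric \<equiv> \<lambda>y. R y ** J y"

lemma R_nth: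
  assumes "y \<in> U"
  shows "R y $ 1 $ 1 = 0" "R y $ 2 $ 2 = 0" "R y $ 2 $ 1 = - R y $ 1 $ 2"
proof -
  have "transpose (R y) $ i $ j = (- R y) $ i $ j" for i j using R(1)[OF assms] by simp
  from this[of 1 1] this[of 2 2] this[of 1 2]
  show "R y $ 1 $ 1 = 0" "R y $ 2 $ 2 = 0" "R y $ 2 $ 1 = - R y $ 1 $ 2"
    by (simp_all add: transpose_def)
qed

lemma symmetric:
  assumes "y \<in> U" shows "symmetric_form (R y ** J y)"
proof -
  interpret complex_structure "J y" using J[OF assms] by unfold_locales
  show ?thesis
    by (simp add: symmetric_form_def mat2_eq_iff transpose_def mat2_mult_nth R_nth[OF assms] J_nth(1))
qed

lemma det_metric:
  assumes "y \<in> U" shows "det (R y ** J y) = (R y $ 1 $ 2)\<^sup>2"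
proof -
  interpret complex_structure "J y" using J[OF assms] by unfold_locales
  have "det (J y) = 1" using J_nth by (simp add: det_2)
  then show ?thesis by (simp add: det_mul) (simp add: det_2 R_nth[OF assms] power2_eq_square)
qed

lemma differentiable_metric: "metric differentiable (at x)"
  using differentiable by (intro differentiable_mat2_mult)

lemma connection_symmetric: "connection metric x X *v Y = connection metric x Y *v X"
  using connection_levi_civita(1)[of U x metric, OF U symmetric differentiable_metric] .

lemma metric_parallel:
  "frechet_derivative metric (at x) X =
    transpose (connection metric x X) ** (R x ** J x) + (R x ** J x) ** connection metric x X"
proof -
  have "det (R x ** J x) \<noteq> 0" using det_metric[OF U(2)] R(2)[OF U(2)] by simp
  then have "nabla_form metric metric x X = 0"
    using connection_levi_civita(2)[of U x metric, OF U symmetric differentiable_metric] by blast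
  then show ?thesis by (simp add: nabla_form_def algebra_simps)
qed

text \<open>The area form is parallel. Its coefficient \<open>r\<close> satisfies
  \<open>r * r = det g\<close>, and differentiating this with \<open>g\<close> parallel gives
  \<open>2 r dr = 2 det g\<close> times the trace of the connection form.\<close>

lemma trace_connection:
  "R x $ 1 $ 2 * trace (connection metric x X) = frechet_derivative (\<lambda>y. R y $ 1 $ 2) (at x) X"
proof -
  define g where "g = metric"
  define r where "r = (\<lambda>y. R y $ 1 $ 2)"
  define D where "D = frechet_derivative g (at x) X"
  define \<Gamma> where "\<Gamma> = connection g x X"
  have dr: "r differentiable (at x)"
    unfolding r_def by (intro differentiable_mat2_nth differentiable)
  have dg: "(\<lambda>y. g y $ i $ j) differentiable (at x)" for i j
    using differentiable_metric unfolding g_def by (rule differentiable_mat2_nth)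
  have Dn: "frechet_derivative (\<lambda>y. g y $ i $ j) (at x) X = D $ i $ j" for i j
    using frechet_derivative_bounded_linear[OF bounded_linear_compose[OF bounded_linear_vec_nth
      bounded_linear_vec_nth], of g x i j X] differentiable_metric by (simp add: D_def g_def)
  have "2 * r x * frechet_derivative r (at x) X =
      frechet_derivative (\<lambda>y. r y * r y) (at x) X"
    using frechet_derivative_bilinear[OF bounded_bilinear_mult dr dr] by simp
  also have "\<dots> = frechet_derivative (\<lambda>y. g y $ 1 $ 1 * g y $ 2 $ 2 - g y $ 1 $ 2 * g y $ 2 $ 1) (at x) X"
    using det_metric
    by (subst frechet_derivative_cong[OF U, of _ "\<lambda>y. g y $ 1 $ 1 * g y $ 2 $ 2 - g y $ 1 $ 2 * g y $ 2 $ 1"])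
      (simp_all add: g_def r_def det_2 power2_eq_square)
  also have "\<dots> = g x $ 1 $ 1 * D$2$2 + D$1$1 * g x $ 2 $ 2 - (g x $ 1 $ 2 * D$2$1 + D$1$2 * g x $ 2 $ 1)"
    using dg by (simp add: frechet_derivative_rules differentiable_mult
        frechet_derivative_bilinear[OF bounded_bilinear_mult] Dn)
  also have "\<dots> = 2 * det (g x) * trace \<Gamma>"
  proof -
    have "D = transpose \<Gamma> ** g x + g x ** \<Gamma>"
      using metric_parallel by (simp add: D_def \<Gamma>_def g_def)
    then show ?thesis by (simp add: mat2_simps algebra_simps)
  qed
  also have "\<dots> = 2 * r x * (r x * trace \<Gamma>)"
    using det_metric[OF U(2)] by (simp add: g_def r_def power2_eq_square)
  finally show ?thesis using R(2)[OF U(2)] by (simp add: r_def \<Gamma>_def g_def)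
qed

text \<open>The area form and the metric are both parallel, and \<open>metric\<close> is
  \<open>R ** J\<close> with \<open>R\<close> invertible, so the remaining factor \<open>J\<close>
  is parallel.\<close>

lemma nabla_J: "nabla_endo metric J x X = 0"
proof -
  define \<Gamma> where "\<Gamma> = connection metric x X"
  define E where "E = frechet_derivative R (at x) X"
  define D where "D = frechet_derivative J (at x) X"
  have En: "E $ i $ j = frechet_derivative (\<lambda>y. R y $ i $ j) (at x) X" for i j
    using frechet_derivative_bounded_linear[OF bounded_linear_compose[OF bounded_linear_vec_nth
      bounded_linear_vec_nth], of R x i j X] differentiable by (simp add: E_def)
  have "E$1$1 = 0" "E$2$2 = 0"
    unfolding En using frechet_derivative_cong[OF U, of "\<lambda>y. R y $ _ $ _" "\<lambda>_. 0"] R_nth by auto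
  moreover have "E$2$1 = - E$1$2"
    unfolding En using frechet_derivative_cong[OF U, of "\<lambda>y. R y $ 2 $ 1" "\<lambda>y. - R y $ 1 $ 2"] R_nth
      frechet_derivative_bounded_linear[OF bounded_linear_minus[OF bounded_linear_ident],
        of "\<lambda>y. R y $ 1 $ 2" x X] differentiable_mat2_nth[OF differentiable(1)] by auto
  moreover have "E$1$2 = R x $ 1 $ 2 * trace \<Gamma>"
    unfolding En \<Gamma>_def trace_connection ..
  \<comment> \<open>For skew \<open>R\<close> the right-hand side is \<open>trace \<Gamma>\<close>
    times \<open>R\<close>, so the identity for the single coefficient of the area form is
    enough.\<close>
  ultimately have E: "E = transpose \<Gamma> ** R x + R x ** \<Gamma>"
    by (simp add: mat2_eq_iff mat2_simps R_nth[OF U(2)] algebra_simps)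
  have "E ** J x + R x ** D = transpose \<Gamma> ** R x ** J x + R x ** J x ** \<Gamma>"
    using metric_parallel[of X] frechet_derivative_mat2_mult[OF differentiable]
    by (simp add: E_def D_def \<Gamma>_def matrix_mul_assoc add.commute)
  then have "R x ** (D + \<Gamma> ** J x - J x ** \<Gamma>) = 0"
    by (simp add: E mat2_linear_simps matrix_mul_assoc algebra_simps)
  moreover have "det (R x) \<noteq> 0" using R(2)[OF U(2)] by (simp add: det_2 R_nth[OF U(2)])
  ultimately have "D + \<Gamma> ** J x - J x ** \<Gamma> = 0"
    by (metis matrix_inv_cancel(2) matrix_mul_assoc matrix_mul_lid mat2_linear_simps(10))
  then show ?thesis by (simp add: nabla_endo_def D_def \<Gamma>_def)
qed

lemma divergence_metric:
  assumes "A differentiable (at x)"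
  shows "divergence metric A x X = (\<Sum>k\<in>UNIV. (nabla_endo metric A x (axis k 1) *v X) $ k)"
  using divergence_eq_trace[of A x metric] assms symmetric[OF U(2)] pos_def[OF U(2)] by simp

end

text \<open>
  Both connections preserve the area form, so their difference is trace-free; pairing it with an
  endomorphism anticommuting with \<open>I\<close> is then determined by \<open>I\<close> being parallel for the second one.
\<close>

lemma divergence_change_of_complex_structure:
  assumes "area_structure U R J x" "area_structure U R I x"
    and A: "A differentiable (at x)" "A x ** I x = - (I x ** A x)"
  shows "divergence (\<lambda>y. R y ** I y) A x X = divergence (\<lambda>y. R y ** J y) A x X
    - trace (A x ** nabla_endo (\<lambda>y. R y ** J y) I x X ** I x) / 2"
proof -
  interpret J: area_structure U R J x by fact
  interpret I: area_structure U R I x by fact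
  interpret complex_structure "I x" using I.J[OF I.U(2)] by unfold_locales
  define S where "S V = connection I.metric x V - connection J.metric x V" for V
  have S_sym: "S V *v W = S W *v V" for V W
    using I.connection_symmetric[of V W] J.connection_symmetric[of V W]
    by (simp add: S_def matrix_vector_mult_diff_rdistrib)
  have "R x $ 1 $ 2 * trace (S V) = 0" for V
    using I.trace_connection[of V] J.trace_connection[of V]
    by (simp add: S_def trace_mat2_simps algebra_simps)
  then have S_tr: "trace (S V) = 0" for V using I.R(2)[OF I.U(2)] by (metis less_irrefl mult_eq_0_iff)
  have change: "nabla_endo I.metric B x V = nabla_endo J.metric B x V + (S V ** B x - B x ** S V)" for B V
    by (simp add: nabla_endo_def S_def mat2_linear_simps)
  have "divergence I.metric A x X = (\<Sum>k\<in>UNIV. (nabla_endo J.metric A x (axis k 1) *v X) $ k)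
      + ((\<Sum>k\<in>UNIV. (S (axis k 1) *v (A x *v X)) $ k) - (\<Sum>k\<in>UNIV. (A x *v (S (axis k 1) *v X)) $ k))"
    unfolding I.divergence_metric[OF A(1)] change
    by (simp add: matrix_vector_mult_diff_rdistrib matrix_vector_mult_add_rdistrib
        matrix_vector_mul_assoc sum.distrib sum_subtractf)
  \<comment> \<open>Symmetry of \<open>S\<close> moves the basis vector to the other slot. The first
    sum becomes the trace of \<open>S (A X)\<close>, which is zero, and the second the trace of
    \<open>A ** S X\<close>.\<close>
  also have "\<dots> = divergence J.metric A x X - trace (A x ** S X)"
  proof -
    have "(\<Sum>k\<in>UNIV. (S (axis k 1) *v (A x *v X)) $ k) = trace (S (A x *v X))"
      unfolding S_sym[of "axis _ 1"] trace_eq_sum_axis ..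
    moreover have "(\<Sum>k\<in>UNIV. (A x *v (S (axis k 1) *v X)) $ k) = trace (A x ** S X)"
      unfolding S_sym[of "axis _ 1"] trace_eq_sum_axis matrix_vector_mul_assoc[symmetric] ..
    ultimately show ?thesis
      by (simp add: J.divergence_metric[OF A(1)] S_tr)
  qed
  finally have *: "divergence I.metric A x X = divergence J.metric A x X - trace (A x ** S X)" .
  \<comment> \<open>Since \<open>I\<close> is parallel for its own metric, its derivative for the
    other one is a commutator with the difference tensor.\<close>
  have N: "nabla_endo J.metric I x X = I x ** S X - S X ** I x"
    using change[of I X] I.nabla_J[of X] by (simp add: algebra_simps)
  have "A x ** nabla_endo J.metric I x X ** I x = A x ** I x ** S X ** I x + A x ** S X"
    by (simp add: N mat2_linear_simps matrix_mul_assoc[symmetric] JJ)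
  moreover have "trace (A x ** I x ** S X ** I x) = trace (A x ** S X)"
  proof -
    have "trace (A x ** I x ** S X ** I x) = trace ((I x ** (A x ** I x)) ** S X)"
      using trace_mult_commute[of "A x ** I x ** S X" "I x"] by (simp add: matrix_mul_assoc)
    also have "I x ** (A x ** I x) = A x"
      by (simp add: A(2) mat2_linear_simps) (simp add: matrix_mul_assoc JJ mat2_linear_simps)
    finally show ?thesis .
  qed
  ultimately have "trace (A x ** nabla_endo J.metric I x X ** I x) = 2 * trace (A x ** S X)"
    by (simp add: trace_mat2_simps)
  then show ?thesis using * by simp
qed

text \<open>Rescaling the metric by \<open>k\<close> keeps \<open>J\<close> and rescales the area
  form. The difference \<open>S\<close> of the connections has trace \<open>d log k\<close> and
  commutes with \<open>J\<close>, so the new derivative of \<open>A / k\<close> is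
  \<open>(\<nabla>A - 2 A S) / k\<close>. The extra term is symmetric in its two arguments because
  \<open>S\<close> is.\<close>

lemma codazzi_conformal:
  assumes "area_structure U R J x"
    and k: "k differentiable (at x)" "\<And>y. y \<in> U \<Longrightarrow> k y > 0"
    and A: "A differentiable (at x)" "A x ** J x = - (J x ** A x)"
    and codazzi: "nabla_endo (\<lambda>y. k y *\<^sub>R (R y ** J y)) (\<lambda>y. inverse (k y) *\<^sub>R A y) x X *v Y =
      nabla_endo (\<lambda>y. k y *\<^sub>R (R y ** J y)) (\<lambda>y. inverse (k y) *\<^sub>R A y) x Y *v X"
  shows "nabla_endo (\<lambda>y. R y ** J y) A x X *v Y = nabla_endo (\<lambda>y. R y ** J y) A x Y *v X"
proof -
  interpret J: area_structure U R J x by fact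
  have bil_pos: "bil (r *\<^sub>R M) Y Y = r * bil M Y Y" for r M Y
    by (simp add: bil_def scaleR_matrix_vector_assoc[symmetric])
  interpret h: area_structure U "\<lambda>y. k y *\<^sub>R R y" J x
  proof
    show "(\<lambda>y. k y *\<^sub>R R y) differentiable (at x)"
      using k J.differentiable by (intro differentiable_scaleR)
    fix y assume y: "y \<in> U"
    show "transpose (k y *\<^sub>R R y) = - (k y *\<^sub>R R y)"
      using J.R(1)[OF y] transpose_scalar[of "k y" "R y"] by simp
    show "0 < (k y *\<^sub>R R y) $ 1 $ 2" using k(2)[OF y] J.R(2)[OF y] by simp
    show "pos_def_form ((k y *\<^sub>R R y) ** J y)"
      using k(2)[OF y] J.pos_def[OF y] by (simp add: pos_def_form_def mat2_linear_simps bil_pos)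
  qed (fact J.U J.J J.differentiable)+
  interpret complex_structure "J x" using J.J[OF J.U(2)] by unfold_locales
  define S where "S V = connection h.metric x V - connection J.metric x V" for V
  define dk where "dk = frechet_derivative k (at x)"
  have kx: "k x > 0" using k(2) J.U(2) .
  have S_sym: "S V *v W = S W *v V" for V W
    using h.connection_symmetric[of V W] J.connection_symmetric[of V W]
    by (simp add: S_def matrix_vector_mult_diff_rdistrib)
  have tr: "k x * trace (S V) = dk V" for V
  proof -
    have "(\<lambda>y. R y $ 1 $ 2) differentiable (at x)"
      using J.differentiable by (intro differentiable_mat2_nth)
    from frechet_derivative_bilinear[OF bounded_bilinear_mult k(1) this, of V]
    have "k x * R x $ 1 $ 2 * trace (connection h.metric x V) =
        k x * (R x $ 1 $ 2 * trace (connection J.metric x V)) + dk V * R x $ 1 $ 2"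
      unfolding J.trace_connection using h.trace_connection[of V] by (simp add: dk_def)
    then have "R x $ 1 $ 2 * (k x * trace (S V)) = R x $ 1 $ 2 * dk V"
      unfolding S_def trace_mat2_simps by (simp only: algebra_simps)
    then show ?thesis using J.R(2)[OF J.U(2)] by simp
  qed
  have change: "nabla_endo h.metric B x V = nabla_endo J.metric B x V + (S V ** B x - B x ** S V)" for B V
    by (simp add: nabla_endo_def S_def mat2_linear_simps)
  \<comment> \<open>\<open>J\<close> is parallel for both metrics, so \<open>S V\<close> has the
    form \<open>a + b J\<close>. In the anticommutator with an antilinear \<open>A\<close> the
    \<open>b\<close> part cancels and \<open>2 a\<close> is the trace.\<close>
  have SA: "S V ** A x + A x ** S V = trace (S V) *\<^sub>R A x" for V
  proof -
    have "S V ** J x = J x ** S V"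
      using change[of J V] h.nabla_J[of V] J.nabla_J[of V] by simp
    then obtain a b where "S V = qt a b 0 0" by (rule commuting_qtE)
    moreover obtain c d where "A x = qt 0 0 c d" using A(2) by (rule anticommuting_qtE)
    ultimately show ?thesis by (simp add: qt_simps algebra_simps)
  qed
  have "frechet_derivative (\<lambda>y. inverse (k y)) (at x) V = - (inverse (k x) * inverse (k x) * dk V)" for V
    using kx by (subst frechet_derivative_at[OF Deriv.has_derivative_inverse[OF _ k(1)[unfolded
        frechet_derivative_works]], symmetric]) (simp_all add: dk_def)
  then have "nabla_endo h.metric (\<lambda>y. inverse (k y) *\<^sub>R A y) x V =
      inverse (k x) *\<^sub>R (nabla_endo J.metric A x V - trace (S V) *\<^sub>R A x + S V ** A x - A x ** S V)" for V
    using kx unfolding change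
    by (subst nabla_endo_scaleR[OF _ A(1)])
      (auto simp: tr[symmetric] mat2_linear_simps algebra_simps intro: differentiable_inverse k)
  then have "nabla_endo h.metric (\<lambda>y. inverse (k y) *\<^sub>R A y) x V =
      inverse (k x) *\<^sub>R (nabla_endo J.metric A x V - 2 *\<^sub>R (A x ** S V))" for V
    unfolding SA[symmetric] by (simp add: algebra_simps scaleR_2)
  moreover have "h.metric = (\<lambda>y. k y *\<^sub>R (R y ** J y))" by (simp add: mat2_linear_simps)
  ultimately have "(nabla_endo J.metric A x X - 2 *\<^sub>R (A x ** S X)) *v Y =
      (nabla_endo J.metric A x Y - 2 *\<^sub>R (A x ** S Y)) *v X"
    using codazzi kx by (simp add: scaleR_matrix_vector_assoc[symmetric])
  then show ?thesis
    by (simp add: matrix_vector_mult_diff_rdistrib scaleR_matrix_vector_assoc[symmetric]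
        matrix_vector_mul_assoc[symmetric] S_sym[of X Y])
qed

section \<open>The divergence identities of a Codazzi pair\<close>

lemma mat2_neg_vmult: "- (A::mat2) *v X = - (A *v X)"
  by (simp add: vec_eq_iff mat2_vmult_nth)

lemma trace_differentiable:
  fixes A :: "'b::real_normed_vector \<Rightarrow> mat2"
  assumes "A differentiable (at x)" shows "(\<lambda>y. trace (A y)) differentiable (at x)"
  using assms bounded_linear.has_derivative[OF bounded_linear_trace]
  unfolding differentiable_def by blast

text \<open>By the polarised Cayley-Hamilton identity the anticommutator of two trace-free 2x2
  matrices is the trace of their product times the identity.\<close>

lemma (in complex_structure) anticommute_if_traceless:
  assumes "trace A = 0" "trace (J ** A) = 0"
  shows "A ** J = - (J ** A)"
proof -
  have h: "A$2$2 = - A$1$1" using assms(1) by (simp add: trace_mat2)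
  have "J$1$1 * A$1$1 + J$1$2 * A$2$1 + J$2$1 * A$1$2 + J$2$2 * A$2$2 = 0"
    using assms(2) by (simp add: trace_mat2 mat2_mult_nth)
  then show ?thesis by (simp add: mat2_eq_iff mat2_simps h J_nth(1) algebra_simps)
qed

text \<open>Sylvester's criterion, by completing the square in the first coordinate.\<close>

lemma pos_def_form_if_det_pos:
  assumes "symmetric_form M" "M$1$1 > 0" "det M > 0"
  shows "pos_def_form M"
  unfolding pos_def_form_def
proof (intro allI impI)
  fix X :: "real^2" assume X: "X \<noteq> 0"
  have "transpose M $ 1 $ 2 = M $ 1 $ 2" using assms(1) by (simp only: symmetric_form_def)
  then have "M$2$1 = M$1$2" by (simp add: transpose_def)
  then have e: "M$1$1 * bil M X X = (M$1$1 * X$1 + M$1$2 * X$2)\<^sup>2 + det M * (X$2)\<^sup>2"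
    by (simp add: bil_def mat2_vmult_nth inner_vec_def sum_2 det_2 power2_eq_square algebra_simps)
  have "M$1$1 * bil M X X > 0"
  proof (cases "X$2 = 0")
    case True
    then have "X$1 \<noteq> 0" using X by (auto simp: vec_eq_iff forall_2)
    then show ?thesis unfolding e using assms(2) True by simp
  next
    case False
    then show ?thesis unfolding e using assms(3) by (simp add: add_nonneg_pos)
  qed
  then show "bil M X X > 0" using assms(2) by (simp add: zero_less_mult_iff)
qed

locale pair_field =
  fixes U :: "(real^2) set" and R J s :: "real^2 \<Rightarrow> mat2" and x :: "real^2"
  assumes domain: "open U" "x \<in> U"
    and pair: "\<And>y. y \<in> U \<Longrightarrow> pair_at (R y) (J y) (s y)"
    and fields_differentiable: "R differentiable (at x)" "J differentiable (at x)" "s differentiable (at x)"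
begin

sublocale area_structure U R J x
  using domain pair fields_differentiable by unfold_locales (auto simp: pair_at_def)

definition H :: "real^2 \<Rightarrow> mat2" where "H y = matrix_inv (R y ** J y) ** s y"

definition f :: "real^2 \<Rightarrow> real" where "f y = sqrt (1 + inner_form (R y ** J y) (s y) (s y))"

definition Jl :: "real^2 \<Rightarrow> mat2" where "Jl y = f y *\<^sub>R J y + H y"

lemma complex_structure: "y \<in> U \<Longrightarrow> complex_structure (J y)"
  using J by unfold_locales

lemma H_anticommute: "y \<in> U \<Longrightarrow> H y ** J y = - (J y ** H y)"
  using complex_structure.anticommute_if_traceless[OF complex_structure]
    pair_at_facts(4,5)[OF pair] by (simp add: H_def)

lemma f_pos: "y \<in> U \<Longrightarrow> f y > 0"
  using pair_at_facts(2)[OF pair] by (simp add: f_def add_pos_nonneg)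

lemma f_square: "y \<in> U \<Longrightarrow> (f y)\<^sup>2 = 1 + trace (H y ** H y) / 2"
  using pair_at_facts(2)[OF pair] by (simp add: f_def H_def inner_form_def)

lemma H_differentiable: "H differentiable (at x)"
proof -
  have "(\<lambda>y. matrix_inv (R y ** J y)) differentiable (at x)"
    using differentiable_matrix_inv[OF differentiable_metric] pair_at_facts(1)[OF pair[OF U(2)]]
    by simp
  then show ?thesis
    unfolding H_def[abs_def] by (intro differentiable_mat2_mult fields_differentiable)
qed

lemma f_differentiable: "f differentiable (at x)"
proof -
  have "(\<lambda>y. 1 + trace (H y ** H y) / 2) differentiable (at x)"
    unfolding divide_inverse
    by (intro differentiable_add differentiable_mult differentiable_const trace_differentiable
        differentiable_mat2_mult H_differentiable)
  then obtain D where D: "((\<lambda>y. 1 + trace (H y ** H y) / 2) has_derivative D) (at x)"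
    by (auto simp: differentiable_def)
  have "1 + trace (H x ** H x) / 2 > 0"
    using zero_less_power[OF f_pos[OF U(2)], of 2] f_square[OF U(2)] by simp
  from has_derivative_real_sqrt[OF _ D, OF this]
  have "(\<lambda>y. sqrt (1 + trace (H y ** H y) / 2)) differentiable (at x)"
    by (rule differentiableI)
  moreover have "f = (\<lambda>y. sqrt (1 + trace (H y ** H y) / 2))"
    by (simp add: fun_eq_iff f_def H_def inner_form_def)
  ultimately show ?thesis by simp
qed

lemma Jl_differentiable: "Jl differentiable (at x)"
  unfolding Jl_def[abs_def]
  by (intro differentiable_add differentiable_scaleR f_differentiable H_differentiable
      differentiable)

end

locale codazzi_pair = pair_field +
  assumes codazzi: "nabla_endo metric H x X *v Y = nabla_endo metric H x Y *v X"
begin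

definition T :: "real^2 \<Rightarrow> mat2" where "T = nabla_endo metric H x"

lemma T_sym: "T V *v W = T W *v V"
  unfolding T_def by (rule codazzi)

lemma T_anticommute: "T V ** J x = - (J x ** T V)"
proof -
  have "nabla_endo metric (\<lambda>y. H y ** J y) x V = nabla_endo metric (\<lambda>y. - (J y ** H y)) x V"
    by (subst nabla_endo_cong[OF U H_anticommute]) simp_all
  then show ?thesis
    by (simp add: nabla_endo_mult H_differentiable differentiable nabla_J mat2_linear_simps
        nabla_endo_uminus differentiable_mat2_mult T_def)
qed

text \<open>The Cauchy-Riemann equation of the quadratic differential: symmetry exchanges the two
  slots, anticommutation carries \<open>J\<close> across, and a second exchange returns to
  \<open>T X\<close>.\<close>

lemma T_J: "T (J x *v X) = T X ** J x"
proof (rule mat2_eqI_vmult)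
  fix Y
  have "T (J x *v X) *v Y = (T Y ** J x) *v X"
    by (simp add: T_sym[of _ Y] matrix_vector_mul_assoc)
  also have "\<dots> = - (J x *v (T X *v Y))"
    by (simp add: T_anticommute mat2_neg_vmult matrix_vector_mul_assoc[symmetric] T_sym[of Y])
  also have "\<dots> = (T X ** J x) *v Y"
    by (simp add: T_anticommute mat2_neg_vmult matrix_vector_mul_assoc)
  finally show "T (J x *v X) *v Y = (T X ** J x) *v Y" .
qed

lemma T_linear: "T (V + W) = T V + T W" "T (r *\<^sub>R V) = r *\<^sub>R T V"
  unfolding T_def by (rule nabla_endo_linear[OF H_differentiable])+

lemma f_derivative: "f x * frechet_derivative f (at x) V = trace (H x ** T V) / 2"
proof -
  have "2 * (f x * frechet_derivative f (at x) V) = frechet_derivative (\<lambda>y. f y * f y) (at x) V"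
    using frechet_derivative_bilinear[OF bounded_bilinear_mult f_differentiable f_differentiable, of V]
    by simp
  also have "\<dots> = frechet_derivative (\<lambda>y. 1 + trace (H y ** H y) / 2) (at x) V"
    using f_square
    by (subst frechet_derivative_cong[OF U, of _ "\<lambda>y. 1 + trace (H y ** H y) / 2"])
      (simp_all add: power2_eq_square)
  also have "\<dots> = frechet_derivative (\<lambda>y. trace (H y ** H y)) (at x) V / 2"
  proof -
    have t: "(\<lambda>y. trace (H y ** H y)) differentiable (at x)"
      by (intro trace_differentiable differentiable_mat2_mult H_differentiable)
    have "((\<lambda>y. 1 + trace (H y ** H y) / 2) has_derivative
        (\<lambda>v. 0 + frechet_derivative (\<lambda>y. trace (H y ** H y)) (at x) v / 2)) (at x)"
      using t[unfolded frechet_derivative_works]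
      by (intro has_derivative_add has_derivative_const bounded_linear.has_derivative[OF bounded_linear_divide])
    from fun_cong[OF frechet_derivative_at[OF this], of V] show ?thesis by simp
  qed
  also have "frechet_derivative (\<lambda>y. trace (H y ** H y)) (at x) V = 2 * trace (H x ** T V)"
    using trace_mult_commute[of "T V" "H x"]
    by (simp add: trace_nabla_endo[OF differentiable_mat2_mult[OF H_differentiable H_differentiable], of V metric]
        nabla_endo_mult[OF H_differentiable H_differentiable] trace_mat2_simps T_def)
  finally show ?thesis by simp
qed

lemma nabla_Jl: "nabla_endo metric Jl x V = frechet_derivative f (at x) V *\<^sub>R J x + T V"
  unfolding Jl_def[abs_def]
  by (subst nabla_endo_add)
    (auto simp: nabla_endo_scaleR f_differentiable differentiable nabla_J T_def
      intro!: differentiable_scaleR H_differentiable)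

text \<open>Makes the calculus above available for the metric of the Mess image. Positivity reduces
  to \<open>f + h' > 0\<close>, where \<open>h'\<close> is a coordinate of \<open>H\<close>, and
  this follows from \<open>f * f = 1 + h * h + h' * h'\<close> with \<open>f\<close>
  positive.\<close>

lemma Jl_area_structure: "area_structure U R Jl x"
proof
  fix y assume y: "y \<in> U"
  interpret complex_structure "J y" by (rule complex_structure[OF y])
  show sq: "Jl y ** Jl y = - mat 1"
    unfolding Jl_def by (rule mess_square[OF H_anticommute[OF y] f_square[OF y]])
  interpret Jl: complex_structure "Jl y" using sq by unfold_locales
  obtain h h' where h: "H y = qt 0 0 h h'" using H_anticommute[OF y] by (rule anticommuting_qtE)
  have "(f y)\<^sup>2 = 1 + h\<^sup>2 + h'\<^sup>2"
    using f_square[OF y] by (simp add: h qt_simps power2_eq_square del: distrib_left_numeral)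
  then have "(- h')\<^sup>2 < (f y)\<^sup>2" using zero_le_power2[of h] by (simp add: add_pos_nonneg)
  then have "- h' < f y" using f_pos[OF y] by (meson less_eq_real_def power_less_imp_less_base)
  moreover have "Jl y $ 2 $ 1 = (f y + h') * J y $ 2 $ 1"
    by (simp add: Jl_def h qt_def mat_1_mat2 K_nth mat2_mult_nth algebra_simps)
  moreover have "J y $ 2 $ 1 > 0"
    using pair_at_params[OF pair[OF y]] by metis
  ultimately have "(R y ** Jl y) $ 1 $ 1 > 0"
    using R(2)[OF y] by (simp add: mat2_mult_nth R_nth[OF y])
  moreover have "det (R y ** Jl y) > 0"
  proof -
    have "det (Jl y) = 1" using Jl.J_nth by (simp add: det_2)
    then show ?thesis using R(2)[OF y] by (simp add: det_mul) (simp add: det_2 R_nth[OF y])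
  qed
  moreover have "symmetric_form (R y ** Jl y)"
    by (simp add: symmetric_form_def mat2_eq_iff transpose_def mat2_mult_nth R_nth[OF y] Jl.J_nth(1))
  ultimately show "pos_def_form (R y ** Jl y)" by (intro pos_def_form_if_det_pos)
qed (fact U R differentiable Jl_differentiable)+

section \<open>The defect of a field anticommuting with \<open>J\<close>\<close>

context
  fixes Q :: "real^2 \<Rightarrow> mat2"
  assumes Q: "Q differentiable (at x)" and anticommute: "\<And>y. y \<in> U \<Longrightarrow> Q y ** J y = - (J y ** Q y)"
begin

definition defect :: "real^2 \<Rightarrow> real" where
  "defect X = divergence metric Q x X + inverse (f x) * (trace (T (J x *v X) ** Q x) / 2)"

text \<open>\<open>f df (Q X)\<close> is half the trace of \<open>H ** T (Q X)\<close>, by symmetry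
  of \<open>T\<close> a sum of components of \<open>H T(e_k) Q X\<close>. Reversing the product of
  three anticommuting matrices exchanges the roles of \<open>H\<close> and \<open>Q\<close>.\<close>

lemma f_derivative_Q: "frechet_derivative f (at x) (Q x *v X) = inverse (f x) * (trace (T (H x *v X) ** Q x) / 2)"
proof -
  interpret complex_structure "J x" by (rule complex_structure[OF U(2)])
  have e: "trace (A ** T (B *v X)) = (\<Sum>k\<in>UNIV. ((A ** T (axis k 1) ** B) *v X) $ k)" for A B
    unfolding trace_eq_sum_axis
    by (simp add: T_sym[of "B *v X"] matrix_vector_mul_assoc[symmetric])
  have "trace (H x ** T (Q x *v X)) = trace (Q x ** T (H x *v X))"
    unfolding e using anticommuting_triple_commute[OF H_anticommute[OF U(2)] T_anticommute anticommute[OF U(2)]]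
    by metis
  then have "f x * frechet_derivative f (at x) (Q x *v X) = trace (T (H x *v X) ** Q x) / 2"
    by (simp add: f_derivative trace_mult_commute[of "Q x"])
  then show ?thesis using f_pos[OF U(2)] by (simp add: field_simps)
qed

lemma QJJl_differentiable: "(\<lambda>y. Q y ** J y ** Jl y) differentiable (at x)"
  by (intro differentiable_mat2_mult Q Jl_differentiable differentiable)

text \<open>Differentiating \<open>J_l\<close> contributes \<open>- trace (T (J X) ** Q)\<close> and
  \<open>- df (Q X)\<close>. Because \<open>J C X = - f J X - H X\<close>, adding half of that trace
  leaves exactly the two pairing terms of the defect at \<open>C X\<close>.\<close>

lemma divergence_QJJl:
  "divergence metric (\<lambda>y. Q y ** J y ** Jl y) x X + trace (T (J x *v X) ** Q x) / 2 =
    defect ((J x ** Jl x) *v X)"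
proof -
  define df where "df = frechet_derivative f (at x)"
  have df: "linear df" unfolding df_def by (rule linear_frechet_derivative[OF f_differentiable])
  have nabla: "nabla_endo metric (\<lambda>y. Q y ** J y ** Jl y) x V =
      nabla_endo metric Q x V ** (J x ** Jl x) + (Q x ** J x ** T V - df V *\<^sub>R Q x)" for V
    by (subst nabla_endo_mult)
      (simp_all add: differentiable_mat2_mult Q differentiable Jl_differentiable nabla_endo_mult nabla_J nabla_Jl
        mat2_linear_simps matrix_mul_assoc[symmetric] J[OF U(2)] df_def)
  have QT: "(\<Sum>k\<in>UNIV. ((Q x ** J x ** T (axis k 1)) *v X) $ k) = - trace (T (J x *v X) ** Q x)"
  proof -
    have "(\<Sum>k\<in>UNIV. ((Q x ** J x ** T (axis k 1)) *v X) $ k) = trace (Q x ** J x ** T X)"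
      unfolding trace_eq_sum_axis
      by (simp add: matrix_vector_mul_assoc[symmetric] T_sym[of "axis _ 1" X])
    also have "\<dots> = - trace (Q x ** T (J x *v X))"
      by (simp add: T_J T_anticommute matrix_mul_assoc[symmetric] mat2_linear_simps trace_mat2_simps)
    finally show ?thesis by (simp add: trace_mult_commute)
  qed
  have dfQ: "(\<Sum>k\<in>UNIV. ((df (axis k 1) *\<^sub>R Q x) *v X) $ k) = df (Q x *v X)"
  proof -
    have "Q x *v X = (Q x *v X)$1 *\<^sub>R axis 1 1 + (Q x *v X)$2 *\<^sub>R axis 2 1"
      by (simp add: vec_eq_iff forall_2 axis_def)
    then have "df (Q x *v X) = (Q x *v X)$1 * df (axis 1 1) + (Q x *v X)$2 * df (axis 2 1)"
      using linear_add[OF df] linear_scale[OF df] by (metis real_scaleR_def)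
    then show ?thesis by (simp add: sum_2 scaleR_matrix_vector_assoc[symmetric])
  qed
  have "divergence metric (\<lambda>y. Q y ** J y ** Jl y) x X =
      divergence metric Q x ((J x ** Jl x) *v X) - trace (T (J x *v X) ** Q x) - df (Q x *v X)"
    unfolding divergence_metric[OF QJJl_differentiable] divergence_metric[OF Q] nabla
    using QT dfQ
    by (simp add: matrix_vector_mult_diff_rdistrib matrix_vector_mult_add_rdistrib
        matrix_vector_mul_assoc sum.distrib sum_subtractf)
  moreover have "trace (T (J x *v ((J x ** Jl x) *v X)) ** Q x) =
      - f x * trace (T (J x *v X) ** Q x) - trace (T (H x *v X) ** Q x)"
  proof -
    have e: "J x *v ((J x ** Jl x) *v X) = (- f x) *\<^sub>R (J x *v X) + (- 1) *\<^sub>R (H x *v X)"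
    proof -
      have "J x ** (J x ** Jl x) = - Jl x"
        by (simp add: matrix_mul_assoc J[OF U(2)] mat2_linear_simps)
      then have "J x *v ((J x ** Jl x) *v X) = - (Jl x *v X)"
        by (simp only: matrix_vector_mul_assoc mat2_neg_vmult)
      then show ?thesis
        by (simp add: Jl_def matrix_vector_mult_add_rdistrib scaleR_matrix_vector_assoc[symmetric])
    qed
    show ?thesis
      unfolding e T_linear by (simp add: mat2_linear_simps trace_mat2_simps)
  qed
  ultimately show ?thesis
    using f_pos[OF U(2)] by (simp add: defect_def df_def f_derivative_Q field_simps)
qed

lemma defect_vanishes_iff:
  "(\<forall>X. divergence metric (\<lambda>y. Q y ** J y ** Jl y) x X = - (trace (T (J x *v X) ** Q x) / 2)) \<longleftrightarrow>
   (\<forall>X. divergence metric Q x X = - (inverse (f x) * (trace (T (J x *v X) ** Q x) / 2)))"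
proof -
  interpret complex_structure "J x" by (rule complex_structure[OF U(2)])
  have "J x ** Jl x = J x ** H x - f x *\<^sub>R mat 1"
    by (simp add: Jl_def mat2_linear_simps JJ)
  then have "(J x ** Jl x) ** (- (J x ** H x + f x *\<^sub>R mat 1)) = mat 1"
    using mess_inverse[OF H_anticommute[OF U(2)] f_square[OF U(2)]] by simp
  then have surj: "\<exists>Y. X = (J x ** Jl x) *v Y" for X
    by (metis matrix_vector_mul_assoc matrix_vector_mul_lid)
  have "(\<forall>X. defect ((J x ** Jl x) *v X) = 0) \<longleftrightarrow> (\<forall>X. defect X = 0)"
    using surj by metis
  then show ?thesis
    unfolding divergence_QJJl[symmetric] unfolding defect_def by (simp add: eq_neg_iff_add_eq_0)
qed

lemma divergence_mess_tangent:
  assumes "\<And>X. divergence metric (\<lambda>y. Q y ** J y ** Jl y) x X = - (trace (T (J x *v X) ** Q x) / 2)"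
  shows "divergence (\<lambda>y. R y ** Jl y) (\<lambda>y. (trace (H y ** Q y) / 2) *\<^sub>R J y + f y *\<^sub>R Q y) x X =
    frechet_derivative (\<lambda>y. trace (H y ** Q y ** J y) / 2) (at x) X"
proof -
  define A where "A y = (trace (H y ** Q y) / 2) *\<^sub>R J y + f y *\<^sub>R Q y" for y
  define u where "u y = trace (H y ** Q y ** J y) / 2" for y
  have u: "u differentiable (at x)"
    unfolding u_def[abs_def] divide_inverse
    by (intro differentiable_mult differentiable_const trace_differentiable differentiable_mat2_mult
        H_differentiable Q differentiable)
  have A: "A differentiable (at x)"
    unfolding A_def[abs_def] divide_inverse
    by (intro differentiable_add differentiable_scaleR differentiable_mult differentiable_const
        trace_differentiable differentiable_mat2_mult H_differentiable f_differentiable Q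
        differentiable)
  have A_eq: "A y = u y *\<^sub>R mat 1 - Q y ** J y ** Jl y" if "y \<in> U" for y
    unfolding A_def u_def Jl_def
    by (rule complex_structure.mess_tangent_eq[OF complex_structure[OF that]
        H_anticommute[OF that] f_square[OF that] anticommute[OF that]])
  have "nabla_endo metric A x V =
      frechet_derivative u (at x) V *\<^sub>R mat 1 - nabla_endo metric (\<lambda>y. Q y ** J y ** Jl y) x V" for V
  proof -
    have "nabla_endo metric A x V =
        nabla_endo metric (\<lambda>y. u y *\<^sub>R mat 1 - Q y ** J y ** Jl y) x V"
      by (subst nabla_endo_cong[OF U A_eq]) simp_all
    also have "\<dots> = nabla_endo metric (\<lambda>y. u y *\<^sub>R mat 1) x V -
        nabla_endo metric (\<lambda>y. Q y ** J y ** Jl y) x V"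
      by (intro nabla_endo_diff differentiable_scaleR u differentiable_const QJJl_differentiable)
    also have "nabla_endo metric (\<lambda>y. u y *\<^sub>R mat 1) x V = frechet_derivative u (at x) V *\<^sub>R mat 1"
      using nabla_endo_scaleR[OF u, of "\<lambda>_. mat 1" metric V] nabla_endo_const_mat1[of metric 1 x V]
      by simp
    finally show ?thesis .
  qed
  moreover have "frechet_derivative u (at x) X = (\<Sum>k\<in>UNIV. ((frechet_derivative u (at x) (axis k 1) *\<^sub>R mat 1) *v X) $ k)"
  proof -
    have "X = X$1 *\<^sub>R axis 1 1 + X$2 *\<^sub>R axis 2 1"
      by (simp add: vec_eq_iff forall_2 axis_def)
    then have "frechet_derivative u (at x) X = X$1 * frechet_derivative u (at x) (axis 1 1)
        + X$2 * frechet_derivative u (at x) (axis 2 1)"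
      using linear_add[OF linear_frechet_derivative[OF u]] linear_scale[OF linear_frechet_derivative[OF u]]
      by (metis real_scaleR_def)
    then show ?thesis by (simp add: sum_2 scaleR_matrix_vector_assoc[symmetric])
  qed
  ultimately have "divergence metric A x X = frechet_derivative u (at x) X
      - divergence metric (\<lambda>y. Q y ** J y ** Jl y) x X"
    unfolding divergence_metric[OF QJJl_differentiable] divergence_metric[OF A]
    by (simp add: matrix_vector_mult_diff_rdistrib sum_subtractf)
  \<comment> \<open>Half of this trace is the correction for passing to the metric of
    \<open>J_l\<close>; it cancels the term that the assumption puts in place of the divergence of
    \<open>Q J J_l\<close>.\<close>
  moreover have "trace (A x ** nabla_endo metric Jl x X ** Jl x) = trace (T (J x *v X) ** Q x)"
    unfolding nabla_Jl A_def Jl_def T_J trace_mult_commute[of "T X ** J x" "Q x"]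
    by (rule complex_structure.mess_connection_trace[OF complex_structure[OF U(2)]
        H_anticommute[OF U(2)] f_square[OF U(2)] anticommute[OF U(2)] T_anticommute f_derivative])
  moreover have "A x ** Jl x = - (Jl x ** A x)"
    unfolding A_def Jl_def
    by (rule complex_structure.mess_tangent_anticommute[OF complex_structure[OF U(2)]
        H_anticommute[OF U(2)] f_square[OF U(2)] anticommute[OF U(2)]])
  ultimately show ?thesis
    using divergence_change_of_complex_structure[OF area_structure_axioms Jl_area_structure A, of X] assms
    by (simp add: A_def[abs_def] u_def[abs_def])
qed

end

end

section \<open>The first variation of the Mess map\<close>

lemma differentiable_nonzero_nhd:
  fixes F :: "'b::real_normed_vector \<Rightarrow> real"
  assumes "F differentiable (at z)" "F z \<noteq> 0"
  obtains W where "open W" "z \<in> W" "\<And>w. w \<in> W \<Longrightarrow> F w \<noteq> 0"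
proof -
  have "isCont F z" using assms(1) by (rule differentiable_imp_continuous_within)
  then have "(F \<longlongrightarrow> F z) (nhds z)" by (simp add: continuous_within tendsto_nhds_iff)
  then have "eventually (\<lambda>w. F w \<noteq> 0) (nhds z)"
    using assms(2) by (rule tendsto_imp_eventually_ne)
  then show ?thesis using that by (auto simp: eventually_nhds)
qed

lemma differentiable_det:
  fixes F :: "'b::real_normed_vector \<Rightarrow> mat2"
  shows "F differentiable (at z) \<Longrightarrow> (\<lambda>z. det (F z)) differentiable (at z)"
  unfolding det_2 by (intro differentiable_diff differentiable_mult differentiable_mat2_nth)

lemma mat2_left_cancel:
  assumes "(M::mat2) ** A = M ** B" "det M \<noteq> 0" shows "(A::mat2) = B"
proof -
  have "matrix_inv M ** (M ** A) = matrix_inv M ** (M ** B)" using assms(1) by simp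
  then show ?thesis by (simp add: matrix_mul_assoc matrix_inv_cancel(2)[OF assms(2)])
qed

text \<open>The inverse of \<open>R ** J\<close> is \<open>- J\<close> times the inverse of
  \<open>R\<close>, so multiplying the endomorphism by \<open>J\<close> gives the inverse of
  \<open>R\<close> times \<open>s\<close>. Its trace pairs a skew matrix with a symmetric one and
  vanishes.\<close>

lemma sharp_anticommute:
  fixes R J s :: mat2
  assumes "transpose R = - R" "R $ 1 $ 2 > 0" "J ** J = - mat 1"
    and "transpose s = s" "trace (matrix_inv (R ** J) ** s) = 0"
  shows "(matrix_inv (R ** J) ** s) ** J = - (J ** (matrix_inv (R ** J) ** s))"
proof -
  interpret complex_structure J by (unfold_locales) fact
  have "transpose R $ i $ j = (- R) $ i $ j" for i j using assms(1) by simp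
  from this[of 1 1] this[of 2 2] this[of 1 2]
  have R: "R $ 1 $ 1 = 0" "R $ 2 $ 2 = 0" "R $ 2 $ 1 = - R $ 1 $ 2"
    by (simp_all add: transpose_def)
  have d: "det R \<noteq> 0" using assms(2) by (simp add: det_2 R)
  have "(R ** J) ** (- (J ** matrix_inv R)) = R ** (- (J ** J)) ** matrix_inv R"
    by (simp add: mat2_linear_simps matrix_mul_assoc)
  also have "\<dots> = mat 1" by (simp add: JJ matrix_inv_cancel(1)[OF d])
  finally have "matrix_inv (R ** J) = - (J ** matrix_inv R)" by (rule matrix_inv_unique2)
  then have "J ** (matrix_inv (R ** J) ** s) = - (J ** J) ** matrix_inv R ** s"
    by (simp add: mat2_linear_simps matrix_mul_assoc)
  then have "J ** (matrix_inv (R ** J) ** s) = matrix_inv R ** s" by (simp add: JJ)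
  moreover have "transpose s $ 1 $ 2 = s $ 1 $ 2" using assms(4) by simp
  then have "trace (matrix_inv R ** s) = 0"
    unfolding matrix_inv_mat2[OF d] trace_mat2 mat2_mult_nth
    by (simp add: adj2_nth R transpose_def)
  ultimately show ?thesis using assms(5) by (intro anticommute_if_traceless) simp_all
qed

text \<open>\<open>N\<close> is the conjugating matrix cleared of its denominator
  \<open>1 + f\<close>. Both sides of the conjugation relation are differentiated near the pair,
  \<open>mess_linearised\<close> recognises a solution, and invertibility of \<open>N\<close> makes
  it the only one.\<close>

lemma mess_l_derivative:
  fixes R J s J' s' s\<^sub>0 H P :: mat2 and f :: real
  assumes pair: "pair_at R J s"
    and J': "J' ** J + J ** J' = 0"
    and s': "s' = s\<^sub>0 - pair_endo (R ** J) s (J ** J') *\<^sub>R (R ** J)"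
    and s\<^sub>0: "transpose s\<^sub>0 = s\<^sub>0" "trace (matrix_inv (R ** J) ** s\<^sub>0) = 0"
  defines "H \<equiv> matrix_inv (R ** J) ** s" and "f \<equiv> sqrt (1 + inner_form (R ** J) s s)"
  defines "P \<equiv> inverse f *\<^sub>R (matrix_inv (R ** J) ** s\<^sub>0)"
  shows "frechet_derivative (mess_l_at R) (at (J, s)) (J', s') =
    (trace (H ** (P + J')) / 2) *\<^sub>R J + f *\<^sub>R (P + J')"
proof -
  let ?z = "(J, s)" and ?v = "(J', s')"
  define Hz where "Hz z = matrix_inv (R ** fst z) ** snd z" for z :: "mat2 \<times> mat2"
  define fz where "fz z = sqrt (1 + inner_form (R ** fst z) (snd z) (snd z))" for z :: "mat2 \<times> mat2"
  define N where "N z = (1 + fz z) *\<^sub>R mat 1 - fst z ** Hz z" for z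
  define M where "M z = mat 1 - fst z ** shape_at R (fst z) (snd z)" for z :: "mat2 \<times> mat2"
  note facts = pair_at_facts[OF pair, folded H_def]
  interpret complex_structure J using pair by unfold_locales (simp add: pair_at_def)
  have at: "Hz ?z = H" "fz ?z = f" by (simp_all add: Hz_def H_def fz_def f_def)
  have f: "f > 0" "f\<^sup>2 = 1 + trace (H ** H) / 2"
    using facts(2) by (simp_all add: f_def add_pos_nonneg) (simp add: inner_form_def H_def)
  have H: "H ** J = - (J ** H)" using facts(4,5) by (rule anticommute_if_traceless)
  have J'_anti: "J' ** J = - (J ** J')" using J' by (simp add: eq_neg_iff_add_eq_0)
  have P_anti: "P ** J = - (J ** P)"
    using sharp_anticommute[of R J s\<^sub>0] pair s\<^sub>0
    by (simp add: P_def mat2_linear_simps pair_at_def)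
  have fs: "fst differentiable (at ?z)" "snd differentiable (at ?z)"
    unfolding differentiable_def
    using bounded_linear_imp_has_derivative[OF bounded_linear_fst]
      bounded_linear_imp_has_derivative[OF bounded_linear_snd] by blast+
  have dfs: "frechet_derivative fst (at ?z) ?v = J'" "frechet_derivative snd (at ?z) ?v = s'"
    using frechet_derivative_bounded_linear[OF bounded_linear_fst, of "\<lambda>z. z" ?z ?v]
      frechet_derivative_bounded_linear[OF bounded_linear_snd, of "\<lambda>z. z" ?z ?v]
    by (simp_all add: frechet_derivative_ident)
  have RJ: "(\<lambda>z. R ** fst z) differentiable (at ?z)"
    by (intro differentiable_mat2_mult differentiable_const fs)
  have dRJ: "frechet_derivative (\<lambda>z. R ** fst z) (at ?z) ?v = R ** J'"
    by (subst frechet_derivative_mat2_mult) (simp_all add: fs dfs frechet_derivative_const mat2_linear_simps)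
  have Hd: "Hz differentiable (at ?z)"
    unfolding Hz_def[abs_def] using facts(1)
    by (intro differentiable_mat2_mult differentiable_matrix_inv RJ fs) simp
  obtain W where W: "open W" "?z \<in> W" "\<And>z. z \<in> W \<Longrightarrow> det (R ** fst z) \<noteq> 0"
    using differentiable_nonzero_nhd[OF differentiable_det[OF RJ]] facts(1) by auto
  define H' where "H' = frechet_derivative Hz (at ?z) ?v"
  \<comment> \<open>Obtained by differentiating \<open>(R J) H = s\<close>, valid wherever
    \<open>R J\<close> is invertible, instead of the inverse matrix in the definition of
    \<open>H\<close>.\<close>
  have H': "H' = f *\<^sub>R P + (trace (H ** J') / 2) *\<^sub>R J"
  proof -
    have "s' = frechet_derivative (\<lambda>z. (R ** fst z) ** Hz z) (at ?z) ?v"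
      using dfs(2) by (subst frechet_derivative_cong[OF W(1,2), of _ snd])
        (simp_all add: Hz_def matrix_mul_assoc matrix_inv_cancel[OF W(3)])
    also have "\<dots> = (R ** J) ** H' + R ** J' ** H"
      by (simp add: frechet_derivative_mat2_mult[OF RJ Hd] dRJ H'_def at)
    finally have e: "(R ** J) ** H' = s' - R ** J' ** H" by simp
    have e1: "R ** J' ** H = - ((R ** J) ** (J ** J' ** H))"
      by (simp add: matrix_mul_assoc[symmetric]) (simp add: matrix_mul_assoc[of J J] JJ mat2_linear_simps)
    have e2: "s' = (R ** J) ** (f *\<^sub>R P - pair_endo (R ** J) s (J ** J') *\<^sub>R mat 1)"
      using f(1) matrix_inv_cancel(1)[of "R ** J"] facts(1)
      by (simp add: s' P_def mat2_linear_simps matrix_mul_assoc)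
    have "(R ** J) ** H' =
        (R ** J) ** (f *\<^sub>R P - (trace (H ** (J ** J')) / 2) *\<^sub>R mat 1 + J ** J' ** H)"
      unfolding e e1 by (subst e2) (simp add: mat2_linear_simps pair_endo_def H_def)
    then have "H' = f *\<^sub>R P - (trace (H ** (J ** J')) / 2) *\<^sub>R mat 1 + J ** J' ** H"
      by (rule mat2_left_cancel) (use facts(1) in simp)
    also have "f *\<^sub>R P - (trace (H ** (J ** J')) / 2) *\<^sub>R mat 1 + J ** J' ** H =
        f *\<^sub>R P + (trace (H ** J') / 2) *\<^sub>R J"
    proof -
      obtain h h' j j' where *: "H = qt 0 0 h h'" "J' = qt 0 0 j j'"
        by (meson H J'_anti anticommuting_qtE)
      \<comment> \<open>\<open>J J' H\<close> commutes with \<open>J\<close>, and its scalar part is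
        exactly the trace term prescribed for tangent vectors; what survives is a multiple of
        \<open>J\<close>.\<close>
      have "J ** J' ** H - (trace (H ** (J ** J')) / 2) *\<^sub>R mat 1 = (trace (H ** J') / 2) *\<^sub>R J"
        by (simp add: * qt_simps) (simp add: algebra_simps add_divide_distrib diff_divide_distrib)
      moreover have "A - B + C = A + (C - B)" for A B C :: mat2 by simp
      ultimately show ?thesis by (simp only:)
    qed
    finally show ?thesis .
  qed
  define f' where "f' = frechet_derivative fz (at ?z) ?v"
  define S where "S z = 1 + trace (Hz z ** Hz z) / 2" for z
  have fz_eq: "fz = (\<lambda>z. sqrt (S z))" by (simp add: fun_eq_iff fz_def S_def Hz_def inner_form_def)
  have tr: "(\<lambda>z. trace (Hz z ** Hz z)) differentiable (at ?z)"
    by (intro trace_differentiable differentiable_mat2_mult Hd)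
  have dtr: "frechet_derivative (\<lambda>z. trace (Hz z ** Hz z)) (at ?z) ?v = 2 * trace (H ** H')"
    using trace_mult_commute[of H' H]
    by (simp add: frechet_derivative_bounded_linear[OF bounded_linear_trace differentiable_mat2_mult[OF Hd Hd]]
        frechet_derivative_mat2_mult[OF Hd Hd] at H'_def[symmetric] trace_mat2_simps)
  have "(S has_derivative (\<lambda>v. 0 + frechet_derivative (\<lambda>z. trace (Hz z ** Hz z)) (at ?z) v / 2)) (at ?z)"
    unfolding S_def[abs_def] using tr[unfolded frechet_derivative_works]
    by (intro has_derivative_add has_derivative_const bounded_linear.has_derivative[OF bounded_linear_divide])
  note df = has_derivative_real_sqrt[OF _ this, folded fz_eq]
  have S0: "S ?z > 0" using f zero_less_power[of f 2] by (simp add: S_def at)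
  have fd: "fz differentiable (at ?z)" by (rule differentiableI[OF df[OF S0]])
  have f': "f' = trace (H ** P) / 2"
  proof -
    have "f' = trace (H ** H') * (inverse f / 2)"
      using fun_cong[OF frechet_derivative_at[OF df[OF S0]], of ?v] at(2)
      by (simp add: f'_def dtr fun_cong[OF fz_eq, symmetric])
    moreover have "trace (H ** H') = f * trace (H ** P)"
      using facts(5) trace_mult_commute[of J H]
      by (simp add: H' mat2_linear_simps trace_mat2_simps)
    ultimately show ?thesis using f(1) by simp
  qed
  have Nd: "N differentiable (at ?z)"
    unfolding N_def[abs_def]
    by (intro differentiable_diff differentiable_scaleR differentiable_add differentiable_const
        differentiable_mat2_mult fd Hd fs)
  have dN: "frechet_derivative N (at ?z) ?v = f' *\<^sub>R mat 1 - (J' ** H + J ** H')"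
  proof -
    have "((\<lambda>z. (1 + fz z) *\<^sub>R (mat 1 :: mat2)) has_derivative
        (\<lambda>v. (0 + frechet_derivative fz (at ?z) v) *\<^sub>R mat 1)) (at ?z)"
      using fd[unfolded frechet_derivative_works]
      by (intro bounded_linear.has_derivative[OF bounded_linear_scaleR_left] has_derivative_add has_derivative_const)
    then have d1: "(\<lambda>z. (1 + fz z) *\<^sub>R (mat 1 :: mat2)) differentiable (at ?z)"
      and d2: "frechet_derivative (\<lambda>z. (1 + fz z) *\<^sub>R (mat 1 :: mat2)) (at ?z) ?v = f' *\<^sub>R mat 1"
      by (auto intro: differentiableI simp: f'_def frechet_derivative_at[symmetric])
    show ?thesis
      unfolding N_def[abs_def]
        frechet_derivative_rules(2)[OF d1 differentiable_mat2_mult[OF fs(1) Hd]]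
        frechet_derivative_mat2_mult[OF fs(1) Hd] d2
      by (simp add: at H'_def dfs add.commute)
  qed
  have det_N: "det (N ?z) \<noteq> 0"
  proof -
    have "N ?z = (1 + f) *\<^sub>R (mat 1 - J ** shape_at R J s)"
      using f(1) shape_at_eq[OF pair]
      by (simp add: N_def at f_def[symmetric] H_def[symmetric] mat2_linear_simps algebra_simps)
    moreover have "det ((1 + f) *\<^sub>R A) = (1 + f)\<^sup>2 * det A" for A :: mat2
      by (simp add: det_2 power2_eq_square algebra_simps)
    ultimately show ?thesis using det_mess(1)[OF pair] f(1) by (simp add: f_def[symmetric])
  qed
  have kd: "(\<lambda>z. 1 + fz z) differentiable (at ?z)"
    by (intro differentiable_add differentiable_const fd)
  obtain W' where W': "open W'" "?z \<in> W'" "\<And>z. z \<in> W' \<Longrightarrow> 1 + fz z \<noteq> 0"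
    using differentiable_nonzero_nhd[OF kd] f(1) at(2) by (metis add_pos_pos less_irrefl zero_less_one)
  obtain W'' where W'': "open W''" "?z \<in> W''" "\<And>z. z \<in> W'' \<Longrightarrow> det (N z) \<noteq> 0"
    using differentiable_nonzero_nhd[OF differentiable_det[OF Nd] det_N] by auto
  \<comment> \<open>The three neighbourhoods keep \<open>R ** fst z\<close>, \<open>1 + f\<close>
    and \<open>N\<close> invertible, which suffices for the conjugation formula even away from
    pairs.\<close>
  have NK: "N z ** mess_l_at R z = fst z ** N z" if "z \<in> W \<inter> W' \<inter> W''" for z
  proof -
    note nz = W(3)[of z] W'(3)[of z] W''(3)[of z]
    have "((1 + fz z) *\<^sub>R (R ** fst z)) ** ((1 / (1 + fz z)) *\<^sub>R matrix_inv (R ** fst z)) = mat 1"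
      using nz that matrix_inv_cancel(1)[of "R ** fst z"] by (simp add: mat2_linear_simps)
    then have "matrix_inv ((1 + fz z) *\<^sub>R (R ** fst z)) = (1 / (1 + fz z)) *\<^sub>R matrix_inv (R ** fst z)"
      by (rule matrix_inv_unique2)
    then have "shape_at R (fst z) (snd z) = (1 / (1 + fz z)) *\<^sub>R Hz z"
      by (simp add: shape_at_def fz_def[symmetric] Hz_def mat2_linear_simps)
    then have NM: "N z = (1 + fz z) *\<^sub>R M z"
      using nz that by (simp add: N_def M_def mat2_linear_simps algebra_simps)
    have "det (M z) \<noteq> 0"
      using nz that by (auto simp: NM det_2 algebra_simps)
    then have "M z ** (matrix_inv (M z) ** fst z ** M z) = fst z ** M z"
      by (simp add: matrix_mul_assoc matrix_inv_cancel(1))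
    moreover have "mess_l_at R z = matrix_inv (M z) ** fst z ** M z"
      by (simp add: mess_l_at_def case_prod_beta M_def)
    ultimately show ?thesis by (simp add: NM mat2_linear_simps(1,2))
  qed
  define K' where "K' = frechet_derivative (mess_l_at R) (at ?z) ?v"
  have "frechet_derivative (\<lambda>z. N z ** mess_l_at R z) (at ?z) ?v =
      frechet_derivative (\<lambda>z. fst z ** N z) (at ?z) ?v"
    using W(1,2) W'(1,2) W''(1,2)
    by (subst frechet_derivative_cong[of "W \<inter> W' \<inter> W''", OF _ _ NK]) auto
  then have "(f' *\<^sub>R mat 1 - (J' ** H + J ** H')) ** mess_l_at R ?z + N ?z ** K' =
      J' ** N ?z + J ** (f' *\<^sub>R mat 1 - (J' ** H + J ** H'))"
    by (simp add: frechet_derivative_mat2_mult Nd fs differentiable_mess_at[OF pair] dN dfs K'_def add.commute)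
  moreover have "mess_l_at R ?z = f *\<^sub>R J + H"
    using mess_at_eq(1)[OF pair] by (simp add: f_def H_def)
  moreover have "N ?z = (1 + f) *\<^sub>R mat 1 - J ** H" by (simp add: N_def at)
  ultimately have "N ?z ** K' = N ?z ** ((trace (H ** (P + J')) / 2) *\<^sub>R J + f *\<^sub>R (P + J'))"
    using mess_linearised[OF H f(2) J'_anti P_anti f' H'] by (metis add_left_cancel)
  then show ?thesis
    unfolding K'_def using det_N by (rule mat2_left_cancel)
qed

lemma transpose_uminus_mat2: "transpose (- A :: mat2) = - transpose A"
  by (simp add: transpose_def vec_eq_iff)

lemma mess_r_at_eq_mess_l_at: "mess_r_at R z = mess_l_at R (fst z, - snd z)"
proof -
  have "inner_form G (- s) (- s) = inner_form G s s" for G s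
    by (simp add: inner_form_def mat2_linear_simps)
  then show ?thesis
    by (simp add: mess_r_at_def mess_l_at_def case_prod_beta shape_at_def mat2_linear_simps)
qed

lemma pair_at_uminus: "pair_at R J s \<Longrightarrow> pair_at R J (- s)"
  by (auto simp: pair_at_def symmetric_form_def transpose_uminus_mat2 mat2_linear_simps)

text \<open>Chain rule through the map negating the second component. The negated tangent vector has
  \<open>- P\<close> in place of \<open>P\<close>, so the matrix playing the role of
  \<open>P + J'\<close> is \<open>- (P - J')\<close>; this is the outer sign.\<close>

lemma mess_r_derivative:
  fixes R J s J' s' s\<^sub>0 H P :: mat2 and f :: real
  assumes pair: "pair_at R J s"
    and J': "J' ** J + J ** J' = 0"
    and s': "s' = s\<^sub>0 - pair_endo (R ** J) s (J ** J') *\<^sub>R (R ** J)"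
    and s\<^sub>0: "transpose s\<^sub>0 = s\<^sub>0" "trace (matrix_inv (R ** J) ** s\<^sub>0) = 0"
  defines "H \<equiv> matrix_inv (R ** J) ** s" and "f \<equiv> sqrt (1 + inner_form (R ** J) s s)"
  defines "P \<equiv> inverse f *\<^sub>R (matrix_inv (R ** J) ** s\<^sub>0)"
  shows "frechet_derivative (mess_r_at R) (at (J, s)) (J', s') =
    - ((trace (- H ** (P - J')) / 2) *\<^sub>R J + f *\<^sub>R (P - J'))"
proof -
  have flip: "((\<lambda>z :: mat2 \<times> mat2. (fst z, - snd z)) has_derivative (\<lambda>z. (fst z, - snd z))) (at (J, s))"
    by (intro has_derivative_Pair has_derivative_minus has_derivative_fst has_derivative_snd has_derivative_ident)
  have pair': "pair_at R J (- s)" using pair by (rule pair_at_uminus)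
  have "(mess_l_at R has_derivative frechet_derivative (mess_l_at R) (at (J, - s))) (at (fst (J, s), - snd (J, s)))"
    using differentiable_mess_at(1)[OF pair'] by (simp add: frechet_derivative_works)
  from frechet_derivative_at[OF has_derivative_compose[OF flip this]]
  have "frechet_derivative (mess_r_at R) (at (J, s)) =
      (\<lambda>z. frechet_derivative (mess_l_at R) (at (J, - s)) (fst z, - snd z))"
    by (simp add: mess_r_at_eq_mess_l_at[abs_def])
  moreover have "inner_form (R ** J) (- s) (- s) = inner_form (R ** J) s s"
    by (simp add: inner_form_def mat2_linear_simps)
  moreover have "- s' = - s\<^sub>0 - pair_endo (R ** J) (- s) (J ** J') *\<^sub>R (R ** J)"
    by (simp add: s' pair_endo_def mat2_linear_simps trace_mat2_simps)
  moreover have "transpose (- s\<^sub>0) = - s\<^sub>0" "trace (matrix_inv (R ** J) ** (- s\<^sub>0)) = 0"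
    using s\<^sub>0 by (simp_all add: transpose_uminus_mat2 mat2_linear_simps trace_mat2_simps)
  ultimately show ?thesis
    using mess_l_derivative[OF pair' J', of "- s'" "- s\<^sub>0"]
    by (simp add: f_def[symmetric] H_def[symmetric] P_def[symmetric] mat2_linear_simps
        trace_mat2_simps algebra_simps diff_divide_distrib)
qed

section \<open>Smooth maps\<close>

lemma Ck_on_cong:
  assumes "open U"
  shows "Ck_on k U F \<Longrightarrow> (\<And>x. x \<in> U \<Longrightarrow> F x = G x) \<Longrightarrow> Ck_on k U G"
proof (induction k arbitrary: F G)
  case 0
  then show ?case using continuous_on_cong[of U U F G] by simp
next
  case (Suc k)
  have "Ck_on k U (\<lambda>x. frechet_derivative G (at x) v)" for v
  proof (rule Suc.IH)
    show "Ck_on k U (\<lambda>x. frechet_derivative F (at x) v)" using Suc.prems(1) by simp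
    fix x assume "x \<in> U"
    then show "frechet_derivative F (at x) v = frechet_derivative G (at x) v"
      using frechet_derivative_cong[OF assms _ Suc.prems(2)] by simp
  qed
  moreover have "G differentiable (at x)" if "x \<in> U" for x
    using Suc.prems(1) that by (intro differentiable_cong[OF _ assms that Suc.prems(2)]) auto
  ultimately show ?case by simp
qed

lemma Ck_on_Suc_imp: "Ck_on (Suc k) U F \<Longrightarrow> Ck_on k U F"
proof (induction k arbitrary: F)
  case 0
  then show ?case
    by (auto intro!: continuous_at_imp_continuous_on differentiable_imp_continuous_within)
next
  case (Suc k)
  from Suc.prems have "Ck_on k U (\<lambda>x. frechet_derivative F (at x) v)" for v
    by (intro Suc.IH) simp
  then show ?case using Suc.prems by simp
qed

text \<open>Allows any explicit derivative in place of the chosen one, so that closure of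
  \<open>Ck_on\<close> under an operation follows by induction from its differentiation
  rule.\<close>

lemma Ck_on_SucI:
  assumes "open U" "\<And>x. x \<in> U \<Longrightarrow> (F has_derivative F' x) (at x)" "\<And>v. Ck_on k U (\<lambda>x. F' x v)"
  shows "Ck_on (Suc k) U F"
proof -
  have e: "frechet_derivative F (at x) = F' x" if "x \<in> U" for x
    using frechet_derivative_at[OF assms(2)[OF that]] by simp
  have "Ck_on k U (\<lambda>x. frechet_derivative F (at x) v)" for v
    using e by (intro Ck_on_cong[OF assms(1) assms(3)]) simp
  then show ?thesis using assms(2) by (auto intro: differentiableI)
qed

lemma Ck_on_SucD:
  assumes "Ck_on (Suc k) U F"
  shows "x \<in> U \<Longrightarrow> (F has_derivative frechet_derivative F (at x)) (at x)"
    and "Ck_on k U (\<lambda>x. frechet_derivative F (at x) v)"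
  using assms by (simp_all add: frechet_derivative_works[symmetric])

lemma Ck_on_const: "Ck_on k U (\<lambda>_. c)"
  by (induction k arbitrary: c) (simp_all add: frechet_derivative_const)

lemma Ck_on_add:
  assumes "open U"
  shows "Ck_on k U F \<Longrightarrow> Ck_on k U G \<Longrightarrow> Ck_on k U (\<lambda>x. F x + G x)"
proof (induction k arbitrary: F G)
  case 0
  then show ?case by (simp add: continuous_on_add)
next
  case (Suc k)
  show ?case
    by (rule Ck_on_SucI[OF assms has_derivative_add[OF Ck_on_SucD(1)[OF Suc.prems(1)] Ck_on_SucD(1)[OF Suc.prems(2)]]])
      (assumption | intro Suc.IH Ck_on_SucD(2) Suc.prems)+
qed

lemma Ck_on_bounded_linear:
  assumes "open U" "bounded_linear L"
  shows "Ck_on k U F \<Longrightarrow> Ck_on k U (\<lambda>x. L (F x))"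
proof (induction k arbitrary: F)
  case 0
  then show ?case using bounded_linear.continuous_on[OF assms(2)] by simp
next
  case (Suc k)
  show ?case
    by (rule Ck_on_SucI[OF assms(1) bounded_linear.has_derivative[OF assms(2) Ck_on_SucD(1)[OF Suc.prems]]])
      (assumption | intro Suc.IH Ck_on_SucD(2) Suc.prems)+
qed

lemma Ck_on_bilinear:
  assumes "open U" "bounded_bilinear pr"
  shows "Ck_on k U F \<Longrightarrow> Ck_on k U G \<Longrightarrow> Ck_on k U (\<lambda>x. pr (F x) (G x))"
proof (induction k arbitrary: F G)
  case 0
  then show ?case using bounded_bilinear.continuous_on[OF assms(2)] by simp
next
  case (Suc k)
  show ?case
    by (rule Ck_on_SucI[OF assms(1) bounded_bilinear.FDERIV[OF assms(2)
        Ck_on_SucD(1)[OF Suc.prems(1)] Ck_on_SucD(1)[OF Suc.prems(2)]]])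
      (assumption | intro Ck_on_add[OF assms(1)] Suc.IH Ck_on_SucD(2)[OF Suc.prems(1)]
        Ck_on_SucD(2)[OF Suc.prems(2)] Ck_on_Suc_imp[OF Suc.prems(1)] Ck_on_Suc_imp[OF Suc.prems(2)])+
qed

lemma Ck_on_inverse:
  fixes F :: "real^2 \<Rightarrow> real"
  assumes "open U"
  shows "Ck_on k U F \<Longrightarrow> (\<And>x. x \<in> U \<Longrightarrow> F x \<noteq> 0) \<Longrightarrow> Ck_on k U (\<lambda>x. inverse (F x))"
proof (induction k arbitrary: F)
  case 0
  then show ?case by (simp add: continuous_on_inverse)
next
  case (Suc k)
  \<comment> \<open>The derivative of the inverse contains the inverse itself, whose lower
    regularity is the induction hypothesis.\<close>
  have i: "Ck_on k U (\<lambda>x. inverse (F x))"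
    using Suc.IH Ck_on_Suc_imp[OF Suc.prems(1)] Suc.prems(2) by simp
  show ?case
    by (rule Ck_on_SucI[OF assms Deriv.has_derivative_inverse[OF Suc.prems(2) Ck_on_SucD(1)[OF Suc.prems(1)]]])
      (assumption | intro Ck_on_bounded_linear[OF assms bounded_linear_minus[OF bounded_linear_ident]]
        Ck_on_bilinear[OF assms bounded_bilinear_mult] i Ck_on_SucD(2)[OF Suc.prems(1)])+
qed

lemma Ck_on_sqrt:
  fixes F :: "real^2 \<Rightarrow> real"
  assumes "open U"
  shows "Ck_on k U F \<Longrightarrow> (\<And>x. x \<in> U \<Longrightarrow> F x > 0) \<Longrightarrow> Ck_on k U (\<lambda>x. sqrt (F x))"
proof (induction k arbitrary: F)
  case 0
  then show ?case by (simp add: continuous_on_real_sqrt)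
next
  case (Suc k)
  have "Ck_on k U (\<lambda>x. sqrt (F x))"
    using Suc.IH Ck_on_Suc_imp[OF Suc.prems(1)] Suc.prems(2) by simp
  then have i: "Ck_on k U (\<lambda>x. inverse (sqrt (F x)))"
    using Suc.prems(2) by (intro Ck_on_inverse[OF assms]) (auto dest: less_imp_neq[symmetric])
  have "((\<lambda>x. sqrt (F x)) has_derivative
      (\<lambda>v. frechet_derivative F (at x) v * (inverse (sqrt (F x)) / 2))) (at x)" if "x \<in> U" for x
    using has_derivative_real_sqrt[OF _ Ck_on_SucD(1)[OF Suc.prems(1) that]] Suc.prems(2)[OF that] by simp
  then show ?case
    by (rule Ck_on_SucI[OF assms])
      (assumption | intro Ck_on_bilinear[OF assms bounded_bilinear_mult]
        Ck_on_bounded_linear[OF assms bounded_linear_divide] i Ck_on_SucD(2)[OF Suc.prems(1)])+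
qed

lemma smooth_on_differentiable: "smooth_on U F \<Longrightarrow> x \<in> U \<Longrightarrow> F differentiable (at x)"
  unfolding smooth_on_def using Ck_on.simps(2)[of 0 U F] by blast

context
  fixes U :: "(real^2) set"
  assumes U: "open U"
begin

lemma smooth_on_cong: "smooth_on U F \<Longrightarrow> (\<And>x. x \<in> U \<Longrightarrow> F x = G x) \<Longrightarrow> smooth_on U G"
  unfolding smooth_on_def using Ck_on_cong[OF U] by blast

lemma smooth_on_bounded_linear: "bounded_linear L \<Longrightarrow> smooth_on U F \<Longrightarrow> smooth_on U (\<lambda>x. L (F x))"
  unfolding smooth_on_def using Ck_on_bounded_linear[OF U] by blast

lemma smooth_on_const: "smooth_on U (\<lambda>_. c)"
  unfolding smooth_on_def using Ck_on_const by blast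

lemma smooth_on_add: "smooth_on U F \<Longrightarrow> smooth_on U G \<Longrightarrow> smooth_on U (\<lambda>x. F x + G x)"
  unfolding smooth_on_def using Ck_on_add[OF U] by blast

lemma smooth_on_minus: "smooth_on U F \<Longrightarrow> smooth_on U (\<lambda>x. - F x)"
  by (rule smooth_on_bounded_linear[OF bounded_linear_minus[OF bounded_linear_ident]])

lemma smooth_on_diff: "smooth_on U F \<Longrightarrow> smooth_on U G \<Longrightarrow> smooth_on U (\<lambda>x. F x - G x)"
  using smooth_on_add[OF _ smooth_on_minus, of F G] by simp

lemma smooth_on_bilinear:
  "bounded_bilinear pr \<Longrightarrow> smooth_on U F \<Longrightarrow> smooth_on U G \<Longrightarrow> smooth_on U (\<lambda>x. pr (F x) (G x))"
  unfolding smooth_on_def using Ck_on_bilinear[OF U] by blast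

lemmas smooth_on_mult = smooth_on_bilinear[OF bounded_bilinear_mult]
lemmas smooth_on_scaleR = smooth_on_bilinear[OF bounded_bilinear_scaleR]
lemmas smooth_on_mat2_mult = smooth_on_bilinear[OF bounded_bilinear_mat2_mult]
lemmas smooth_on_trace = smooth_on_bounded_linear[OF bounded_linear_trace]
lemmas smooth_on_divide = smooth_on_bounded_linear[OF bounded_linear_divide]

lemma smooth_on_inverse:
  fixes F :: "real^2 \<Rightarrow> real"
  shows "smooth_on U F \<Longrightarrow> (\<And>x. x \<in> U \<Longrightarrow> F x \<noteq> 0) \<Longrightarrow> smooth_on U (\<lambda>x. inverse (F x))"
  unfolding smooth_on_def using Ck_on_inverse[OF U] by blast

lemma smooth_on_sqrt:
  fixes F :: "real^2 \<Rightarrow> real"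
  shows "smooth_on U F \<Longrightarrow> (\<And>x. x \<in> U \<Longrightarrow> F x > 0) \<Longrightarrow> smooth_on U (\<lambda>x. sqrt (F x))"
  unfolding smooth_on_def using Ck_on_sqrt[OF U] by blast

lemma smooth_on_mat2_nth:
  fixes F :: "real^2 \<Rightarrow> mat2"
  shows "smooth_on U F \<Longrightarrow> smooth_on U (\<lambda>x. F x $ i $ j)"
  by (rule smooth_on_bounded_linear[OF bounded_linear_compose[OF bounded_linear_vec_nth bounded_linear_vec_nth]])

lemma smooth_on_matrix_inv:
  fixes F :: "real^2 \<Rightarrow> mat2"
  assumes F: "smooth_on U F" and det: "\<And>x. x \<in> U \<Longrightarrow> det (F x) \<noteq> 0"
  shows "smooth_on U (\<lambda>x. matrix_inv (F x))"
proof (rule smooth_on_cong)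
  \<comment> \<open>In dimension two the adjugate is linear in the matrix, so its smoothness is
    immediate.\<close>
  have adj2: "adj2 A = trace A *\<^sub>R mat 1 - A" for A
    by (simp add: mat2_eq_iff adj2_nth trace_mat2 mat_1_mat2)
  have "smooth_on U (\<lambda>x. adj2 (F x))"
    unfolding adj2
    by (rule smooth_on_diff[OF smooth_on_scaleR[OF smooth_on_trace[OF F] smooth_on_const] F])
  moreover have "smooth_on U (\<lambda>x. inverse (det (F x)))"
    using det unfolding det_2
    by (intro smooth_on_inverse smooth_on_diff smooth_on_mult smooth_on_mat2_nth F)
  ultimately show "smooth_on U (\<lambda>x. inverse (det (F x)) *\<^sub>R adj2 (F x))"
    by (intro smooth_on_scaleR)
  fix x assume "x \<in> U"
  then show "inverse (det (F x)) *\<^sub>R adj2 (F x) = matrix_inv (F x)"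
    using matrix_inv_mat2[OF det] by (simp add: divide_inverse)
qed

end

section \<open>Divergence of sums and the flip of the second component\<close>

context area_structure
begin

lemma divergence_uminus:
  "A differentiable (at x) \<Longrightarrow> divergence metric (\<lambda>y. - A y) x X = - divergence metric A x X"
  by (simp add: divergence_metric nabla_endo_uminus differentiable_minus mat2_neg_vmult sum_negf)

context
  fixes A B :: "real^2 \<Rightarrow> mat2"
  assumes A: "A differentiable (at x)" and B: "B differentiable (at x)"
begin

lemma divergence_add:
  "divergence metric (\<lambda>y. A y + B y) x X = divergence metric A x X + divergence metric B x X"
  by (simp add: divergence_metric nabla_endo_add A B differentiable_add
      matrix_vector_mult_add_rdistrib sum.distrib)

lemma divergence_diff:
  "divergence metric (\<lambda>y. A y - B y) x X = divergence metric A x X - divergence metric B x X"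
  by (simp add: divergence_metric nabla_endo_diff A B differentiable_diff
      matrix_vector_mult_diff_rdistrib sum_subtractf)

end

end

text \<open>The metric is parallel, so raising an index commutes with \<open>\<nabla>\<close>. This
  turns the pairings with the derivative of \<open>\<sigma>\<close> into traces against the
  derivative of \<open>H\<close>.\<close>

lemma (in pair_field) sharp_nabla_form:
  "matrix_inv (R x ** J x) ** nabla_form metric s x V = nabla_endo metric H x V"
proof -
  define \<Gamma> where "\<Gamma> = connection metric x V"
  have g: "det (R y ** J y) \<noteq> 0" if "y \<in> U" for y
    using pair_at_facts(1)[OF pair[OF that]] by simp
  have s: "s y = (R y ** J y) ** H y" if "y \<in> U" for y
    using matrix_inv_cancel(1)[OF g[OF that]] by (simp add: H_def matrix_mul_assoc)
  have "frechet_derivative s (at x) V = frechet_derivative (\<lambda>y. (R y ** J y) ** H y) (at x) V"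
    by (subst frechet_derivative_cong[OF U s]) simp_all
  also have "\<dots> = (R x ** J x) ** frechet_derivative H (at x) V +
      (transpose \<Gamma> ** (R x ** J x) + (R x ** J x) ** \<Gamma>) ** H x"
    by (simp only: frechet_derivative_mat2_mult[OF differentiable_metric H_differentiable]
        metric_parallel \<Gamma>_def)
  finally have "nabla_form metric s x V = (R x ** J x) ** nabla_endo metric H x V"
    unfolding nabla_form_def nabla_endo_def \<Gamma>_def[symmetric] s[OF U(2)]
    by (simp add: mat2_linear_simps matrix_mul_assoc)
  then show ?thesis
    using matrix_inv_cancel(2)[OF g[OF U(2)]]
      matrix_mul_assoc[of "matrix_inv (R x ** J x)" "R x ** J x" "nabla_endo metric H x V"] by simp
qed

lemma (in codazzi_pair) flip: "codazzi_pair U R J (\<lambda>y. - s y) x"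
proof -
  interpret flip: pair_field U R J "\<lambda>y. - s y" x
    using U pair_at_uminus[OF pair] fields_differentiable
    by unfold_locales (auto intro: differentiable_minus)
  have H: "flip.H = (\<lambda>y. - H y)"
    by (simp add: fun_eq_iff flip.H_def H_def mat2_linear_simps)
  show ?thesis
    by unfold_locales (simp add: H nabla_endo_uminus H_differentiable mat2_neg_vmult codazzi)
qed

section \<open>Exactness of forms with equivariant primitives\<close>

text \<open>Glues the primitives: the value at a point is read in an arbitrarily chosen chart around
  it, and invariance under transitions makes the choice immaterial.\<close>

lemma exact_form_of_chart_functions:
  fixes w :: "'a chart \<Rightarrow> real^2 \<Rightarrow> real"
  assumes open_coords: "\<And>c. c \<in> \<A> \<Longrightarrow> open (coords c)"
    and smooth: "\<And>c. c \<in> \<A> \<Longrightarrow> smooth_on (coords c) (w c)"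
    and invariant: "\<And>c d x. c \<in> \<A> \<Longrightarrow> d \<in> \<A> \<Longrightarrow> x \<in> overlap c d \<Longrightarrow> w d (transition c d x) = w c x"
    and primitive: "\<And>c x X. c \<in> \<A> \<Longrightarrow> x \<in> coords c \<Longrightarrow> \<alpha> c x X = frechet_derivative (w c) (at x) X"
  shows "exact_form \<A> \<alpha>"
proof -
  define ch where "ch p = (SOME d. d \<in> \<A> \<and> p \<in> fst d)" for p :: 'a
  define u where "u p = w (ch p) (snd (ch p) p)" for p
  have u: "(u \<circ> chart_inv c) x = w c x" if c: "c \<in> \<A>" and x: "x \<in> coords c" for c x
  proof -
    define p where "p = chart_inv c x"
    have p: "p \<in> fst c" "snd c p = x"
      using x by (auto simp: p_def chart_inv_def coords_def inv_into_into f_inv_into_f)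
    have d: "ch p \<in> \<A>" "p \<in> fst (ch p)"
      using someI[of "\<lambda>d. d \<in> \<A> \<and> p \<in> fst d" c] c p(1) by (auto simp: ch_def)
    have "x \<in> overlap c (ch p)" using p d by (auto simp: overlap_def)
    then show ?thesis
      using invariant[OF c d(1)] by (simp add: u_def transition_def p_def)
  qed
  have "smooth_function \<A> u"
    unfolding smooth_function_def
    using smooth_on_cong[OF open_coords smooth] u by metis
  moreover have "frechet_derivative (u \<circ> chart_inv c) (at x) = frechet_derivative (w c) (at x)"
    if "c \<in> \<A>" "x \<in> coords c" for c x
    using frechet_derivative_cong[OF open_coords[OF that(1)] that(2) u[OF that(1)]] .
  ultimately show ?thesis
    unfolding exact_form_def eq_forms_def using primitive by auto
qed

section \<open>Matrices under a change of chart\<close>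

lemma trace_equivariant:
  assumes "(A::mat2) ** \<Phi> = \<Phi> ** A'" "det \<Phi> \<noteq> 0"
  shows "trace A = trace A'"
proof -
  have "trace A = trace (\<Phi> ** A' ** matrix_inv \<Phi>)"
    by (simp add: assms(1)[symmetric] matrix_mul_assoc[symmetric] matrix_inv_cancel(1)[OF assms(2)])
  also have "\<dots> = trace A'"
    using trace_mult_commute[of "\<Phi> ** A'" "matrix_inv \<Phi>"]
    by (simp add: matrix_mul_assoc matrix_inv_cancel(2)[OF assms(2)])
  finally show ?thesis .
qed

lemma mult_equivariant:
  fixes A A' B B' \<Phi> :: mat2
  assumes "A ** \<Phi> = \<Phi> ** A'" "B ** \<Phi> = \<Phi> ** B'"
  shows "(A ** B) ** \<Phi> = \<Phi> ** (A' ** B')"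
proof -
  have "(A ** B) ** \<Phi> = (A ** \<Phi>) ** B'"
    by (simp only: matrix_mul_assoc[symmetric] assms(2))
  also have "\<dots> = \<Phi> ** (A' ** B')"
    by (simp only: assms(1) matrix_mul_assoc)
  finally show ?thesis .
qed

lemma sharp_equivariant:
  fixes G G' s s' \<Phi> :: mat2
  assumes "G' = transpose \<Phi> ** G ** \<Phi>" "s' = transpose \<Phi> ** s ** \<Phi>" "det \<Phi> \<noteq> 0" "det G \<noteq> 0"
  shows "(matrix_inv G ** s) ** \<Phi> = \<Phi> ** (matrix_inv G' ** s')"
proof (rule mat2_left_cancel[OF _ assms(4)], rule mat2_left_cancel)
  show "det (transpose \<Phi>) \<noteq> 0" using assms(3) by (simp add: det_transpose)
  have "det G' \<noteq> 0" using assms(3,4) by (simp add: assms(1) det_mul det_transpose)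
  then have "G' ** (matrix_inv G' ** s') = s'"
    by (simp add: matrix_mul_assoc matrix_inv_cancel(1))
  moreover have "G ** (matrix_inv G ** s ** \<Phi>) = s ** \<Phi>"
    by (simp add: matrix_mul_assoc matrix_inv_cancel(1)[OF assms(4)])
  ultimately show "transpose \<Phi> ** (G ** (matrix_inv G ** s ** \<Phi>)) =
      transpose \<Phi> ** (G ** (\<Phi> ** (matrix_inv G' ** s')))"
    by (simp add: assms(1,2) matrix_mul_assoc)
qed

section \<open>The fields of a tangent vector\<close>

lemma smooth_onD_endo: "endo_field \<A> A \<Longrightarrow> c \<in> \<A> \<Longrightarrow> smooth_on (coords c) (A c)"
  and smooth_onD_form: "form_field \<A> s \<Longrightarrow> c \<in> \<A> \<Longrightarrow> smooth_on (coords c) (s c)"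
  by (simp_all add: endo_field_def form_field_def)

locale tangent_pair =
  fixes \<Sigma> :: "'a topology" and \<A> :: "'a chart set" and \<rho> J \<sigma> J' \<sigma>' :: "'a tensor"
  assumes surface: "closed_oriented_surface \<Sigma> \<A>"
    and area: "area_form \<A> \<rho>"
    and MS: "(J, \<sigma>) \<in> MS0 \<A> \<rho>"
    and tangent: "(J', \<sigma>') \<in> tangent_TstarJ \<A> \<rho> (J, \<sigma>)"
begin

abbreviation "g \<equiv> metric_of \<rho> J"
abbreviation "f \<equiv> f_fun g \<sigma>"
abbreviation "H \<equiv> sharp g \<sigma>"
abbreviation "\<sigma>0' \<equiv> traceless_field g \<sigma>'"
abbreviation "P \<equiv> (\<lambda>c x. inverse (f c x) *\<^sub>R sharp g \<sigma>0' c x)"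

lemma open_coords: "c \<in> \<A> \<Longrightarrow> open (coords c)"
  using surface by (simp add: closed_oriented_surface_def)

lemma TstarJ: "(J, \<sigma>) \<in> TstarJ \<A> \<rho>"
  using MS by (simp add: MS0_def)

lemma fields: "endo_field \<A> J" "form_field \<A> \<sigma>" "form_field \<A> \<rho>" "endo_field \<A> J'" "form_field \<A> \<sigma>'"
  using TstarJ area tangent by (simp_all add: TstarJ_def area_form_def tangent_TstarJ_def)

lemma pair: "c \<in> \<A> \<Longrightarrow> x \<in> coords c \<Longrightarrow> pair_at (\<rho> c x) (J c x) (\<sigma> c x)"
  by (rule TstarJ_pair_at[OF area TstarJ])

lemma smooth:
  assumes "c \<in> \<A>"
  shows "smooth_on (coords c) (\<rho> c)" "smooth_on (coords c) (J c)" "smooth_on (coords c) (\<sigma> c)"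
    "smooth_on (coords c) (J' c)" "smooth_on (coords c) (\<sigma>' c)"
  using fields assms smooth_onD_endo smooth_onD_form by blast+

lemma tangent_at:
  assumes "c \<in> \<A>" "x \<in> coords c"
  shows "J' c x ** J c x + J c x ** J' c x = 0"
    and "transpose (\<sigma>0' c x) = \<sigma>0' c x" "trace (matrix_inv (\<rho> c x ** J c x) ** \<sigma>0' c x) = 0"
    and "\<sigma>' c x = \<sigma>0' c x - pair_endo (\<rho> c x ** J c x) (\<sigma> c x) (J c x ** J' c x) *\<^sub>R (\<rho> c x ** J c x)"
proof -
  let ?G = "\<rho> c x ** J c x" and ?p = "pair_endo (\<rho> c x ** J c x) (\<sigma> c x) (J c x ** J' c x)"
  obtain s where s: "symmetric_form s" "trace (matrix_inv ?G ** s) = 0" "\<sigma>' c x = s - ?p *\<^sub>R ?G"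
    and J': "J' c x ** J c x + J c x ** J' c x = 0"
    using tangent assms by (auto simp: tangent_TstarJ_def Let_def metric_of_def)
  have "det ?G \<noteq> 0" using pair_at_facts(1)[OF pair[OF assms]] by simp
  \<comment> \<open>Taking the trace recovers the coefficient of the metric, so the witness in the
    definition of tangent vectors has to be the traceless part.\<close>
  then have "trace (matrix_inv ?G ** \<sigma>' c x) = - 2 * ?p"
    using s(2) by (simp add: s(3) mat2_linear_simps trace_mat2_simps matrix_inv_cancel(2))
  then have e: "\<sigma>0' c x = s"
    by (simp add: traceless_field_def traceless_part_def metric_of_def s(3))
  show "J' c x ** J c x + J c x ** J' c x = 0" by fact
  show "transpose (\<sigma>0' c x) = \<sigma>0' c x" "trace (matrix_inv ?G ** \<sigma>0' c x) = 0"
    "\<sigma>' c x = \<sigma>0' c x - ?p *\<^sub>R ?G"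
    using s by (simp_all add: e symmetric_form_def)
qed

lemma pair_field:
  assumes "c \<in> \<A>" "x \<in> coords c"
  shows "pair_field (coords c) (\<rho> c) (J c) (\<sigma> c) x"
  using open_coords[OF assms(1)] assms pair smooth_on_differentiable[OF smooth(1)]
    smooth_on_differentiable[OF smooth(2)] smooth_on_differentiable[OF smooth(3)]
  by unfold_locales auto

text \<open>With \<open>k = 1 + f\<close> the metric \<open>h\<close> is \<open>k\<close> times
  \<open>g\<close> and the shape operator is \<open>H / k\<close>, which is the situation of
  \<open>codazzi_conformal\<close>.\<close>

lemma codazzi_pair:
  assumes c: "c \<in> \<A>" and x: "x \<in> coords c"
  shows "codazzi_pair (coords c) (\<rho> c) (J c) (\<sigma> c) x"
proof -
  interpret F: pair_field "coords c" "\<rho> c" "J c" "\<sigma> c" x using pair_field[OF c x] .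
  define k where "k y = 1 + F.f y" for y
  have k: "k differentiable (at x)"
    unfolding k_def[abs_def] by (intro differentiable_add differentiable_const F.f_differentiable)
  have k_pos: "k y > 0" if "y \<in> coords c" for y
    using F.f_pos[OF that] by (simp add: k_def)
  have h: "h_metric \<rho> J \<sigma> c = (\<lambda>y. k y *\<^sub>R (\<rho> c y ** J c y))"
    by (simp add: fun_eq_iff h_metric_def k_def F.f_def f_fun_def metric_of_def)
  have "shape_op \<rho> J \<sigma> c y = inverse (k y) *\<^sub>R F.H y" if "y \<in> coords c" for y
    using shape_at_eq[OF pair[OF c that]]
    by (simp add: shape_op_eq_shape_at k_def F.f_def F.H_def divide_inverse)
  then have B: "nabla_endo G (shape_op \<rho> J \<sigma> c) x = nabla_endo G (\<lambda>y. inverse (k y) *\<^sub>R F.H y) x" for G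
    by (rule nabla_endo_cong[OF F.U])
  have cod: "nabla_endo (h_metric \<rho> J \<sigma> c) (shape_op \<rho> J \<sigma> c) x X *v Y =
      nabla_endo (h_metric \<rho> J \<sigma> c) (shape_op \<rho> J \<sigma> c) x Y *v X" for X Y
    using MS c x by (simp add: MS0_def Let_def)
  show ?thesis
    by unfold_locales
      (rule codazzi_conformal[OF F.area_structure_axioms k k_pos F.H_differentiable
          F.H_anticommute[OF x] cod[unfolded h B]])
qed

lemma f_square:
  assumes "c \<in> \<A>" "x \<in> coords c"
  shows "f c x = sqrt (1 + trace (H c x ** H c x) / 2)" "1 + trace (H c x ** H c x) / 2 > 0" "f c x > 0"
proof -
  show f: "f c x = sqrt (1 + trace (H c x ** H c x) / 2)"
    by (simp add: f_fun_def inner_form_def sharp_def)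
  show pos: "1 + trace (H c x ** H c x) / 2 > 0"
    using pair_at_facts(2)[OF pair[OF assms]] by (simp add: sharp_def inner_form_def metric_of_def)
  show "f c x > 0" using pos by (simp add: f)
qed

lemma smooth_fields:
  assumes c: "c \<in> \<A>"
  shows "smooth_on (coords c) (H c)" "smooth_on (coords c) (f c)" "smooth_on (coords c) (P c)"
proof -
  note op = open_coords[OF c]
  have det: "det (\<rho> c x ** J c x) \<noteq> 0" if "x \<in> coords c" for x
    using pair_at_facts(1)[OF pair[OF c that]] by simp
  have inv: "smooth_on (coords c) (\<lambda>x. matrix_inv (\<rho> c x ** J c x))"
    using det by (intro smooth_on_matrix_inv[OF op] smooth_on_mat2_mult[OF op] smooth[OF c])
  show H: "smooth_on (coords c) (H c)"
    unfolding sharp_def metric_of_def by (intro smooth_on_mat2_mult[OF op] inv smooth[OF c])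
  have "smooth_on (coords c) (\<lambda>x. sqrt (1 + trace (H c x ** H c x) / 2))"
    using f_square(2)[OF c]
    by (intro smooth_on_sqrt[OF op] smooth_on_add[OF op] smooth_on_const[OF op] smooth_on_divide[OF op]
        smooth_on_trace[OF op] smooth_on_mat2_mult[OF op] H)
  then show f: "smooth_on (coords c) (f c)"
    by (rule smooth_on_cong[OF op]) (simp add: f_square(1)[OF c])
  have "smooth_on (coords c) (\<lambda>x. inverse (f c x))"
    using f_square(3)[OF c] by (intro smooth_on_inverse[OF op] f) (metis less_irrefl)
  then show "smooth_on (coords c) (P c)"
    unfolding sharp_def metric_of_def traceless_field_def traceless_part_def
    by (intro smooth_on_scaleR[OF op] smooth_on_mat2_mult[OF op] smooth_on_diff[OF op]
        smooth_on_divide[OF op] smooth_on_trace[OF op] inv smooth[OF c])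
qed

lemma anticommute:
  assumes c: "c \<in> \<A>" and x: "x \<in> coords c"
  shows "J' c x ** J c x = - (J c x ** J' c x)" "P c x ** J c x = - (J c x ** P c x)"
proof -
  show "J' c x ** J c x = - (J c x ** J' c x)"
    using tangent_at(1)[OF c x] by (simp add: eq_neg_iff_add_eq_0)
  show "P c x ** J c x = - (J c x ** P c x)"
    using sharp_anticommute[of "\<rho> c x" "J c x" "\<sigma>0' c x"] tangent_at(2,3)[OF c x] pair[OF c x]
    by (simp add: sharp_def metric_of_def mat2_linear_simps pair_at_def)
qed

text \<open>Makes the primitive \<open><\<sigma> | Q J>\<close> a function on the surface. The
  scalar \<open>r\<close> is 1 for the plus field and -1 for the minus field.\<close>

lemma trace_invariant:
  assumes c: "c \<in> \<A>" and d: "d \<in> \<A>" and x: "x \<in> overlap c d"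
  defines "y \<equiv> transition c d x"
  shows "trace (H d y ** (P d y + r *\<^sub>R J' d y) ** J d y) = trace (H c x ** (P c x + r *\<^sub>R J' c x) ** J c x)"
proof -
  define \<Phi> where "\<Phi> = jacobian (transition c d) (at x)"
  have x': "x \<in> coords c" using x by (auto simp: overlap_def coords_def)
  have y: "y \<in> coords d"
  proof -
    obtain p where p: "p \<in> fst c" "p \<in> fst d" "x = snd c p" using x by (auto simp: overlap_def)
    have "inj_on (snd c) (fst c)"
    proof -
      have "openin \<Sigma> (fst c)" "homeomorphic_map (subtopology \<Sigma> (fst c)) (top_of_set (coords c)) (snd c)"
        using surface c by (simp_all add: closed_oriented_surface_def)
      then show ?thesis
        using homeomorphic_imp_injective_map openin_subset by (metis topspace_subtopology_subset)
    qed
    then have "chart_inv c x = p" using p by (simp add: chart_inv_def inv_into_f_f)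
    then show ?thesis using p by (auto simp: y_def transition_def coords_def)
  qed
  have \<Phi>: "det \<Phi> \<noteq> 0"
  proof -
    have "\<forall>x\<in>overlap c d. det (jacobian (transition c d) (at x)) > 0"
      using surface c d by (simp add: closed_oriented_surface_def)
    then show ?thesis using x by (auto simp: \<Phi>_def)
  qed
  have e: "J d y ** \<Phi> = \<Phi> ** J c x" "J' d y ** \<Phi> = \<Phi> ** J' c x"
    using fields(1,4) c d x by (simp_all add: endo_field_def \<Phi>_def y_def)
  have F: "\<rho> c x = transpose \<Phi> ** \<rho> d y ** \<Phi>" "\<sigma> c x = transpose \<Phi> ** \<sigma> d y ** \<Phi>"
    "\<sigma>' c x = transpose \<Phi> ** \<sigma>' d y ** \<Phi>"
    using fields(2,3,5) c d x unfolding form_field_def \<Phi>_def y_def by blast+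
  have G: "\<rho> c x ** J c x = transpose \<Phi> ** (\<rho> d y ** J d y) ** \<Phi>"
    unfolding F(1) by (simp add: matrix_mul_assoc[symmetric] e(1))
  have det: "det (\<rho> d y ** J d y) \<noteq> 0" "det (\<rho> c x ** J c x) \<noteq> 0"
    using pair_at_facts(1)[OF pair[OF d y]] pair_at_facts(1)[OF pair[OF c x']] by simp_all
  have H: "H d y ** \<Phi> = \<Phi> ** H c x" and S: "sharp g \<sigma>' d y ** \<Phi> = \<Phi> ** sharp g \<sigma>' c x"
    unfolding sharp_def metric_of_def by (rule sharp_equivariant[OF G _ \<Phi> det(1)], rule F)+
  have f: "f d y = f c x"
    unfolding f_square(1)[OF d y] f_square(1)[OF c x'] trace_equivariant[OF mult_equivariant[OF H H] \<Phi>] ..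
  \<comment> \<open>Expresses the endomorphism of the traceless part through
    \<open>\<sigma>'\<close>, whose transformation law is known.\<close>
  have sharp0: "sharp g \<sigma>0' e z = sharp g \<sigma>' e z - (trace (sharp g \<sigma>' e z) / 2) *\<^sub>R mat 1"
    if "det (\<rho> e z ** J e z) \<noteq> 0" for e z
    using matrix_inv_cancel(2)[OF that]
    by (simp add: sharp_def metric_of_def traceless_field_def traceless_part_def mat2_linear_simps)
  have "P d y ** \<Phi> = \<Phi> ** P c x"
    by (simp only: f sharp0[OF det(1)] sharp0[OF det(2)] mat2_linear_simps S trace_equivariant[OF S \<Phi>]
        matrix_mul_lid matrix_mul_rid)
  then have "(P d y + r *\<^sub>R J' d y) ** \<Phi> = \<Phi> ** (P c x + r *\<^sub>R J' c x)"
    by (simp only: mat2_linear_simps e)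
  then show ?thesis
    by (intro trace_equivariant[OF mult_equivariant[OF mult_equivariant[OF H] e(1)] \<Phi>])
qed

section \<open>The equations at a point of a chart\<close>

context
  fixes c :: "'a chart" and x :: "real^2"
  assumes c: "c \<in> \<A>" and x: "x \<in> coords c"
begin

interpretation F: codazzi_pair "coords c" "\<rho> c" "J c" "\<sigma> c" x
  by (rule codazzi_pair[OF c x])

interpretation F': codazzi_pair "coords c" "\<rho> c" "J c" "\<lambda>y. - \<sigma> c y" x
  by (rule F.flip)

lemma metric_eq: "g c = F.metric"
  by (simp add: metric_of_def)

lemma F_eq: "F.H = H c" "F'.H = (\<lambda>y. - H c y)" "F.f = f c" "F'.f = f c"
  by (simp_all add: fun_eq_iff F.H_def F'.H_def F.f_def F'.f_def sharp_def metric_of_def f_fun_def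
      inner_form_def mat2_linear_simps)

lemma T_eq: "F'.T V = - F.T V"
  unfolding F.T_def F'.T_def F_eq
  using nabla_endo_uminus[OF F.H_differentiable] by (simp add: F_eq)

lemma nablaJ_endo_eq: "nablaJ_endo g J \<sigma> A c x X = trace (F.T (J c x *v X) ** A c x) / 2"
  unfolding nablaJ_endo_def pair_endo_def metric_eq F.sharp_nabla_form F.T_def ..

lemma nablaJ_form_eq: "nablaJ_form g J \<sigma> \<sigma>0' c x X = f c x * (trace (F.T (J c x *v X) ** P c x) / 2)"
proof -
  have "sharp g \<sigma>0' c x = f c x *\<^sub>R P c x" using f_square(3)[OF c x] by simp
  then have "matrix_inv (\<rho> c x ** J c x) ** \<sigma>0' c x = f c x *\<^sub>R P c x"
    by (simp add: sharp_def metric_of_def)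
  then show ?thesis
    unfolding nablaJ_form_def inner_form_def metric_eq F.sharp_nabla_form F.T_def[symmetric]
    by (simp add: mat2_linear_simps trace_mat2_simps)
qed

lemma P_differentiable: "P c differentiable (at x)" and J'_differentiable: "J' c differentiable (at x)"
  using smooth_on_differentiable[OF smooth_fields(3)[OF c] x]
    smooth_on_differentiable[OF smooth(4)[OF c] x] by simp_all

lemma Q_anticommute:
  assumes "y \<in> coords c"
  shows "(P c y + J' c y) ** J c y = - (J c y ** (P c y + J' c y))"
    and "(P c y - J' c y) ** J c y = - (J c y ** (P c y - J' c y))"
  using anticommute[OF c assms] by (simp_all add: mat2_linear_simps)

lemma mess_eq:
  assumes "y \<in> coords c"
  shows "mess_l \<rho> J \<sigma> c y = F.Jl y" "mess_r \<rho> J \<sigma> c y = F'.Jl y"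
  using mess_at_eq[OF pair[OF c assms]]
  by (simp_all add: mess_l_def mess_r_def F.Jl_def F'.Jl_def F_eq)
    (simp_all add: sharp_def metric_of_def f_fun_def)

lemma i_iff_iii_at:
  "div_field g P c x X = - (inverse (f c x) * nablaJ_endo g J \<sigma> J' c x X) \<and>
   div_field g J' c x X = - (inverse ((f c x)\<^sup>2) * nablaJ_form g J \<sigma> \<sigma>0' c x X) \<longleftrightarrow>
   div_field g (\<lambda>c x. P c x + J' c x) c x X =
     - (inverse (f c x) * nablaJ_endo g J \<sigma> (\<lambda>c x. P c x + J' c x) c x X) \<and>
   div_field g (\<lambda>c x. P c x - J' c x) c x X =
     inverse (f c x) * nablaJ_endo g J \<sigma> (\<lambda>c x. P c x - J' c x) c x X"
proof -
  define dP dJ nP nJ where *: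
    "dP = divergence F.metric (P c) x X" "dJ = divergence F.metric (J' c) x X"
    "nP = trace (F.T (J c x *v X) ** P c x) / 2" "nJ = trace (F.T (J c x *v X) ** J' c x) / 2"
  \<comment> \<open>Pairing with \<open>\<sigma>0'\<close> instead of \<open>P\<close> costs a
    factor \<open>f\<close>, so the coefficient of the second equation in i) drops to the same
    \<open>1 / f\<close> as in the first and the two can be added and subtracted.\<close>
  have n: "inverse ((f c x)\<^sup>2) * (f c x * nP) = inverse (f c x) * nP"
    using f_square(3)[OF c x] by (simp add: power2_eq_square)
  have "dP = - (i * nJ) \<and> dJ = - (i * nP) \<longleftrightarrow>
      dP + dJ = - (i * (nP + nJ)) \<and> dP - dJ = i * (nP - nJ)" for i
    unfolding distrib_left right_diff_distrib by linarith
  then show ?thesis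
    unfolding div_field_def metric_eq nablaJ_form_eq nablaJ_endo_eq
      F.divergence_add[OF P_differentiable J'_differentiable]
      F.divergence_diff[OF P_differentiable J'_differentiable]
      mat2_linear_simps(4,6) trace_mat2_simps(1,2) add_divide_distrib diff_divide_distrib
      *[symmetric] n .
qed

text \<open>Passing to \<open>- \<sigma>\<close> changes the sign of \<open>T\<close>, which
  accounts for the opposite signs in the equations for the minus field.\<close>

lemma ii_iff_iii_at:
  "(\<forall>X. div_field g (\<lambda>c x. (P c x + J' c x) ** J c x ** mess_l \<rho> J \<sigma> c x) c x X =
      - nablaJ_endo g J \<sigma> (\<lambda>c x. P c x + J' c x) c x X) \<longleftrightarrow>
   (\<forall>X. div_field g (\<lambda>c x. P c x + J' c x) c x X =
      - (inverse (f c x) * nablaJ_endo g J \<sigma> (\<lambda>c x. P c x + J' c x) c x X))"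
  "(\<forall>X. div_field g (\<lambda>c x. (P c x - J' c x) ** J c x ** mess_r \<rho> J \<sigma> c x) c x X =
      nablaJ_endo g J \<sigma> (\<lambda>c x. P c x - J' c x) c x X) \<longleftrightarrow>
   (\<forall>X. div_field g (\<lambda>c x. P c x - J' c x) c x X =
      inverse (f c x) * nablaJ_endo g J \<sigma> (\<lambda>c x. P c x - J' c x) c x X)"
proof -
  have l: "div_field g (\<lambda>c x. (P c x + J' c x) ** J c x ** mess_l \<rho> J \<sigma> c x) c x X =
      divergence F.metric (\<lambda>y. (P c y + J' c y) ** J c y ** F.Jl y) x X" for X
    unfolding div_field_def metric_eq by (rule divergence_cong[OF F.U]) (simp_all add: mess_eq)
  have r: "div_field g (\<lambda>c x. (P c x - J' c x) ** J c x ** mess_r \<rho> J \<sigma> c x) c x X =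
      divergence F.metric (\<lambda>y. (P c y - J' c y) ** J c y ** F'.Jl y) x X" for X
    unfolding div_field_def metric_eq by (rule divergence_cong[OF F.U]) (simp_all add: mess_eq)
  show "(\<forall>X. div_field g (\<lambda>c x. (P c x + J' c x) ** J c x ** mess_l \<rho> J \<sigma> c x) c x X =
      - nablaJ_endo g J \<sigma> (\<lambda>c x. P c x + J' c x) c x X) \<longleftrightarrow>
   (\<forall>X. div_field g (\<lambda>c x. P c x + J' c x) c x X =
      - (inverse (f c x) * nablaJ_endo g J \<sigma> (\<lambda>c x. P c x + J' c x) c x X))"
    using F.defect_vanishes_iff[of "\<lambda>y. P c y + J' c y", OF differentiable_add[OF P_differentiable J'_differentiable]
        Q_anticommute(1)]
    unfolding l unfolding div_field_def metric_eq nablaJ_endo_eq F_eq by blast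
  show "(\<forall>X. div_field g (\<lambda>c x. (P c x - J' c x) ** J c x ** mess_r \<rho> J \<sigma> c x) c x X =
      nablaJ_endo g J \<sigma> (\<lambda>c x. P c x - J' c x) c x X) \<longleftrightarrow>
   (\<forall>X. div_field g (\<lambda>c x. P c x - J' c x) c x X =
      inverse (f c x) * nablaJ_endo g J \<sigma> (\<lambda>c x. P c x - J' c x) c x X)"
    using F'.defect_vanishes_iff[of "\<lambda>y. P c y - J' c y", OF differentiable_diff[OF P_differentiable J'_differentiable]
        Q_anticommute(2)]
    unfolding r unfolding div_field_def metric_eq nablaJ_endo_eq F_eq T_eq
    by (simp add: mat2_linear_simps(7) trace_mat2_simps(3))
qed

lemma mess_l_variation_divergence:
  assumes "\<And>X. div_field g (\<lambda>c x. (P c x + J' c x) ** J c x ** mess_l \<rho> J \<sigma> c x) c x X =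
      - nablaJ_endo g J \<sigma> (\<lambda>c x. P c x + J' c x) c x X"
  shows "div_field (metric_of \<rho> (mess_l \<rho> J \<sigma>)) (mess_l_variation \<rho> J \<sigma> J' \<sigma>') c x X =
    frechet_derivative (\<lambda>y. trace (H c y ** (P c y + J' c y) ** J c y) / 2) (at x) X"
proof -
  have "divergence F.metric (\<lambda>y. (P c y + J' c y) ** J c y ** F.Jl y) x X =
      - (trace (F.T (J c x *v X) ** (P c x + J' c x)) / 2)" for X
    using assms[of X] unfolding div_field_def metric_eq nablaJ_endo_eq
    by (subst divergence_cong[OF F.U, of _ F.metric _ "\<lambda>y. (P c y + J' c y) ** J c y ** mess_l \<rho> J \<sigma> c y"])
      (simp_all add: mess_eq)
  note div = F.divergence_mess_tangent[of "\<lambda>y. P c y + J' c y",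
      OF differentiable_add[OF P_differentiable J'_differentiable] Q_anticommute(1) this]
  have "mess_l_variation \<rho> J \<sigma> J' \<sigma>' c y =
      (trace (F.H y ** (P c y + J' c y)) / 2) *\<^sub>R J c y + F.f y *\<^sub>R (P c y + J' c y)"
    if "y \<in> coords c" for y
    using mess_l_derivative[OF pair[OF c that] tangent_at(1,4,2,3)[OF c that]]
    by (simp add: mess_l_variation_def F_eq) (simp add: sharp_def metric_of_def f_fun_def)
  then have "div_field (metric_of \<rho> (mess_l \<rho> J \<sigma>)) (mess_l_variation \<rho> J \<sigma> J' \<sigma>') c x X =
      divergence (\<lambda>y. \<rho> c y ** F.Jl y)
        (\<lambda>y. (trace (F.H y ** (P c y + J' c y)) / 2) *\<^sub>R J c y + F.f y *\<^sub>R (P c y + J' c y)) x X"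
    unfolding div_field_def metric_of_def by (intro divergence_cong[OF F.U]) (simp_all add: mess_eq)
  then show ?thesis using div by (simp only: F_eq)
qed

text \<open>Two signs cancel: the variation is minus the tangent field of the flipped pair, and the
  primitive belonging to that field contains \<open>- H\<close>.\<close>

lemma mess_r_variation_divergence:
  assumes "\<And>X. div_field g (\<lambda>c x. (P c x - J' c x) ** J c x ** mess_r \<rho> J \<sigma> c x) c x X =
      nablaJ_endo g J \<sigma> (\<lambda>c x. P c x - J' c x) c x X"
  shows "div_field (metric_of \<rho> (mess_r \<rho> J \<sigma>)) (mess_r_variation \<rho> J \<sigma> J' \<sigma>') c x X =
    frechet_derivative (\<lambda>y. trace (H c y ** (P c y - J' c y) ** J c y) / 2) (at x) X"
proof -
  let ?A = "\<lambda>y. (trace (F'.H y ** (P c y - J' c y)) / 2) *\<^sub>R J c y + F'.f y *\<^sub>R (P c y - J' c y)"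
  have Q: "(\<lambda>y. P c y - J' c y) differentiable (at x)"
    by (rule differentiable_diff[OF P_differentiable J'_differentiable])
  have "divergence F.metric (\<lambda>y. (P c y - J' c y) ** J c y ** F'.Jl y) x X =
      - (trace (F'.T (J c x *v X) ** (P c x - J' c x)) / 2)" for X
    using assms[of X] unfolding div_field_def metric_eq nablaJ_endo_eq T_eq
    by (subst divergence_cong[OF F.U, of _ F.metric _ "\<lambda>y. (P c y - J' c y) ** J c y ** mess_r \<rho> J \<sigma> c y"])
      (simp_all add: mess_eq mat2_linear_simps(7) trace_mat2_simps(3))
  note div = F'.divergence_mess_tangent[of "\<lambda>y. P c y - J' c y", OF Q Q_anticommute(2) this]
  interpret r: area_structure "coords c" "\<rho> c" F'.Jl x by (rule F'.Jl_area_structure)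
  have A: "?A differentiable (at x)"
    unfolding divide_inverse
    by (intro differentiable_add differentiable_scaleR differentiable_mult differentiable_const
        trace_differentiable differentiable_mat2_mult F'.H_differentiable F'.f_differentiable Q
        F.differentiable)
  have "mess_r_variation \<rho> J \<sigma> J' \<sigma>' c y = - ?A y" if "y \<in> coords c" for y
    using mess_r_derivative[OF pair[OF c that] tangent_at(1,4,2,3)[OF c that]]
    by (simp add: mess_r_variation_def F_eq) (simp add: sharp_def metric_of_def f_fun_def)
  then have "div_field (metric_of \<rho> (mess_r \<rho> J \<sigma>)) (mess_r_variation \<rho> J \<sigma> J' \<sigma>') c x X =
      divergence r.metric (\<lambda>y. - ?A y) x X"
    unfolding div_field_def metric_of_def by (intro divergence_cong[OF F.U]) (simp_all add: mess_eq)
  also have "\<dots> = - frechet_derivative (\<lambda>y. trace (F'.H y ** (P c y - J' c y) ** J c y) / 2) (at x) X"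
    unfolding r.divergence_uminus[OF A] by (simp only: div)
  also have "\<dots> = frechet_derivative (\<lambda>y. - (trace (F'.H y ** (P c y - J' c y) ** J c y) / 2)) (at x) X"
    unfolding divide_inverse
    by (subst frechet_derivative_bounded_linear[OF bounded_linear_minus[OF bounded_linear_ident]])
      (intro refl differentiable_mult differentiable_const trace_differentiable differentiable_mat2_mult
        F'.H_differentiable Q F.differentiable)+
  also have "(\<lambda>y. - (trace (F'.H y ** (P c y - J' c y) ** J c y) / 2)) =
      (\<lambda>y. trace (H c y ** (P c y - J' c y) ** J c y) / 2)"
    by (simp add: F_eq mat2_linear_simps(7) trace_mat2_simps(3))
  finally show ?thesis .
qed

end

end

theorem propositionK:
  fixes \<Sigma> :: "'a topology" and \<A> :: "'a chart set"
    and \<rho> J \<sigma> J' \<sigma>' :: "'a tensor"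
  assumes "closed_oriented_surface \<Sigma> \<A>"
    and "genus \<Sigma> \<ge> 2"
    and "area_form \<A> \<rho>"
    and "has_total_area \<Sigma> \<A> \<rho> (- pi * real_of_int (euler_char \<Sigma>))"
    and "(J, \<sigma>) \<in> MS0 \<A> \<rho>"
    and "(J', \<sigma>') \<in> tangent_TstarJ \<A> \<rho> (J, \<sigma>)"
  shows
    "let g = metric_of \<rho> J;
         f = f_fun g \<sigma>;
         \<sigma>0' = traceless_field g \<sigma>';
         P = (\<lambda>c x. inverse (f c x) *\<^sub>R sharp g \<sigma>0' c x);
         Qp = (\<lambda>c x. P c x + J' c x);
         Qm = (\<lambda>c x. P c x - J' c x);
         Jl = mess_l \<rho> J \<sigma>;
         Jr = mess_r \<rho> J \<sigma>;
         cond_i =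
           (eq_forms \<A> (div_field g P)
              (\<lambda>c x X. - (inverse (f c x) * nablaJ_endo g J \<sigma> J' c x X)) \<and>
            eq_forms \<A> (div_field g J')
              (\<lambda>c x X. - (inverse ((f c x)\<^sup>2) * nablaJ_form g J \<sigma> \<sigma>0' c x X)));
         cond_ii =
           (eq_forms \<A> (div_field g (\<lambda>c x. Qp c x ** J c x ** Jl c x))
              (\<lambda>c x X. - nablaJ_endo g J \<sigma> Qp c x X) \<and>
            eq_forms \<A> (div_field g (\<lambda>c x. Qm c x ** J c x ** Jr c x))
              (nablaJ_endo g J \<sigma> Qm));
         cond_iii =
           (eq_forms \<A> (div_field g Qp)
              (\<lambda>c x X. - (inverse (f c x) * nablaJ_endo g J \<sigma> Qp c x X)) \<and>
            eq_forms \<A> (div_field g Qm)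
              (\<lambda>c x X. inverse (f c x) * nablaJ_endo g J \<sigma> Qm c x X))
     in (cond_i \<longleftrightarrow> cond_ii) \<and> (cond_ii \<longleftrightarrow> cond_iii) \<and>
        (cond_i \<longrightarrow>
           exact_form \<A> (div_field (metric_of \<rho> Jl) (mess_l_variation \<rho> J \<sigma> J' \<sigma>')) \<and>
           exact_form \<A> (div_field (metric_of \<rho> Jr) (mess_r_variation \<rho> J \<sigma> J' \<sigma>')))"
proof -
  interpret tangent_pair \<Sigma> \<A> \<rho> J \<sigma> J' \<sigma>'
    using assms by unfold_locales
  let ?Qp = "\<lambda>c x. P c x + J' c x" and ?Qm = "\<lambda>c x. P c x - J' c x"
  let ?Jl = "mess_l \<rho> J \<sigma>" and ?Jr = "mess_r \<rho> J \<sigma>"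
  let ?i = "eq_forms \<A> (div_field g P) (\<lambda>c x X. - (inverse (f c x) * nablaJ_endo g J \<sigma> J' c x X)) \<and>
    eq_forms \<A> (div_field g J') (\<lambda>c x X. - (inverse ((f c x)\<^sup>2) * nablaJ_form g J \<sigma> \<sigma>0' c x X))"
  let ?ii = "eq_forms \<A> (div_field g (\<lambda>c x. ?Qp c x ** J c x ** ?Jl c x))
      (\<lambda>c x X. - nablaJ_endo g J \<sigma> ?Qp c x X) \<and>
    eq_forms \<A> (div_field g (\<lambda>c x. ?Qm c x ** J c x ** ?Jr c x)) (nablaJ_endo g J \<sigma> ?Qm)"
  let ?iii = "eq_forms \<A> (div_field g ?Qp) (\<lambda>c x X. - (inverse (f c x) * nablaJ_endo g J \<sigma> ?Qp c x X)) \<and>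
    eq_forms \<A> (div_field g ?Qm) (\<lambda>c x X. inverse (f c x) * nablaJ_endo g J \<sigma> ?Qm c x X)"
  have i_iii: "?i \<longleftrightarrow> ?iii"
    unfolding eq_forms_def using i_iff_iii_at by blast
  have ii_iii: "?ii \<longleftrightarrow> ?iii"
    unfolding eq_forms_def using ii_iff_iii_at by blast
  have exact: "exact_form \<A> (div_field (metric_of \<rho> ?Jl) (mess_l_variation \<rho> J \<sigma> J' \<sigma>'))"
    "exact_form \<A> (div_field (metric_of \<rho> ?Jr) (mess_r_variation \<rho> J \<sigma> J' \<sigma>'))" if ?ii
  proof -
    have smooth_primitive: "smooth_on (coords c) (\<lambda>y. trace (H c y ** Q c y ** J c y) / 2)"
      if "c \<in> \<A>" "smooth_on (coords c) (Q c)" for c Q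
      using open_coords[OF that(1)] that smooth(2) smooth_fields(1)
      by (intro smooth_on_divide smooth_on_trace smooth_on_mat2_mult) auto
    show "exact_form \<A> (div_field (metric_of \<rho> ?Jl) (mess_l_variation \<rho> J \<sigma> J' \<sigma>'))"
    proof (rule exact_form_of_chart_functions[OF open_coords])
      show "smooth_on (coords c) (\<lambda>y. trace (H c y ** ?Qp c y ** J c y) / 2)" if "c \<in> \<A>" for c
        by (intro smooth_primitive smooth_on_add open_coords smooth_fields smooth that)
      show "trace (H d (transition c d x) ** ?Qp d (transition c d x) ** J d (transition c d x)) / 2 =
          trace (H c x ** ?Qp c x ** J c x) / 2" if "c \<in> \<A>" "d \<in> \<A>" "x \<in> overlap c d" for c d x
        using trace_invariant[OF that, of 1] by simp
      show "div_field (metric_of \<rho> ?Jl) (mess_l_variation \<rho> J \<sigma> J' \<sigma>') c x X =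
          frechet_derivative (\<lambda>y. trace (H c y ** ?Qp c y ** J c y) / 2) (at x) X"
        if "c \<in> \<A>" "x \<in> coords c" for c x X
        using \<open>?ii\<close> that by (intro mess_l_variation_divergence) (simp_all add: eq_forms_def)
    qed
    show "exact_form \<A> (div_field (metric_of \<rho> ?Jr) (mess_r_variation \<rho> J \<sigma> J' \<sigma>'))"
    proof (rule exact_form_of_chart_functions[OF open_coords])
      show "smooth_on (coords c) (\<lambda>y. trace (H c y ** ?Qm c y ** J c y) / 2)" if "c \<in> \<A>" for c
        by (intro smooth_primitive smooth_on_diff open_coords smooth_fields smooth that)
      show "trace (H d (transition c d x) ** ?Qm d (transition c d x) ** J d (transition c d x)) / 2 =
          trace (H c x ** ?Qm c x ** J c x) / 2" if "c \<in> \<A>" "d \<in> \<A>" "x \<in> overlap c d" for c d x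
        using trace_invariant[OF that, of "- 1"] by simp
      show "div_field (metric_of \<rho> ?Jr) (mess_r_variation \<rho> J \<sigma> J' \<sigma>') c x X =
          frechet_derivative (\<lambda>y. trace (H c y ** ?Qm c y ** J c y) / 2) (at x) X"
        if "c \<in> \<A>" "x \<in> coords c" for c x X
        using \<open>?ii\<close> that by (intro mess_r_variation_divergence) (simp_all add: eq_forms_def)
    qed
  qed
  show ?thesis
    unfolding Let_def using i_iii ii_iii exact by blast
qed

end
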